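(* Let $\mathcal{E}$ be a right Hilbert $C^*$-module over a unital $C^*$-algebra $\mathcal{A}$, let $\mathcal{H},\mathcal{K}$ be Hilbert spaces, and let $\Phi:\mathcal{E}\to\mathcal{B}(\mathcal{H},\mathcal{K})$ be a map. The following statements are equivalent: (i) $\Phi$ is a completely bounded linear map. (ii) There exist a completely positive map $\varphi:\mathcal{A}\to\mathcal{B}(\mathcal{H})$, a Hilbert space $\mathcal{L}$, a $\varphi$-map $\Gamma:\mathcal{E}\to\mathcal{B}(\mathcal{H},\mathcal{L})$ and a bounded operator $S:\mathcal{L}\to\mathcal{K}$ such that $\Phi(x)=S\Gamma(x)$ for all $x\in\mathcal{E}$.
   Context: $\mathcal{B}(\mathcal{H},\mathcal{K})$ denotes the bounded operators from $\mathcal{H}$ to $\mathcal{K}$, and $\mathcal{B}(\mathcal{H})=\mathcal{B}(\mathcal{H},\mathcal{H})$. The $\mathcal{A}$-valued inner product $\langle\cdot,\cdot\rangle$ of $\mathcal{E}$ is conjugate-linear in the first variable and linear in the second. For a completely positive (linear) map $\varphi:\mathcal{A}\to\mathcal{B}(\mathcal{H})$, a map $\Gamma:\mathcal{E}\to\mathcal{B}(\mathcal{H},\mathcal{L})$ (not assumed linear) is called a $\varphi$-map if $\Gamma(x)^*\Gamma(y)=\varphi(\langle x,y\rangle)$ for all $x,y\in\mathcal{E}$. Complete boundedness of $\Phi$ is with respect to the canonical operator space structure on $\mathcal{E}$: $\mathbb{M}_n(\mathcal{E})$ is a Hilbert $\mathbb{M}_n(\mathcal{A})$-module with inner product $\langle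 [x_{ij}],[y_{ij}]\rangle=\big[\sum_k\langle x_{ki},y_{kj}\rangle\big]_{i,j}$ and norm $\|x\|=\|\langle x,x\rangle\|^{1/2}$ (equivalently, the structure inherited from the linking $C^*$-algebra of $\mathcal{E}$), and $\Phi_n:\mathbb{M}_n(\mathcal{E})\to\mathbb{M}_n(\mathcal{B}(\mathcal{H},\mathcal{K}))=\mathcal{B}(\mathcal{H}^n,\mathcal{K}^n)$ is the entrywise application of $\Phi$; $\Phi$ is completely bounded if $\sup_n\|\Phi_n\|<\infty$. *)

theory Defs
  imports "HOL-Analysis.Analysis"
begin

section \<open>Complex normed spaces and Hilbert spaces\<close>

class scaleC = scaleR +
  fixes scaleC :: "complex \<Rightarrow> 'a \<Rightarrow> 'a"  (infixr "*\<^sub>C" 75)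
  assumes scaleR_scaleC: "r *\<^sub>R x = complex_of_real r *\<^sub>C x"

class complex_vector = scaleC + ab_group_add +
  assumes scaleC_add_right: "c *\<^sub>C (x + y) = c *\<^sub>C x + c *\<^sub>C y"
    and scaleC_add_left: "(c + d) *\<^sub>C x = c *\<^sub>C x + d *\<^sub>C x"
    and scaleC_scaleC: "c *\<^sub>C d *\<^sub>C x = (c * d) *\<^sub>C x"
    and scaleC_one: "1 *\<^sub>C x = x"

class complex_normed_vector = complex_vector + real_normed_vector +
  assumes norm_scaleC: "norm (c *\<^sub>C x) = cmod c * norm x"

text \<open>
  Inner products are conjugate-linear in the first and linear in the second variable. The class
  extends \<^class>\<open>real_inner\<close>, whose real inner product is forced to be the real part of the complex
  one; positivity, definiteness and the formula for the norm are then those of \<^class>\<open>real_inner\<close>.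
\<close>

class chilbert_space = complex_normed_vector + real_inner + banach +
  fixes cinner :: "'a \<Rightarrow> 'a \<Rightarrow> complex"
  assumes cinner_commute: "cinner y x = cnj (cinner x y)"
    and cinner_add_right: "cinner x (y + z) = cinner x y + cinner x z"
    and cinner_scaleC_right: "cinner x (c *\<^sub>C y) = c * cinner x y"
    and inner_eq_Re_cinner: "inner x y = Re (cinner x y)"

text \<open>
  A Hilbert space that is existentially quantified in a proposition cannot be a type. It is given
  by the following record instead: a carrier set in some type, with its own operations.
\<close>

record 'l hilbert =
  hcarrier :: "'l set"
  hzero :: 'l
  hadd :: "'l \<Rightarrow> 'l \<Rightarrow> 'l"
  hscale :: "complex \<Rightarrow> 'l \<Rightarrow> 'l"
  hinner :: "'l \<Rightarrow> 'l \<Rightarrow> complex"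

definition hnorm :: "'l hilbert \<Rightarrow> 'l \<Rightarrow> real"
  where "hnorm L x = sqrt (Re (hinner L x x))"

definition hdist :: "'l hilbert \<Rightarrow> 'l \<Rightarrow> 'l \<Rightarrow> real"
  where "hdist L x y = hnorm L (hadd L x (hscale L (- 1) y))"

locale hilbert_space =
  fixes L :: "'l hilbert"
  assumes zero_closed: "hzero L \<in> hcarrier L"
    and add_closed: "\<lbrakk>x \<in> hcarrier L; y \<in> hcarrier L\<rbrakk> \<Longrightarrow> hadd L x y \<in> hcarrier L"
    and scale_closed: "x \<in> hcarrier L \<Longrightarrow> hscale L c x \<in> hcarrier L"
    and add_assoc: "\<lbrakk>x \<in> hcarrier L; y \<in> hcarrier L; z \<in> hcarrier L\<rbrakk>
      \<Longrightarrow> hadd L (hadd L x y) z = hadd L x (hadd L y z)"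
    and add_commute: "\<lbrakk>x \<in> hcarrier L; y \<in> hcarrier L\<rbrakk> \<Longrightarrow> hadd L x y = hadd L y x"
    and add_zero: "x \<in> hcarrier L \<Longrightarrow> hadd L x (hzero L) = x"
    and add_inverse: "x \<in> hcarrier L \<Longrightarrow> hadd L x (hscale L (- 1) x) = hzero L"
    and scale_add_right: "\<lbrakk>x \<in> hcarrier L; y \<in> hcarrier L\<rbrakk>
      \<Longrightarrow> hscale L c (hadd L x y) = hadd L (hscale L c x) (hscale L c y)"
    and scale_add_left: "x \<in> hcarrier L
      \<Longrightarrow> hscale L (c + d) x = hadd L (hscale L c x) (hscale L d x)"
    and scale_scale: "x \<in> hcarrier L \<Longrightarrow> hscale L c (hscale L d x) = hscale L (c * d) x"
    and scale_one: "x \<in> hcarrier L \<Longrightarrow> hscale L 1 x = x"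
    and inner_commute: "\<lbrakk>x \<in> hcarrier L; y \<in> hcarrier L\<rbrakk> \<Longrightarrow> hinner L y x = cnj (hinner L x y)"
    and inner_add_right: "\<lbrakk>x \<in> hcarrier L; y \<in> hcarrier L; z \<in> hcarrier L\<rbrakk>
      \<Longrightarrow> hinner L x (hadd L y z) = hinner L x y + hinner L x z"
    and inner_scale_right: "\<lbrakk>x \<in> hcarrier L; y \<in> hcarrier L\<rbrakk>
      \<Longrightarrow> hinner L x (hscale L c y) = c * hinner L x y"
    and inner_nonneg: "x \<in> hcarrier L \<Longrightarrow> 0 \<le> Re (hinner L x x)"
    and inner_definite: "\<lbrakk>x \<in> hcarrier L; hinner L x x = 0\<rbrakk> \<Longrightarrow> x = hzero L"
    and complete: "\<lbrakk>\<And>n. f n \<in> hcarrier L;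
        \<forall>e>0. \<exists>N::nat. \<forall>m\<ge>N. \<forall>n\<ge>N. hdist L (f m) (f n) < e\<rbrakk>
      \<Longrightarrow> \<exists>l\<in>hcarrier L. (\<lambda>n. hdist L (f n) l) \<longlonglongrightarrow> 0"

definition type_hilbert :: "'h::chilbert_space hilbert"
  where "type_hilbert =
    \<lparr>hcarrier = UNIV, hzero = 0, hadd = (+), hscale = scaleC, hinner = cinner\<rparr>"

lemma scaleC_minus_one: "(- 1) *\<^sub>C x = - (x :: 'a::complex_normed_vector)"
  using scaleR_scaleC[of "-1" x] by simp

lemma hnorm_type_hilbert: "hnorm type_hilbert x = norm x"
  by (simp add: hnorm_def type_hilbert_def norm_eq_sqrt_inner inner_eq_Re_cinner)

lemma hdist_type_hilbert: "hdist type_hilbert x y = dist x y"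
  by (simp add: hdist_def hnorm_type_hilbert)
     (simp add: type_hilbert_def scaleC_minus_one dist_norm)

lemma hilbert_space_type_hilbert: "hilbert_space (type_hilbert :: 'h::chilbert_space hilbert)"
proof
  fix f :: "nat \<Rightarrow> 'h"
  assume "\<forall>e>0. \<exists>N. \<forall>m\<ge>N. \<forall>n\<ge>N. hdist type_hilbert (f m) (f n) < e"
  then have "Cauchy f"
    by (simp add: hdist_type_hilbert Cauchy_def)
  then obtain l where "f \<longlonglongrightarrow> l"
    using Cauchy_convergent convergent_def by blast
  then show "\<exists>l\<in>hcarrier type_hilbert. (\<lambda>n. hdist type_hilbert (f n) l) \<longlonglongrightarrow> 0"
    unfolding hdist_type_hilbert using tendsto_dist_iff[of f l sequentially]
    by (auto simp: type_hilbert_def)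
next
  fix x :: 'h
  assume "hinner type_hilbert x x = 0"
  then have "inner x x = 0"
    by (simp add: type_hilbert_def inner_eq_Re_cinner)
  then show "x = hzero type_hilbert"
    by (simp add: type_hilbert_def)
next
  fix x :: 'h
  show "0 \<le> Re (hinner type_hilbert x x)"
    by (simp add: type_hilbert_def flip: inner_eq_Re_cinner)
next
  fix x y :: 'h
  show "hinner type_hilbert y x = cnj (hinner type_hilbert x y)"
    unfolding type_hilbert_def hilbert.simps by (rule cinner_commute)
qed (simp_all add: type_hilbert_def algebra_simps scaleC_add_right scaleC_add_left scaleC_scaleC scaleC_one
       scaleC_minus_one cinner_add_right cinner_scaleC_right)

text \<open>
  \<open>bounded_operator H K T\<close> says that \<open>T\<close> belongs to \<open>\<B>(H,K)\<close>; values of \<open>T\<close> off the carrier of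
  \<open>H\<close> are irrelevant. By the Riesz theorem \<open>hadjoint H K T\<close> is the usual adjoint on the carrier of
  \<open>K\<close>, when \<open>H\<close> and \<open>K\<close> are Hilbert spaces and \<open>T\<close> is bounded.
\<close>

definition bounded_operator :: "'h hilbert \<Rightarrow> 'k hilbert \<Rightarrow> ('h \<Rightarrow> 'k) \<Rightarrow> bool"
  where "bounded_operator H K T \<longleftrightarrow>
    (\<forall>x\<in>hcarrier H. T x \<in> hcarrier K) \<and>
    (\<forall>x\<in>hcarrier H. \<forall>y\<in>hcarrier H. T (hadd H x y) = hadd K (T x) (T y)) \<and>
    (\<forall>c. \<forall>x\<in>hcarrier H. T (hscale H c x) = hscale K c (T x)) \<and>
    (\<exists>C. \<forall>x\<in>hcarrier H. hnorm K (T x) \<le> C * hnorm H x)"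

definition hadjoint :: "'h hilbert \<Rightarrow> 'k hilbert \<Rightarrow> ('h \<Rightarrow> 'k) \<Rightarrow> 'k \<Rightarrow> 'h"
  where "hadjoint H K T k =
    (THE h. h \<in> hcarrier H \<and> (\<forall>g\<in>hcarrier H. hinner H h g = hinner K k (T g)))"


section \<open>Hilbert modules over unital C*-algebras\<close>

text \<open>The zero algebra is not excluded: there is no axiom \<open>0 \<noteq> 1\<close>.\<close>

class unital_cstar_algebra =
  complex_normed_vector + real_normed_algebra + banach + monoid_mult +
  fixes star :: "'a \<Rightarrow> 'a"
  assumes scaleC_mult_left: "(c *\<^sub>C a) * b = c *\<^sub>C (a * b)"
    and scaleC_mult_right: "a * (c *\<^sub>C b) = c *\<^sub>C (a * b)"
    and star_star: "star (star a) = a"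
    and star_add: "star (a + b) = star a + star b"
    and star_scaleC: "star (c *\<^sub>C a) = cnj c *\<^sub>C star a"
    and star_mult: "star (a * b) = star b * star a"
    and cstar_identity: "norm (star a * a) = (norm a)\<^sup>2"

locale hilbert_cstar_module =
  fixes act :: "'e::{complex_normed_vector,banach} \<Rightarrow> 'a::unital_cstar_algebra \<Rightarrow> 'e"
    and ip :: "'e \<Rightarrow> 'e \<Rightarrow> 'a"
  assumes act_add_left: "act (x + y) a = act x a + act y a"
    and act_add_right: "act x (a + b) = act x a + act x b"
    and act_mult: "act x (a * b) = act (act x a) b"
    and act_one: "act x 1 = x"
    and act_scaleC_left: "act (c *\<^sub>C x) a = c *\<^sub>C act x a"
    and act_scaleC_right: "act x (c *\<^sub>C a) = c *\<^sub>C act x a"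
    and ip_add_right: "ip x (y + z) = ip x y + ip x z"
    and ip_scaleC_right: "ip x (c *\<^sub>C y) = c *\<^sub>C ip x y"
    and ip_act_right: "ip x (act y a) = ip x y * a"
    and ip_star: "ip y x = star (ip x y)"
    and ip_positive: "\<exists>b. ip x x = star b * b"
    and ip_definite: "ip x x = 0 \<Longrightarrow> x = 0"
    and norm_ip: "norm x = sqrt (norm (ip x x))"


section \<open>Matrices and completely positive maps\<close>

text \<open>
  An \<open>n\<close> by \<open>n\<close> matrix is a function on pairs of natural numbers of which only the values at
  indices below \<open>n\<close> matter; likewise for vectors of length \<open>n\<close>. The size \<open>n = 0\<close> is harmlessly
  allowed.
\<close>

definition cstar_matrix_positive ::
    "nat \<Rightarrow> (nat \<Rightarrow> nat \<Rightarrow> 'a::unital_cstar_algebra) \<Rightarrow> bool"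
  where "cstar_matrix_positive n a \<longleftrightarrow>
    (\<exists>b. \<forall>i<n. \<forall>j<n. a i j = (\<Sum>k<n. star (b k i) * b k j))"

definition operator_matrix_positive ::
    "nat \<Rightarrow> (nat \<Rightarrow> nat \<Rightarrow> 'h::chilbert_space \<Rightarrow> 'h) \<Rightarrow> bool"
  where "operator_matrix_positive n T \<longleftrightarrow>
    (\<forall>h. (\<Sum>i<n. cinner (h i) (\<Sum>j<n. T i j (h j))) \<in> \<real>\<^sub>\<ge>\<^sub>0)"

definition linear_into_operators ::
    "('v::complex_vector \<Rightarrow> 'h \<Rightarrow> 'k::complex_vector) \<Rightarrow> bool"
  where "linear_into_operators F \<longleftrightarrow>
    (\<forall>x y h. F (x + y) h = F x h + F y h) \<and> (\<forall>c x h. F (c *\<^sub>C x) h = c *\<^sub>C F x h)"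

definition completely_positive ::
    "('a::unital_cstar_algebra \<Rightarrow> 'h::chilbert_space \<Rightarrow> 'h) \<Rightarrow> bool"
  where "completely_positive \<phi> \<longleftrightarrow>
    (\<forall>a. bounded_operator type_hilbert type_hilbert (\<phi> a)) \<and>
    linear_into_operators \<phi> \<and>
    (\<forall>n a. cstar_matrix_positive n a \<longrightarrow> operator_matrix_positive n (\<lambda>i j. \<phi> (a i j)))"


section \<open>Completely bounded maps\<close>

text \<open>
  The C*-norm of \<open>M\<^sub>n(A)\<close> is its operator norm on the Hilbert module \<open>A\<^sup>n\<close>, whose inner product is
  \<open>\<langle>\<xi>,\<eta>\<rangle> = \<Sum>\<^sub>i \<xi>\<^sub>i\<^sup>* \<eta>\<^sub>i\<close>. The supremum is over a nonempty bounded set of reals; the same holds for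
  \<open>operator_matrix_norm\<close> when the entries are bounded operators.
\<close>

definition column_norm :: "nat \<Rightarrow> (nat \<Rightarrow> 'a::unital_cstar_algebra) \<Rightarrow> real"
  where "column_norm n \<xi> = sqrt (norm (\<Sum>i<n. star (\<xi> i) * \<xi> i))"

definition cstar_matrix_norm :: "nat \<Rightarrow> (nat \<Rightarrow> nat \<Rightarrow> 'a::unital_cstar_algebra) \<Rightarrow> real"
  where "cstar_matrix_norm n a =
    (SUP \<xi>\<in>{\<xi>. column_norm n \<xi> \<le> 1}. column_norm n (\<lambda>i. \<Sum>j<n. a i j * \<xi> j))"

definition module_matrix_ip ::
    "('e \<Rightarrow> 'e \<Rightarrow> 'a::unital_cstar_algebra) \<Rightarrow> nat
      \<Rightarrow> (nat \<Rightarrow> nat \<Rightarrow> 'e) \<Rightarrow> (nat \<Rightarrow> nat \<Rightarrow> 'e) \<Rightarrow> nat \<Rightarrow> nat \<Rightarrow> 'a"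
  where "module_matrix_ip ip n x y = (\<lambda>i j. \<Sum>k<n. ip (x k i) (y k j))"

definition module_matrix_norm ::
    "('e \<Rightarrow> 'e \<Rightarrow> 'a::unital_cstar_algebra) \<Rightarrow> nat \<Rightarrow> (nat \<Rightarrow> nat \<Rightarrow> 'e) \<Rightarrow> real"
  where "module_matrix_norm ip n x = sqrt (cstar_matrix_norm n (module_matrix_ip ip n x x))"

definition direct_sum_norm :: "nat \<Rightarrow> (nat \<Rightarrow> 'h::chilbert_space) \<Rightarrow> real"
  where "direct_sum_norm n h = sqrt (\<Sum>i<n. (norm (h i))\<^sup>2)"

definition operator_matrix_norm ::
    "nat \<Rightarrow> (nat \<Rightarrow> nat \<Rightarrow> 'h::chilbert_space \<Rightarrow> 'k::chilbert_space) \<Rightarrow> real"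
  where "operator_matrix_norm n T =
    (SUP h\<in>{h. direct_sum_norm n h \<le> 1}. direct_sum_norm n (\<lambda>i. \<Sum>j<n. T i j (h j)))"

definition amplification_norm ::
    "('e \<Rightarrow> 'e \<Rightarrow> 'a::unital_cstar_algebra)
      \<Rightarrow> ('e \<Rightarrow> 'h::chilbert_space \<Rightarrow> 'k::chilbert_space) \<Rightarrow> nat \<Rightarrow> ereal"
  where "amplification_norm ip \<Phi> n =
    (SUP x\<in>{x. module_matrix_norm ip n x \<le> 1}. ereal (operator_matrix_norm n (\<lambda>i j. \<Phi> (x i j))))"

definition completely_bounded ::
    "('e \<Rightarrow> 'e \<Rightarrow> 'a::unital_cstar_algebra)
      \<Rightarrow> ('e \<Rightarrow> 'h::chilbert_space \<Rightarrow> 'k::chilbert_space) \<Rightarrow> bool"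
  where "completely_bounded ip \<Phi> \<longleftrightarrow> (SUP n. amplification_norm ip \<Phi> n) < \<infinity>"


section \<open>Maps over a completely positive map\<close>

definition phi_map ::
    "('e \<Rightarrow> 'e \<Rightarrow> 'a) \<Rightarrow> ('a \<Rightarrow> 'h::chilbert_space \<Rightarrow> 'h) \<Rightarrow> 'l hilbert \<Rightarrow> ('e \<Rightarrow> 'h \<Rightarrow> 'l) \<Rightarrow> bool"
  where "phi_map ip \<phi> L \<Gamma> \<longleftrightarrow>
    (\<forall>x. bounded_operator type_hilbert L (\<Gamma> x)) \<and>
    (\<forall>x y. hadjoint type_hilbert L (\<Gamma> x) \<circ> \<Gamma> y = \<phi> (ip x y))"

text \<open>
  The last argument is the type in which the carrier of the Hilbert space \<open>L\<close> lives. The type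
  \<open>'e \<times> 'h \<Rightarrow> complex\<close> always suffices: \<open>L\<close> may be replaced by the closed span of the vectors
  \<open>\<Gamma> x h\<close>, which is unitarily equivalent to a reproducing kernel space of functions of \<open>(x, h)\<close>.
\<close>

definition factors_through_phi_map ::
    "('e \<Rightarrow> 'e \<Rightarrow> 'a::unital_cstar_algebra)
      \<Rightarrow> ('e \<Rightarrow> 'h::chilbert_space \<Rightarrow> 'k::chilbert_space) \<Rightarrow> 'l itself \<Rightarrow> bool"
  where "factors_through_phi_map ip \<Phi> (_ :: 'l itself) \<longleftrightarrow>
    (\<exists>\<phi> (L :: 'l hilbert) \<Gamma> S.
      completely_positive \<phi> \<and> hilbert_space L \<and> phi_map ip \<phi> L \<Gamma> \<and>
      bounded_operator L type_hilbert S \<and> (\<forall>x. \<Phi> x = S \<circ> \<Gamma> x))"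

end

theory Submission
  imports Defs "HOL-Library.Function_Algebras"
begin

text \<open>
  If \<open>\<Phi> = S\<Gamma>\<close>, then \<open>\<parallel>\<Phi>\<^sub>n(x)h\<parallel>\<^sup>2 \<le> \<parallel>S\<parallel>\<^sup>2 \<langle>h, \<phi>\<^sub>n(\<langle>x, x\<rangle>)h\<rangle>\<close>, and \<open>\<phi>\<^sub>n(\<langle>x, x\<rangle>) \<le> \<phi>\<^sub>n(1)\<close> when
  \<open>\<parallel>x\<parallel> \<le> 1\<close>, because \<open>1 - \<langle>x, x\<rangle>\<close> has a square root given by a power series.

  Conversely, what has to be found is a completely positive \<open>\<phi>\<close> with
  \<open>\<parallel>\<Sum>\<^sub>j \<Phi>(x\<^sub>j)h\<^sub>j\<parallel>\<^sup>2 \<le> \<Sum>\<^sub>i\<^sub>j \<langle>h\<^sub>i, \<phi>(\<langle>x\<^sub>i, x\<^sub>j\<rangle>)h\<^sub>j\<rangle>\<close>; the space \<open>L\<close> is then the completion of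
  \<open>E \<otimes> H\<close> for the form on the right, \<open>\<Gamma>(x)h = x \<otimes> h\<close> and \<open>S(x \<otimes> h) = \<Phi>(x)h\<close>. Instead of extending
  \<open>\<Phi>\<close> to the linking algebra, \<open>\<phi>\<close> is obtained from a real functional on kernels that is dominated by
  a sublinear one (Hahn-Banach). That the latter is finite amounts to the following: if a sum of
  positive kernels and of Gram kernels of tensors \<open>X\<^sub>m\<close> equals \<open>\<Sum>\<^sub>k g\<^sub>k \<otimes> 1 \<otimes> g\<^sub>k\<^sup>*\<close>, then
  \<open>\<Sum>\<^sub>m \<parallel>\<Phi>(X\<^sub>m)\<parallel>\<^sup>2 \<le> c\<^sup>2 \<Sum>\<^sub>k \<parallel>g\<^sub>k\<parallel>\<^sup>2\<close>. This is the definition of complete boundedness, applied to the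
  matrix of the \<open>X\<^sub>m\<close> in a basis that is orthonormal for the right-hand side.
\<close>

section \<open>Power series of the square root\<close>

text \<open>\<open>ip x x\<close> is only known to be some \<open>star b * b\<close>, so the order
  of a C*-algebra has to be built first. Spectra do not occur; the tool throughout is the binomial
  series of sqrt(1 - a). Its coefficients \<open>sqrt_coeff\<close> are absolutely summable, so norm
  a = 1 is included, and it can be summed entry by entry for matrices.

  The Hahn-Banach functional is only real linear and stands for Re <h, \<phi>(a) k>. Complex
  linearity of \<phi> and its compatibility with \<open>star\<close> reappear because scalars can be
  moved between the factors of an elementary kernel and because skew kernels are bounded by 0 in
  both directions.

  The delicate point is that the kernel 0 has no negative bound. The form given by the g_k is
  degenerate, and the tensors must first be shown to vanish on its null space; this holds since
  positive elements with sum 0 are all 0. What remains has finite rank, and an orthonormal family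
  turns the identity of kernels into one of matrices, which makes the matrix of the tensors a
  contraction over E.\<close>

definition sqrt_coeff :: "nat \<Rightarrow> real"
  where "sqrt_coeff k = (-1) ^ k * ((1/2) gchoose k)"

text \<open>With the sign absorbed, signs are read off from the factor (k - a) / (k + 1): negative
  only at k = 0 for a = 1/2, never negative for a = -1/2.\<close>

lemma signed_gbinomial_Suc:
  "(-1) ^ Suc k * (a gchoose Suc k) = (-1) ^ k * (a gchoose k) * ((real k - a) / (real k + 1))"
  for a :: real
  by (simp add: gbinomial_prod_rev field_simps)

lemma sqrt_coeff_0 [simp]: "sqrt_coeff 0 = 1"
  by (simp add: sqrt_coeff_def)

lemma sqrt_coeff_Suc_nonpos: "sqrt_coeff (Suc k) \<le> 0"
proof (induction k)
  case 0
  show ?case by (simp add: sqrt_coeff_def)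
next
  case (Suc k)
  have "sqrt_coeff (Suc (Suc k)) = sqrt_coeff (Suc k) * ((real (Suc k) - 1/2) / (real (Suc k) + 1))"
    unfolding sqrt_coeff_def by (rule signed_gbinomial_Suc)
  with Suc show ?case by (simp add: mult_nonpos_nonneg divide_nonpos_nonneg)
qed

text \<open>These are the coefficients of (1 - x)^(-1/2) = (1 - x)^(1/2) / (1 - x), hence the
  partial sums of \<open>sqrt_coeff\<close>.\<close>

lemma signed_gbinomial_neg_half_nonneg: "0 \<le> (-1) ^ k * (((-1/2)::real) gchoose k)"
proof (induction k)
  case (Suc k)
  have "(-1) ^ Suc k * (((-1/2)::real) gchoose Suc k)
      = (-1) ^ k * (((-1/2)::real) gchoose k) * ((real k - (-1/2)) / (real k + 1))"
    by (rule signed_gbinomial_Suc)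
  with Suc show ?case by simp
qed simp

lemma sum_sqrt_coeff_nonneg: "0 \<le> (\<Sum>k\<le>n. sqrt_coeff k)"
proof -
  have "(\<Sum>k\<le>n. sqrt_coeff k) = (-1) ^ n * (((-1/2)::real) gchoose n)"
    using gbinomial_sum_lower_neg[of "1/2::real" n] by (simp add: sqrt_coeff_def mult.commute)
  then show ?thesis
    using signed_gbinomial_neg_half_nonneg[of n] by simp
qed

text \<open>All coefficients after the first are nonpositive, so their absolute sum is 1 minus a
  partial sum of \<open>sqrt_coeff\<close>.\<close>

lemma sum_abs_sqrt_coeff_Suc: "(\<Sum>k<n. \<bar>sqrt_coeff (Suc k)\<bar>) \<le> 1"
proof -
  have "(\<Sum>k<n. \<bar>sqrt_coeff (Suc k)\<bar>) = - (\<Sum>k<n. sqrt_coeff (Suc k))"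
    by (simp add: sum_negf abs_of_nonpos[OF sqrt_coeff_Suc_nonpos])
  moreover have "(\<Sum>k\<le>n. sqrt_coeff k) = 1 + (\<Sum>k<n. sqrt_coeff (Suc k))"
    by (simp add: sum.atMost_shift)
  ultimately show ?thesis
    using sum_sqrt_coeff_nonneg[of n] by linarith
qed

lemma summable_abs_sqrt_coeff_Suc: "summable (\<lambda>k. \<bar>sqrt_coeff (Suc k)\<bar>)"
  by (rule summableI_nonneg_bounded[where x = 1]) (auto simp: sum_abs_sqrt_coeff_Suc)

lemma suminf_abs_sqrt_coeff_Suc: "(\<Sum>k. \<bar>sqrt_coeff (Suc k)\<bar>) \<le> 1"
  by (rule suminf_le_const[OF summable_abs_sqrt_coeff_Suc sum_abs_sqrt_coeff_Suc])

lemma summable_abs_sqrt_coeff: "summable (\<lambda>k. \<bar>sqrt_coeff k\<bar>)"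
  using summable_abs_sqrt_coeff_Suc by (subst (asm) summable_Suc_iff)

text \<open>The square of the series is 1 - x: Vandermonde turns the convolution for the exponent
  1/2 into the binomial coefficients of the exponent 1.\<close>

lemma sqrt_coeff_convolution:
  "(\<Sum>i\<le>k. sqrt_coeff i * sqrt_coeff (k - i)) = (if k = 0 then 1 else if k = 1 then - 1 else 0)"
proof -
  have "(\<Sum>i\<le>k. sqrt_coeff i * sqrt_coeff (k - i))
      = (-1) ^ k * (\<Sum>i\<in>{0..k}. ((1/2::real) gchoose i) * ((1/2) gchoose (k - i)))"
    unfolding sum_distrib_left atMost_atLeast0
    by (rule sum.cong) (auto simp: sqrt_coeff_def simp flip: power_add)
  also have "\<dots> = (-1) ^ k * ((1::real) gchoose k)"
    by (simp add: gbinomial_Vandermonde)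
  also have "(1::real) gchoose k = of_nat (1 choose k)"
    using binomial_gbinomial[of 1 k, where ?'a = real] by simp
  also have "(-1) ^ k * real (1 choose k) = (if k = 0 then 1 else if k = 1 then - 1 else 0)"
    by (cases k rule: nat.exhaust) (auto simp: binomial_eq_0 split: nat.split)
  finally show ?thesis .
qed

lemma summable_norm_sqrt_series:
  fixes u :: "nat \<Rightarrow> 'a::real_normed_vector"
  assumes "\<And>k. norm (u k) \<le> 1"
  shows "summable (\<lambda>k. norm (sqrt_coeff k *\<^sub>R u k))"
  by (rule summable_comparison_test'[OF summable_abs_sqrt_coeff, of 0])
     (simp add: mult_left_le assms)

lemma summable_sqrt_series:
  fixes u :: "nat \<Rightarrow> 'a::banach"
  assumes "\<And>k. norm (u k) \<le> 1"
  shows "summable (\<lambda>k. sqrt_coeff k *\<^sub>R u k)"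
  by (rule summable_norm_cancel[OF summable_norm_sqrt_series[OF assms]])

text \<open>Here \<open>u k\<close> is the \<open>k\<close>-th power of a matrix, and the series is the square root of \<open>1 - u 1\<close>.\<close>

lemma sqrt_series_square:
  fixes u :: "nat \<Rightarrow> nat \<Rightarrow> nat \<Rightarrow> 'a::{real_normed_algebra,banach}"
  assumes bound: "\<And>k i j. i < n \<Longrightarrow> j < n \<Longrightarrow> norm (u k i j) \<le> 1"
    and mult: "\<And>k m i j. i < n \<Longrightarrow> j < n \<Longrightarrow> (\<Sum>l<n. u k i l * u m l j) = u (k + m) i j"
    and ij: "i < n" "j < n"
  shows "(\<Sum>l<n. (\<Sum>k. sqrt_coeff k *\<^sub>R u k i l) * (\<Sum>k. sqrt_coeff k *\<^sub>R u k l j)) = u 0 i j - u 1 i j"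
    (is "(\<Sum>l<n. ?b i l * ?b l j) = _")
proof -
  let ?t = "\<lambda>l k m. (sqrt_coeff k *\<^sub>R u k i l) * (sqrt_coeff m *\<^sub>R u m l j)"
  have "(\<lambda>k. \<Sum>m\<le>k. ?t l m (k - m)) sums (?b i l * ?b l j)" if "l < n" for l
    using that ij by (intro Cauchy_product_sums summable_norm_sqrt_series bound)
  then have "(\<lambda>k. \<Sum>l<n. \<Sum>m\<le>k. ?t l m (k - m)) sums (\<Sum>l<n. ?b i l * ?b l j)"
    by (intro sums_sum) auto
  moreover have "(\<Sum>l<n. \<Sum>m\<le>k. ?t l m (k - m)) = (if k = 0 then u 0 i j else if k = 1 then - u 1 i j else 0)"
    for k
  proof -
    have "(\<Sum>l<n. \<Sum>m\<le>k. ?t l m (k - m))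
        = (\<Sum>m\<le>k. (sqrt_coeff m * sqrt_coeff (k - m)) *\<^sub>R (\<Sum>l<n. u m i l * u (k - m) l j))"
      by (subst sum.swap) (simp add: scaleR_sum_right mult.commute)
    also have "\<dots> = (\<Sum>m\<le>k. (sqrt_coeff m * sqrt_coeff (k - m)) *\<^sub>R u k i j)"
      by (intro sum.cong) (auto simp: mult ij)
    also have "\<dots> = (\<Sum>m\<le>k. sqrt_coeff m * sqrt_coeff (k - m)) *\<^sub>R u k i j"
      by (simp add: scaleR_sum_left)
    finally show ?thesis
      by (simp add: sqrt_coeff_convolution)
  qed
  ultimately have "(\<lambda>k. if k = 0 then u 0 i j else if k = 1 then - u 1 i j else 0)
      sums (\<Sum>l<n. ?b i l * ?b l j)"
    by simp
  moreover have "(\<lambda>k. if k = 0 then u 0 i j else if k = 1 then - u 1 i j else 0) sums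
      (\<Sum>k\<in>{0,1::nat}. if k = 0 then u 0 i j else if k = 1 then - u 1 i j else 0)"
    by (rule sums_finite) auto
  ultimately show ?thesis
    by (auto dest: sums_unique2)
qed


section \<open>Complex vector spaces and Hilbert spaces\<close>

lemma scaleC_zero_right [simp]: "c *\<^sub>C (0::'a::complex_vector) = 0"
  using scaleC_add_right[of c 0 0] by simp

lemma scaleC_zero_left [simp]: "0 *\<^sub>C (x::'a::complex_vector) = 0"
  using scaleC_add_left[of 0 0 x] by simp

lemma scaleC_minus_left [simp]: "(- c) *\<^sub>C (x::'a::complex_vector) = - (c *\<^sub>C x)"
  using scaleC_add_left[of c "-c" x] by (simp add: eq_neg_iff_add_eq_0 add.commute)

lemma scaleC_minus_right [simp]: "c *\<^sub>C (- x::'a::complex_vector) = - (c *\<^sub>C x)"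
  using scaleC_add_right[of c x "-x"] by (simp add: eq_neg_iff_add_eq_0 add.commute)

lemma scaleC_diff_right: "c *\<^sub>C (x - y::'a::complex_vector) = c *\<^sub>C x - c *\<^sub>C y"
  using scaleC_add_right[of c x "-y"] by simp

lemma scaleC_sum_right: "c *\<^sub>C (\<Sum>i\<in>I. f i) = (\<Sum>i\<in>I. c *\<^sub>C (f i::'a::complex_vector))"
  by (induction I rule: infinite_finite_induct) (simp_all add: scaleC_add_right)

lemma scaleC_scaleR [simp]: "c *\<^sub>C r *\<^sub>R x = r *\<^sub>R c *\<^sub>C (x::'a::complex_vector)"
  by (simp add: scaleR_scaleC scaleC_scaleC mult.commute)

section \<open>Rules for the complex inner product\<close>

lemma cinner_add_left: "cinner (x + y) z = cinner x z + cinner y (z::'a::chilbert_space)"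
  by (subst (1 2 3) cinner_commute) (simp add: cinner_add_right)

lemma cinner_scaleC_left: "cinner (c *\<^sub>C x) z = cnj c * cinner x (z::'a::chilbert_space)"
  by (subst (1 2) cinner_commute) (simp add: cinner_scaleC_right)

lemma cinner_zero_right [simp]: "cinner x (0::'a::chilbert_space) = 0"
  using cinner_add_right[of x 0 0] by simp

lemma cinner_zero_left [simp]: "cinner 0 (x::'a::chilbert_space) = 0"
  using cinner_add_left[of 0 0 x] by simp

lemma cinner_minus_right [simp]: "cinner x (- y) = - cinner x (y::'a::chilbert_space)"
  using cinner_add_right[of x y "-y"] by (simp add: eq_neg_iff_add_eq_0 add.commute)

lemma cinner_diff_right: "cinner x (y - z) = cinner x y - cinner x (z::'a::chilbert_space)"
  using cinner_add_right[of x y "-z"] by simp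

lemma cinner_scaleR_right: "cinner x (r *\<^sub>R y) = of_real r * cinner x (y::'a::chilbert_space)"
  by (simp add: scaleR_scaleC cinner_scaleC_right)

lemma cinner_scaleR_left: "cinner (r *\<^sub>R x) y = of_real r * cinner x (y::'a::chilbert_space)"
  by (simp add: scaleR_scaleC cinner_scaleC_left)

lemma cinner_sum_right: "cinner x (\<Sum>i\<in>I. f i) = (\<Sum>i\<in>I. cinner x (f i::'a::chilbert_space))"
  by (induction I rule: infinite_finite_induct) (simp_all add: cinner_add_right)

lemma cinner_sum_left: "cinner (\<Sum>i\<in>I. f i) x = (\<Sum>i\<in>I. cinner (f i::'a::chilbert_space) x)"
  by (induction I rule: infinite_finite_induct) (simp_all add: cinner_add_left)

lemma Re_cinner_self: "Re (cinner x x) = (norm (x::'a::chilbert_space))\<^sup>2"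
  by (simp add: power2_norm_eq_inner inner_eq_Re_cinner)

lemma cinner_self: "cinner x x = of_real ((norm (x::'a::chilbert_space))\<^sup>2)"
proof -
  have "Im (cinner x x) = 0"
    using arg_cong[OF cinner_commute[of x x], of Im] by simp
  then show ?thesis
    by (simp add: complex_eq_iff Re_cinner_self)
qed

lemma Re_cinner_eqI:
  assumes "\<And>h. Re (cinner h x) = Re (cinner h (y::'a::chilbert_space))"
  shows "x = y"
  using assms vector_eq_ldot[of x y] by (simp add: inner_eq_Re_cinner)

lemma cinner_eqI:
  assumes "\<And>h. cinner h x = cinner h (y::'a::chilbert_space)"
  shows "x = y"
  by (rule Re_cinner_eqI) (simp add: assms)

section \<open>Positive elements of a unital C*-algebra\<close>

context unital_cstar_algebra
begin

lemma star_zero [simp]: "star 0 = 0"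
  using star_add[of 0 0] by simp

lemma star_minus [simp]: "star (- a) = - star a"
  using star_add[of a "- a"] by (simp add: eq_neg_iff_add_eq_0 add.commute)

lemma star_diff: "star (a - b) = star a - star b"
  using star_add[of a "- b"] by simp

lemma star_one [simp]: "star 1 = 1"
  using star_mult[of "star 1" 1] star_star[of 1] by simp

lemma star_scaleR: "star (r *\<^sub>R a) = r *\<^sub>R star a"
  by (simp add: scaleR_scaleC star_scaleC)

lemma star_sum: "star (\<Sum>i\<in>I. f i) = (\<Sum>i\<in>I. star (f i))"
  by (induction I rule: infinite_finite_induct) (simp_all add: star_add)

lemma star_power: "star (a ^ n) = star a ^ n"
  by (induction n) (simp_all add: star_mult power_commutes)

end

lemma norm_star [simp]: "norm (star a) = norm (a::'a::unital_cstar_algebra)"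
proof -
  have *: "norm b \<le> norm (star b)" for b :: 'a
  proof (cases "norm b = 0")
    case False
    have "norm b * norm b \<le> norm (star b) * norm b"
      using norm_mult_ineq[of "star b" b] unfolding cstar_identity by (simp only: power2_eq_square)
    with False show ?thesis
      by simp
  qed simp
  from *[of a] *[of "star a"] show ?thesis
    by (simp add: star_star)
qed

lemma bounded_linear_star: "bounded_linear (star :: 'a \<Rightarrow> 'a::unital_cstar_algebra)"
  by (rule bounded_linear_intro[where K = 1]) (simp_all add: star_add star_scaleR)

lemma norm_one_le: "norm (1::'a::unital_cstar_algebra) \<le> 1"
proof (cases "norm (1::'a) = 0")
  case False
  have "norm (1::'a) = norm (1::'a) * norm (1::'a)"
    using cstar_identity[of "1::'a"] by (simp add: power2_eq_square)
  with False show ?thesis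
    by simp
qed simp

lemma norm_power_le_one:
  assumes "norm (a::'a::unital_cstar_algebra) \<le> 1"
  shows "norm (a ^ k) \<le> 1"
proof (induction k)
  case 0
  show ?case by (simp add: norm_one_le)
next
  case (Suc k)
  have "norm (a ^ Suc k) \<le> norm a * norm (a ^ k)"
    by (simp add: norm_mult_ineq)
  also have "\<dots> \<le> 1 * 1"
    using assms Suc by (intro mult_mono) auto
  finally show ?case by simp
qed

lemma norm_square_self_adjoint:
  "star a = a \<Longrightarrow> norm (a * a) = (norm (a::'a::unital_cstar_algebra))\<^sup>2"
  using cstar_identity[of a] by simp

lemma self_adjoint_square_eq_0:
  assumes "star a = (a::'a::unital_cstar_algebra)" "a * a = 0"
  shows "a = 0"
  using norm_square_self_adjoint[OF assms(1)] assms(2) by simp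

text \<open>The square root of \<open>1 - a\<close> is a norm limit of polynomials in \<open>a\<close>, hence lies in the bicommutant.\<close>

lemma sqrt_one_minus:
  fixes a :: "'a::unital_cstar_algebra"
  assumes sa: "star a = a" and le: "norm a \<le> 1"
  obtains c where "star c = c" "c * c = 1 - a" "norm (1 - c) \<le> 1"
    "\<And>d. d * a = a * d \<Longrightarrow> d * c = c * d"
proof
  define c where "c = (\<Sum>k. sqrt_coeff k *\<^sub>R a ^ k)"
  note bound = norm_power_le_one[OF le]
  note summ = summable_sqrt_series[of "\<lambda>k. a ^ k", OF bound]
  show "star c = c"
    unfolding c_def bounded_linear.suminf[OF bounded_linear_star summ]
    by (simp add: star_scaleR star_power sa)
  show "c * c = 1 - a"
    using sqrt_series_square[of 1 "\<lambda>k i j. a ^ k" 0 0] bound by (simp add: c_def power_add)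
  show "d * c = c * d" if "d * a = a * d" for d
  proof -
    have "d * a ^ k = a ^ k * d" for k
    proof (induction k)
      case (Suc k)
      have "d * (a * a ^ k) = a * (d * a ^ k)"
        using that by (simp flip: mult.assoc)
      with Suc show ?case
        by (simp add: mult.assoc)
    qed simp
    then show ?thesis
      unfolding c_def suminf_mult[OF summ, symmetric] suminf_mult2[OF summ] by simp
  qed
  \<comment> \<open>Without the constant term the coefficients have absolute sum at most 1. The
    resulting bound on 1 - c is a positivity criterion for c itself (\<open>cpos_iff\<close> with t
    = 1).\<close>
  have summ': "summable (\<lambda>k. norm (sqrt_coeff (Suc k) *\<^sub>R a ^ Suc k))"
    using summable_norm_sqrt_series[of "\<lambda>k. a ^ k", OF bound]
    by (subst (asm) summable_Suc_iff[symmetric])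
  have "c - 1 = (\<Sum>k. sqrt_coeff (Suc k) *\<^sub>R a ^ Suc k)"
    using suminf_split_head[OF summ] by (simp add: c_def)
  then have "norm (c - 1) = norm (\<Sum>k. sqrt_coeff (Suc k) *\<^sub>R a ^ Suc k)"
    by simp
  also have "\<dots> \<le> (\<Sum>k. norm (sqrt_coeff (Suc k) *\<^sub>R a ^ Suc k))"
    by (rule summable_norm[OF summ'])
  also have "\<dots> \<le> (\<Sum>k. \<bar>sqrt_coeff (Suc k)\<bar>)"
    by (rule suminf_le[OF _ summ' summable_abs_sqrt_coeff_Suc])
       (simp add: mult_left_le bound del: power_Suc)
  finally show "norm (1 - c) \<le> 1"
    using suminf_abs_sqrt_coeff_Suc by (subst norm_minus_commute) linarith
qed

text \<open>If \<open>c\<close> and \<open>d\<close> are commuting and self-adjoint, then \<open>(c + \<i>d)\<^sup>*(c + \<i>d) = c\<^sup>2 + d\<^sup>2\<close>.\<close>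

lemma norm_le_of_square_sum:
  fixes c d :: "'a::unital_cstar_algebra"
  assumes sa: "star c = c" "star d = d" and comm: "c * d = d * c" and t: "c * c + d * d = t *\<^sub>R 1" "0 \<le> t"
  shows "(norm c)\<^sup>2 \<le> t"
proof -
  define u where "u = c + \<i> *\<^sub>C d"
  have su: "star u = c - \<i> *\<^sub>C d"
    by (simp add: u_def star_add star_scaleC sa)
  have "star u * u = c * c + d * d"
    unfolding su by (simp add: u_def algebra_simps scaleC_mult_left scaleC_mult_right scaleC_scaleC
        scaleC_one scaleC_diff_right comm)
  then have "(norm u)\<^sup>2 = t * norm (1::'a)"
    using cstar_identity[of u] t by simp
  also have "\<dots> \<le> t"
    using mult_left_mono[OF norm_one_le \<open>0 \<le> t\<close>] by simp
  finally have "norm u \<le> sqrt t"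
    by (rule real_le_rsqrt)
  have "c = (1/2) *\<^sub>R (u + star u)"
    unfolding su by (simp add: u_def flip: scaleR_2)
  then have "norm c \<le> (1/2) * (norm u + norm (star u))"
    using norm_triangle_ineq[of u "star u"] by (metis norm_scaleR abs_of_nonneg mult_left_mono
        zero_le_divide_1_iff zero_le_numeral)
  with \<open>norm u \<le> sqrt t\<close> have "norm c \<le> sqrt t"
    by simp
  then show ?thesis
    by (metis \<open>0 \<le> t\<close> norm_ge_zero power_mono real_sqrt_pow2)
qed

text \<open>Squares of self-adjoint elements instead of \<open>star b * b\<close>: for squares, sums
  and norm estimates are accessible through the square root series. That both notions agree is
  \<open>cpos_star_mult\<close>.\<close>

definition cpos :: "'a::unital_cstar_algebra \<Rightarrow> bool"
  where "cpos a \<longleftrightarrow> (\<exists>b. star b = b \<and> a = b * b)"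

lemma cpos_self_adjoint: "cpos a \<Longrightarrow> star a = a"
  by (auto simp: cpos_def star_mult)

lemma cpos_zero [simp]: "cpos 0"
  unfolding cpos_def by (rule exI[of _ 0]) simp

lemma cpos_square: "star b = b \<Longrightarrow> cpos (b * b)"
  by (auto simp: cpos_def)

lemma cpos_scaleR: "cpos a \<Longrightarrow> 0 \<le> r \<Longrightarrow> cpos (r *\<^sub>R a)"
  unfolding cpos_def
proof (elim exE conjE)
  fix b assume "star b = b" "a = b * b" "0 \<le> r"
  then show "\<exists>b. star b = b \<and> r *\<^sub>R a = b * b"
    by (intro exI[of _ "sqrt r *\<^sub>R b"]) (simp add: star_scaleR)
qed

text \<open>The root c of 1 - a^2 commutes with a and satisfies c^2 + a^2 = 1, so its norm is at
  most 1, and so is that of c^2.\<close>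

lemma norm_one_minus_square_le:
  fixes a :: "'a::unital_cstar_algebra"
  assumes "star a = a" "norm a \<le> 1"
  shows "norm (1 - a * a) \<le> 1"
proof -
  have sa: "star (a * a) = a * a"
    by (simp add: star_mult assms)
  have "norm (a * a) \<le> 1"
    by (simp add: norm_square_self_adjoint assms power_le_one)
  then obtain c where c: "star c = c" "c * c = 1 - a * a" "\<And>d. d * (a * a) = a * a * d \<Longrightarrow> d * c = c * d"
    using sqrt_one_minus[OF sa] by metis
  have "(norm c)\<^sup>2 \<le> 1"
    by (rule norm_le_of_square_sum[of c a]) (use assms c in \<open>auto simp: mult.assoc\<close>)
  then show ?thesis
    using norm_square_self_adjoint[OF c(1)] c(2) by simp
qed

text \<open>Write a = t (1 - x) with norm x \<le> 1 and use the series for 1 - x; for t = 0 the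
  hypothesis forces a = 0.\<close>

lemma sqrt_of_near_scalar:
  fixes a :: "'a::unital_cstar_algebra"
  assumes sa: "star a = a" and le: "norm (t *\<^sub>R 1 - a) \<le> t"
  obtains c where "star c = c" "c * c = a" "\<And>d. d * a = a * d \<Longrightarrow> d * c = c * d"
proof (cases "t = 0")
  case True
  with le that[of 0] show ?thesis
    by simp
next
  case False
  with le have t: "t > 0"
    using norm_ge_zero order.trans by (metis less_eq_real_def)
  define x where "x = 1 - (1/t) *\<^sub>R a"
  have sx: "star x = x"
    by (simp add: x_def star_diff star_scaleR sa)
  have "x = (1/t) *\<^sub>R (t *\<^sub>R 1 - a)"
    using t by (simp add: x_def scaleR_diff_right)
  then have "norm x \<le> 1"
    using le t by simp
  then obtain c where c: "star c = c" "c * c = 1 - x" "\<And>d. d * x = x * d \<Longrightarrow> d * c = c * d"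
    using sqrt_one_minus[OF sx] by metis
  show ?thesis
  proof (rule that[of "sqrt t *\<^sub>R c"])
    show "star (sqrt t *\<^sub>R c) = sqrt t *\<^sub>R c"
      by (simp add: star_scaleR c)
    show "sqrt t *\<^sub>R c * sqrt t *\<^sub>R c = a"
      using t by (simp add: c x_def)
    fix d assume "d * a = a * d"
    then have "d * c = c * d"
      by (intro c) (simp add: x_def algebra_simps)
    then show "d * sqrt t *\<^sub>R c = sqrt t *\<^sub>R c * d"
      by simp
  qed
qed

text \<open>The norm condition stands in for a nonnegative spectrum. Unlike being a square, it is
  visibly stable under addition, by the triangle inequality.\<close>

lemma cpos_iff: "cpos a \<longleftrightarrow> star a = a \<and> (\<exists>t. norm (t *\<^sub>R 1 - a) \<le> t)"
proof
  assume "cpos a"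
  then obtain b where b: "star b = b" "a = b * b"
    by (auto simp: cpos_def)
  have "norm (t *\<^sub>R 1 - a) \<le> t" if "t = (norm b)\<^sup>2" for t
  proof (cases "b = 0")
    case False
    define c where "c = (1 / norm b) *\<^sub>R b"
    have "norm (1 - c * c) \<le> 1"
      by (rule norm_one_minus_square_le) (simp_all add: c_def star_scaleR b)
    moreover have "t *\<^sub>R 1 - a = t *\<^sub>R (1 - c * c)"
      using False by (simp add: c_def that b scaleR_diff_right power2_eq_square)
    ultimately show ?thesis
      using that by (simp add: mult_left_le)
  qed (simp add: that b)
  then show "star a = a \<and> (\<exists>t. norm (t *\<^sub>R 1 - a) \<le> t)"
    using cpos_self_adjoint[OF \<open>cpos a\<close>] by blast
next
  assume "star a = a \<and> (\<exists>t. norm (t *\<^sub>R 1 - a) \<le> t)"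
  then show "cpos a"
    by (metis sqrt_of_near_scalar cpos_square)
qed

lemma cpos_sqrt:
  fixes a :: "'a::unital_cstar_algebra"
  assumes "cpos a"
  obtains c where "star c = c" "c * c = a" "\<And>d. d * a = a * d \<Longrightarrow> d * c = c * d"
  using assms sqrt_of_near_scalar unfolding cpos_iff by metis

lemma cpos_add:
  assumes "cpos a" "cpos b"
  shows "cpos (a + b)"
proof -
  obtain s t where st: "norm (s *\<^sub>R 1 - a) \<le> s" "norm (t *\<^sub>R 1 - b) \<le> t"
    using assms unfolding cpos_iff by blast
  have "(s + t) *\<^sub>R 1 - (a + b) = (s *\<^sub>R 1 - a) + (t *\<^sub>R 1 - b)"
    by (simp add: algebra_simps)
  then have "norm ((s + t) *\<^sub>R 1 - (a + b)) \<le> norm (s *\<^sub>R 1 - a) + norm (t *\<^sub>R 1 - b)"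
    by (metis norm_triangle_ineq)
  then have "norm ((s + t) *\<^sub>R 1 - (a + b)) \<le> s + t"
    using st by linarith
  moreover have "star (a + b) = a + b"
    by (simp add: star_add cpos_self_adjoint assms)
  ultimately show ?thesis
    unfolding cpos_iff by blast
qed

lemma cpos_sum: "(\<And>i. i \<in> I \<Longrightarrow> cpos (f i)) \<Longrightarrow> cpos (\<Sum>i\<in>I. f i)"
  by (induction I rule: infinite_finite_induct) (simp_all add: cpos_add)

lemma cpos_scalar_minus:
  fixes a :: "'a::unital_cstar_algebra"
  assumes "star a = a" "norm a \<le> t"
  shows "cpos (t *\<^sub>R 1 - a)"
  unfolding cpos_iff
proof
  show "star (t *\<^sub>R 1 - a) = t *\<^sub>R 1 - a"
    by (simp add: star_diff star_scaleR assms)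
  show "\<exists>s. norm (s *\<^sub>R 1 - (t *\<^sub>R 1 - a)) \<le> s"
    using assms by (intro exI[of _ t]) simp
qed

text \<open>For t = norm (p + q) both p and t - p are positive. Their roots d and e commute and d^2
  + e^2 = t, so norm p = (norm d)^2 \<le> t.\<close>

lemma cpos_norm_le:
  fixes p q :: "'a::unital_cstar_algebra"
  assumes p: "cpos p" and q: "cpos q"
  shows "norm p \<le> norm (p + q)"
proof -
  define t where "t = norm (p + q)"
  have "cpos (t *\<^sub>R 1 - (p + q))"
    by (rule cpos_scalar_minus) (simp_all add: t_def star_add cpos_self_adjoint p q)
  from cpos_add[OF this q] have r: "cpos (t *\<^sub>R 1 - p)"
    by (simp add: algebra_simps)
  obtain d where d: "star d = d" "d * d = p" "\<And>x. x * p = p * x \<Longrightarrow> x * d = d * x"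
    using cpos_sqrt[OF p] by metis
  obtain e where e: "star e = e" "e * e = t *\<^sub>R 1 - p"
    "\<And>x. x * (t *\<^sub>R 1 - p) = (t *\<^sub>R 1 - p) * x \<Longrightarrow> x * e = e * x"
    using cpos_sqrt[OF r] by metis
  \<comment> \<open>d commutes with its square p, hence with t - p, hence with e, which commutes
    with everything that t - p commutes with.\<close>
  have "d * p = p * d"
    using d(2) by (metis mult.assoc)
  then have "d * e = e * d"
    by (intro e(3)) (simp add: algebra_simps)
  then have "(norm d)\<^sup>2 \<le> t"
    by (intro norm_le_of_square_sum[of d e]) (simp_all add: d(1,2) e(1,2) t_def)
  then show ?thesis
    using norm_square_self_adjoint[OF d(1)] d(2) by (simp add: t_def)
qed

lemma cpos_add_eq_0:
  fixes p q :: "'a::unital_cstar_algebra"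
  assumes "cpos p" "cpos q" "p + q = 0"
  shows "p = 0"
  using cpos_norm_le[OF assms(1,2)] unfolding assms(3) by simp

text \<open>Commutation makes b p b the square of the self-adjoint b r, where r is the root of p.
  Without it the product is only of the form \<open>star x * x\<close>, whose positivity is deduced
  from this case.\<close>

lemma cpos_conjugate_self_adjoint:
  "cpos p \<Longrightarrow> star b = b \<Longrightarrow> b * p = p * b \<Longrightarrow> cpos (b * p * (b::'a::unital_cstar_algebra))"
proof -
  assume p: "cpos p" and b: "star b = b" "b * p = p * b"
  obtain r where r: "star r = r" "r * r = p" "\<And>x. x * p = p * x \<Longrightarrow> x * r = r * x"
    using cpos_sqrt[OF p] by metis
  have br: "b * r = r * b"
    by (rule r(3)[OF b(2)])
  have "b * p * b = (b * r) * (r * b)"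
    by (simp add: mult.assoc flip: r(2))
  also have "\<dots> = (b * r) * (b * r)"
    by (simp add: br)
  finally show ?thesis
    by (metis br b(1) cpos_square r(1) star_mult)
qed

text \<open>
  If \<open>yy\<^sup>*\<close> and \<open>- y\<^sup>*y\<close> are positive, then \<open>(1 + yy\<^sup>*)\<^sup>n y = y (1 + y\<^sup>*y)\<^sup>n\<close> stays bounded (after
  scaling \<open>y\<close>), which contradicts the linear growth of \<open>(1 + yy\<^sup>*)\<^sup>n yy\<^sup>*\<close> unless \<open>y = 0\<close>.
\<close>

lemma eq_0_if_cpos_uminus:
  fixes y :: "'a::unital_cstar_algebra"
  assumes p: "cpos (y * star y)" and m: "cpos (- (star y * y))"
  shows "y = 0"
proof -
  define p where "p = y * star y"
  define s where "s = - (star y * y)"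
  have cp: "cpos p" and cs: "cpos s"
    using assms by (auto simp: p_def s_def)
  \<comment> \<open>Small enough that \<tau> s lies between 0 and 1; then 1 - \<tau> s is a
    contraction and its powers stay bounded.\<close>
  define \<tau> where "\<tau> = 1 / (norm s + 1)"
  have \<tau>: "\<tau> > 0" "norm (\<tau> *\<^sub>R s) \<le> 1"
    by (simp_all add: \<tau>_def field_simps add_pos_nonneg)
  have le1: "norm (1 - \<tau> *\<^sub>R s) \<le> 1"
  proof -
    have "cpos (\<tau> *\<^sub>R s)"
      using cs \<tau> by (simp add: cpos_scaleR)
    then obtain r where r: "star r = r" "r * r = \<tau> *\<^sub>R s"
      by (auto simp: cpos_def)
    have "(norm r)\<^sup>2 \<le> 1"
      using norm_square_self_adjoint[OF r(1)] r(2) \<tau>(2) by simp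
    then have "norm r \<le> 1"
      using abs_square_le_1[of "norm r"] by simp
    with r show ?thesis
      using norm_one_minus_square_le[of r] by simp
  qed
  define z where "z = 1 + \<tau> *\<^sub>R p"
  have zy: "z ^ n * y = y * (1 - \<tau> *\<^sub>R s) ^ n" for n
  proof (induction n)
    case (Suc n)
    have "z ^ Suc n * y = z * (z ^ n * y)"
      by (simp add: mult.assoc)
    also have "\<dots> = (z * y) * (1 - \<tau> *\<^sub>R s) ^ n"
      by (simp add: Suc mult.assoc)
    also have "z * y = y * (1 - \<tau> *\<^sub>R s)"
      by (simp add: z_def s_def p_def algebra_simps)
    finally show ?case
      by (simp add: mult.assoc)
  qed simp
  have bound: "norm (z ^ n * p) \<le> (norm y)\<^sup>2" for n
  proof -
    have "norm (z ^ n * p) = norm (y * (1 - \<tau> *\<^sub>R s) ^ n * star y)"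
      by (metis zy p_def mult.assoc)
    also have "\<dots> \<le> norm (y * (1 - \<tau> *\<^sub>R s) ^ n) * norm (star y)"
      by (rule norm_mult_ineq)
    also have "\<dots> \<le> norm y * norm ((1 - \<tau> *\<^sub>R s) ^ n) * norm y"
      by (simp add: mult_right_mono norm_mult_ineq)
    also have "\<dots> \<le> norm y * 1 * norm y"
      by (intro mult_right_mono mult_left_mono norm_power_le_one le1) auto
    finally show ?thesis
      by (simp add: power2_eq_square)
  qed
  obtain q where q: "star q = q" "q * q = p"
    using cp by (auto simp: cpos_def)
  have pk: "cpos (p ^ k)" for k
  proof -
    have "p ^ k = q ^ k * q ^ k"
      unfolding q(2)[symmetric]
      by (simp add: mult_2 flip: power2_eq_square[of q] power_mult power_add)
    then show ?thesis
      by (metis cpos_square q(1) star_power)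
  qed
  \<comment> \<open>Three inductions of Bernoulli type: z^n p^k \<ge> 0, then z^n p^2 \<ge> p^2,
    then z^n p \<ge> n \<tau> p^2. Each step of the last two adds \<tau> times an instance of the
    previous inequality.\<close>
  have zp: "cpos (z ^ n * p ^ k)" for n k
  proof (induction n arbitrary: k)
    case (Suc n)
    have *: "z ^ Suc n * p ^ k = z ^ n * p ^ k + \<tau> *\<^sub>R (z ^ n * p ^ Suc k)"
      by (simp add: power_Suc2 mult.assoc del: power_Suc)
         (simp add: z_def algebra_simps power_commutes)
    show ?case
      unfolding * by (intro cpos_add cpos_scaleR Suc) (use \<tau> in auto)
  qed (simp add: pk)
  have z2: "cpos (z ^ n * p ^ 2 - p ^ 2)" for n
  proof (induction n)
    case (Suc n)
    have *: "z ^ Suc n * p ^ 2 - p ^ 2 = (z ^ n * p ^ 2 - p ^ 2) + \<tau> *\<^sub>R (z ^ n * p ^ 3)"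
      by (simp add: power_Suc2 mult.assoc del: power_Suc)
         (simp add: z_def algebra_simps power_commutes power2_eq_square power3_eq_cube)
    show ?case
      unfolding * by (intro cpos_add cpos_scaleR Suc zp) (use \<tau> in auto)
  qed simp
  have z1: "cpos (z ^ n * p - (real n * \<tau>) *\<^sub>R p ^ 2)" for n
  proof (induction n)
    case (Suc n)
    have *: "z ^ Suc n * p - (real (Suc n) * \<tau>) *\<^sub>R p ^ 2
        = (z ^ n * p - (real n * \<tau>) *\<^sub>R p ^ 2) + \<tau> *\<^sub>R (z ^ n * p ^ 2 - p ^ 2)"
      by (simp add: power_Suc2 mult.assoc del: power_Suc)
         (simp add: z_def algebra_simps power2_eq_square)
    show ?case
      unfolding * by (intro cpos_add cpos_scaleR Suc z2) (use \<tau> in auto)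
  qed (use cp in simp)
  have growth: "real n * (\<tau> * norm (p ^ 2)) \<le> (norm y)\<^sup>2" for n
  proof -
    have "cpos ((real n * \<tau>) *\<^sub>R p ^ 2)"
      using \<tau> by (intro cpos_scaleR pk) auto
    from cpos_norm_le[OF this z1[of n]] have "real n * \<tau> * norm (p ^ 2) \<le> norm (z ^ n * p)"
      using \<tau> by simp
    with bound[of n] show ?thesis
      by simp
  qed
  have "norm (p ^ 2) = 0"
  proof (rule ccontr)
    assume "norm (p ^ 2) \<noteq> 0"
    then have "\<tau> * norm (p ^ 2) > 0"
      using \<tau> by simp
    then obtain n where "(norm y)\<^sup>2 < real n * (\<tau> * norm (p ^ 2))"
      using reals_Archimedean3 by blast
    with growth[of n] show False
      by simp
  qed
  then have "p = 0"
    using self_adjoint_square_eq_0[OF cpos_self_adjoint[OF cp]] by (simp add: power2_eq_square)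
  then show "y = 0"
    using cstar_identity[of "star y"] by (simp add: p_def star_star)
qed

text \<open>Serves to deduce that \<open>y * star y\<close> is positive once
  \<open>- (star y * y)\<close> is: the sum of the two products is a positive multiple of a sum of
  self-adjoint squares.\<close>

lemma cartesian_decomposition:
  fixes y :: "'a::unital_cstar_algebra"
  obtains u v where "star u = u" "star v = v" "2 *\<^sub>R (star y * y + y * star y) = u * u + v * v"
proof
  define u where "u = y + star y"
  define v where "v = \<i> *\<^sub>C (y - star y)"
  show "star u = u" "star v = v"
    by (simp_all add: u_def v_def star_add star_scaleC star_diff star_star scaleC_diff_right)
  show "2 *\<^sub>R (star y * y + y * star y) = u * u + v * v"
    by (simp add: u_def v_def scaleC_diff_right scaleC_mult_left scaleC_mult_right scaleC_scaleC scaleC_one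
        algebra_simps scaleR_2)
qed

text \<open>The negative part of a = \<open>star x * x\<close> vanishes. With b = |a| - a, twice the
  negative part, y = x b has \<open>star y * y\<close> = b a b = - b |a| b \<le> 0, hence
  \<open>y * star y\<close> is positive and y = 0. Then b^3 = b |a| b - b a b = 0, so b = 0 and a =
  |a|.\<close>

theorem cpos_star_mult: "cpos (star x * (x::'a::unital_cstar_algebra))"
proof -
  define a where "a = star x * x"
  have sa: "star a = a"
    by (simp add: a_def star_mult star_star)
  \<comment> \<open>m is the absolute value of a: the root of a^2 from the series, after scaling a
    to norm one and writing \<alpha>^2 as 1 - (1 - \<alpha>^2).\<close>
  obtain m where m: "star m = m" "m * m = a * a" "cpos m" "m * a = a * m"
  proof (cases "a = 0")
    case False
    define \<alpha> where "\<alpha> = (1 / norm a) *\<^sub>R a"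
    have \<alpha>: "star \<alpha> = \<alpha>" "norm \<alpha> \<le> 1"
      using False by (simp_all add: \<alpha>_def star_scaleR sa)
    have s: "star (1 - \<alpha> * \<alpha>) = 1 - \<alpha> * \<alpha>"
      by (simp add: star_diff star_mult \<alpha>)
    obtain c where c: "star c = c" "c * c = 1 - (1 - \<alpha> * \<alpha>)" "norm (1 - c) \<le> 1"
      "\<And>d. d * (1 - \<alpha> * \<alpha>) = (1 - \<alpha> * \<alpha>) * d \<Longrightarrow> d * c = c * d"
      using sqrt_one_minus[OF s norm_one_minus_square_le[OF \<alpha>]] by metis
    show ?thesis
    proof (rule that[of "norm a *\<^sub>R c"])
      show "star (norm a *\<^sub>R c) = norm a *\<^sub>R c"
        by (simp add: star_scaleR c(1))
      show "norm a *\<^sub>R c * norm a *\<^sub>R c = a * a"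
        using False by (simp add: c(2) \<alpha>_def)
      have "cpos c"
        unfolding cpos_iff using c(1,3) by (auto intro!: exI[of _ 1])
      then show "cpos (norm a *\<^sub>R c)"
        by (simp add: cpos_scaleR)
      have "\<alpha> * c = c * \<alpha>"
        by (rule c(4)) (simp add: algebra_simps)
      then show "norm a *\<^sub>R c * a = a * norm a *\<^sub>R c"
        using False by (simp add: \<alpha>_def)
    qed
  qed (use that[of 0] in simp)
  define b where "b = m - a"
  have b: "star b = b" "b * a = a * b" "b * m = m * b"
    by (simp_all add: b_def star_diff m sa algebra_simps)
  have ab: "a * b = - (m * b)"
    by (simp add: b_def algebra_simps m)
  define y where "y = x * b"
  have yy: "star y * y = - (b * m * b)"
  proof -
    have "star y * y = b * (a * b)"
      by (simp add: y_def star_mult b(1) a_def mult.assoc)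
    then show ?thesis
      by (simp add: ab mult.assoc)
  qed
  have c1: "cpos (- (star y * y))"
    unfolding yy using cpos_conjugate_self_adjoint[OF m(3) b(1) b(3)] by simp
  obtain u v where uv: "star u = u" "star v = v" "2 *\<^sub>R (star y * y + y * star y) = u * u + v * v"
    by (rule cartesian_decomposition)
  have "y * star y = (1/2) *\<^sub>R (u * u + v * v) + (- (star y * y))"
    by (simp flip: uv(3))
  then have c2: "cpos (y * star y)"
    using c1 uv by (simp add: cpos_add cpos_scaleR cpos_square del: add_uminus_conv_diff)
  have "y = 0"
    by (rule eq_0_if_cpos_uminus[OF c2 c1])
  then have bmb: "b * m * b = 0"
    using yy by simp
  then have bab: "b * a * b = 0"
    by (simp add: ab mult.assoc)
  have "(b * b) * b = b * m * b - b * a * b"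
    by (simp add: b_def algebra_simps)
  then have "(b * b) * b = 0"
    by (simp add: bmb bab)
  then have "(b * b) * (b * b) = 0"
    by (simp flip: mult.assoc)
  then have "b * b = 0"
    by (rule self_adjoint_square_eq_0[rotated]) (simp add: star_mult b)
  then have "b = 0"
    using self_adjoint_square_eq_0[OF b(1)] by simp
  then show ?thesis
    using m by (simp add: b_def a_def)
qed

section \<open>Riesz representation and inner product estimates\<close>

text \<open>The representing vector minimises J(x) = |x|^2 - 2 f(x). The parallelogram law makes
  minimising sequences Cauchy, and at the limit J cannot decrease along any line.\<close>

lemma riesz_representation:
  fixes f :: "'a::{real_inner,banach} \<Rightarrow> real"
  assumes "bounded_linear f"
  obtains z where "\<And>x. f x = inner x z"
proof -
  interpret f: bounded_linear f by fact
  obtain K where K: "\<And>x. norm (f x) \<le> norm x * K"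
    using f.bounded by blast
  define J where "J x = (norm x)\<^sup>2 - 2 * f x" for x
  have J_ge: "- K\<^sup>2 \<le> J x" for x
  proof -
    have "f x \<le> norm x * K"
      using K[of x] by simp
    then have "- K\<^sup>2 + (norm x - K)\<^sup>2 \<le> J x"
      by (simp add: J_def power2_diff)
    then show ?thesis
      by (smt (verit) zero_le_power2)
  qed
  define m where "m = Inf (range J)"
  have bdd: "bdd_below (range J)"
    using J_ge by (auto intro!: bdd_belowI[of _ "- K\<^sup>2"])
  then have m_le: "m \<le> J x" for x
    unfolding m_def by (rule cInf_lower[rotated]) simp
  have "\<exists>x. J x < m + 1 / real (Suc n)" for n
  proof -
    have "Inf (range J) < m + 1 / real (Suc n)"
      by (simp add: m_def)
    then show ?thesis
      using cInf_less_iff[OF _ bdd] by auto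
  qed
  then obtain x where x: "\<And>n. J (x n) < m + 1 / real (Suc n)"
    by metis
  have par: "(norm (a - b))\<^sup>2 \<le> 2 * J a + 2 * J b - 4 * m" for a b
  proof -
    have "(norm (a - b))\<^sup>2 = 2 * J a + 2 * J b - 4 * J ((1/2) *\<^sub>R (a + b))"
      by (simp add: J_def power2_norm_eq_inner inner_add inner_diff inner_commute f.add f.scaleR
          algebra_simps)
    then show ?thesis
      using m_le[of "(1/2) *\<^sub>R (a + b)"] by linarith
  qed
  have "Cauchy x"
  proof (rule CauchyI)
    fix e :: real assume "0 < e"
    then obtain N where N: "1 / real (Suc N) < e\<^sup>2 / 4"
      using nat_approx_posE[of "e\<^sup>2 / 4"] by auto
    have "norm (x i - x j) < e" if "i \<ge> N" "j \<ge> N" for i j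
    proof -
      have "1 / real (Suc i) \<le> 1 / real (Suc N)" "1 / real (Suc j) \<le> 1 / real (Suc N)"
        using that by (auto intro!: divide_left_mono)
      then have "(norm (x i - x j))\<^sup>2 < e\<^sup>2"
        using par[of "x i" "x j"] x[of i] x[of j] N by linarith
      then show ?thesis
        using \<open>0 < e\<close> by (simp add: power2_less_imp_less)
    qed
    then show "\<exists>N. \<forall>i\<ge>N. \<forall>j\<ge>N. norm (x i - x j) < e"
      by blast
  qed
  then obtain z where z: "x \<longlonglongrightarrow> z"
    using Cauchy_convergent convergent_def by blast
  have "(\<lambda>n. J (x n)) \<longlonglongrightarrow> J z"
    unfolding J_def by (intro tendsto_intros z f.tendsto)
  moreover have "(\<lambda>n. m + 1 / real (Suc n)) \<longlonglongrightarrow> m + 0"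
    by (intro tendsto_add tendsto_const) (use LIMSEQ_Suc[OF lim_1_over_n] in simp)
  ultimately have "J z \<le> m"
    using LIMSEQ_le[of "\<lambda>n. J (x n)" "J z" "\<lambda>n. m + 1 / real (Suc n)" "m + 0"] x
    by (auto intro: less_imp_le)
  have "f y = inner y z" for y
  proof (rule ccontr)
    define d where "d = inner y z - f y"
    assume "f y \<noteq> inner y z"
    then have "d \<noteq> 0"
      by (simp add: d_def)
    then have "y \<noteq> 0"
      using f.zero by (auto simp: d_def)
    \<comment> \<open>The minimiser of J along the line through z in the direction y; there J drops
      by d^2 / |y|^2.\<close>
    define t where "t = - d / (norm y)\<^sup>2"
    have "J (z + t *\<^sub>R y) = J z + 2 * t * d + t\<^sup>2 * (norm y)\<^sup>2"
      by (simp add: J_def power2_norm_eq_inner inner_add inner_commute f.add f.scaleR d_def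
          algebra_simps power2_eq_square[of t])
    also have "\<dots> = J z - d\<^sup>2 / (norm y)\<^sup>2"
      using \<open>y \<noteq> 0\<close> by (simp add: t_def power2_eq_square field_simps)
    also have "\<dots> < J z"
      using \<open>y \<noteq> 0\<close> \<open>d \<noteq> 0\<close> by simp
    finally show False
      using m_le[of "z + t *\<^sub>R y"] \<open>J z \<le> m\<close> by linarith
  qed
  then show ?thesis
    by (rule that)
qed

text \<open>
  A semi-inner product space without any vector space axioms; only the values of the inner product
  matter. This covers both Hilbert spaces and the formal sums that are completed below.
\<close>

locale prehilbert =
  fixes L :: "'l hilbert"
  assumes add_closed: "\<lbrakk>x \<in> hcarrier L; y \<in> hcarrier L\<rbrakk> \<Longrightarrow> hadd L x y \<in> hcarrier L"
    and scale_closed: "x \<in> hcarrier L \<Longrightarrow> hscale L c x \<in> hcarrier L"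
    and inner_commute: "\<lbrakk>x \<in> hcarrier L; y \<in> hcarrier L\<rbrakk> \<Longrightarrow> hinner L y x = cnj (hinner L x y)"
    and inner_add_right: "\<lbrakk>x \<in> hcarrier L; y \<in> hcarrier L; z \<in> hcarrier L\<rbrakk>
      \<Longrightarrow> hinner L x (hadd L y z) = hinner L x y + hinner L x z"
    and inner_scale_right: "\<lbrakk>x \<in> hcarrier L; y \<in> hcarrier L\<rbrakk>
      \<Longrightarrow> hinner L x (hscale L c y) = c * hinner L x y"
    and inner_nonneg: "x \<in> hcarrier L \<Longrightarrow> 0 \<le> Re (hinner L x x)"
begin

abbreviation diff :: "'l \<Rightarrow> 'l \<Rightarrow> 'l"
  where "diff x y \<equiv> hadd L x (hscale L (- 1) y)"

lemma diff_closed: "\<lbrakk>x \<in> hcarrier L; y \<in> hcarrier L\<rbrakk> \<Longrightarrow> diff x y \<in> hcarrier L"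
  by (simp add: add_closed scale_closed)

lemma inner_add_left:
  assumes "x \<in> hcarrier L" "y \<in> hcarrier L" "z \<in> hcarrier L"
  shows "hinner L (hadd L x y) z = hinner L x z + hinner L y z"
proof -
  have "hinner L (hadd L x y) z = cnj (hinner L z (hadd L x y))"
    by (intro inner_commute add_closed assms)
  also have "\<dots> = cnj (hinner L z x) + cnj (hinner L z y)"
    by (simp add: inner_add_right assms)
  finally show ?thesis
    using inner_commute[of z x] inner_commute[of z y] assms by simp
qed

lemma inner_scale_left:
  assumes "x \<in> hcarrier L" "z \<in> hcarrier L"
  shows "hinner L (hscale L c x) z = cnj c * hinner L x z"
proof -
  have "hinner L (hscale L c x) z = cnj (hinner L z (hscale L c x))"
    by (intro inner_commute scale_closed assms)
  then show ?thesis
    using inner_commute[of z x] assms by (simp add: inner_scale_right)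
qed

lemmas closed = add_closed scale_closed
lemmas inner_linear = inner_add_left inner_add_right inner_scale_left inner_scale_right

lemma Re_inner_commute: "\<lbrakk>x \<in> hcarrier L; y \<in> hcarrier L\<rbrakk> \<Longrightarrow> Re (hinner L y x) = Re (hinner L x y)"
  by (simp add: inner_commute[of x y])

lemma hnorm_power2: "x \<in> hcarrier L \<Longrightarrow> (hnorm L x)\<^sup>2 = Re (hinner L x x)"
  by (simp add: hnorm_def inner_nonneg)

lemma hnorm_nonneg: "x \<in> hcarrier L \<Longrightarrow> 0 \<le> hnorm L x"
  by (simp add: hnorm_def inner_nonneg)

lemma inner_self: "x \<in> hcarrier L \<Longrightarrow> hinner L x x = of_real ((hnorm L x)\<^sup>2)"
  using inner_commute[of x x] by (simp add: hnorm_power2 complex_eq_iff)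

lemma hnorm_scale:
  assumes "x \<in> hcarrier L"
  shows "hnorm L (hscale L c x) = cmod c * hnorm L x"
proof -
  have "hinner L (hscale L c x) (hscale L c x) = (cnj c * c) * hinner L x x"
    by (simp add: inner_linear closed assms)
  also have "\<dots> = of_real ((cmod c * hnorm L x)\<^sup>2)"
    by (simp add: inner_self assms mult.commute[of "cnj c"] complex_norm_square power_mult_distrib
        flip: complex_norm_square)
  finally show ?thesis
    by (simp add: hnorm_def[of L "hscale L c x"] hnorm_nonneg assms)
qed

lemma cauchy_schwarz:
  assumes x: "x \<in> hcarrier L" and y: "y \<in> hcarrier L"
  shows "cmod (hinner L x y) \<le> hnorm L x * hnorm L y"
proof -
  define a where "a = hinner L x y"
  define A B where "A = (hnorm L x)\<^sup>2" and "B = (hnorm L y)\<^sup>2"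
  have quad: "0 \<le> A - 2 * s * (cmod a)\<^sup>2 + s\<^sup>2 * (cmod a)\<^sup>2 * B" for s
  proof -
    \<comment> \<open>The phase of c makes both cross terms equal to - s |a|^2.\<close>
    define c where "c = - of_real s * cnj a"
    have "hinner L (hadd L x (hscale L c y)) (hadd L x (hscale L c y))
        = hinner L x x + c * a + cnj c * cnj a + cnj c * c * hinner L y y"
      using inner_commute[OF x y] x y by (simp add: inner_linear closed a_def algebra_simps)
    also have "c * a = of_real (- s * (cmod a)\<^sup>2)"
      by (simp add: c_def mult.commute[of "cnj a"] mult.assoc flip: complex_norm_square)
    also have "cnj c * cnj a = of_real (- s * (cmod a)\<^sup>2)"
      by (simp add: c_def mult.assoc flip: complex_norm_square)
    also have "cnj c * c = of_real (s\<^sup>2 * (cmod a)\<^sup>2)"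
      by (simp add: c_def power2_eq_square[of s] complex_norm_square[symmetric] mult.assoc
          mult.left_commute[of a] flip: complex_norm_square)
    finally show ?thesis
      using inner_nonneg[OF add_closed[OF x scale_closed[OF y]], of c]
      by (simp add: A_def B_def inner_self x y power2_eq_square)
  qed
  have "(cmod a)\<^sup>2 \<le> A * B"
  proof (cases "B = 0")
    case True
    have "cmod a = 0"
    proof (rule ccontr)
      assume "cmod a \<noteq> 0"
      \<comment> \<open>For B = 0 the quadratic degenerates to A - 2 s |a|^2, which is -1 at this
        s.\<close>
      then show False
        using quad[of "(A + 1) / (2 * (cmod a)\<^sup>2)"] True by simp
    qed
    then show ?thesis
      by (simp add: A_def B_def)
  next
    case False
    then have "B > 0"
      by (simp add: B_def)
    have "0 \<le> A - 2 * (1/B) * (cmod a)\<^sup>2 + (1/B)\<^sup>2 * (cmod a)\<^sup>2 * B"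
      by (rule quad)
    also have "\<dots> = A - (cmod a)\<^sup>2 / B"
      using False by (simp add: field_simps power2_eq_square)
    finally show ?thesis
      using \<open>B > 0\<close> by (simp add: field_simps)
  qed
  then have "(cmod a)\<^sup>2 \<le> (hnorm L x * hnorm L y)\<^sup>2"
    by (simp add: A_def B_def power_mult_distrib)
  then show ?thesis
    by (simp add: a_def hnorm_nonneg x y power2_le_iff_abs_le)
qed

lemma hnorm_triangle:
  assumes x: "x \<in> hcarrier L" and y: "y \<in> hcarrier L"
  shows "hnorm L (hadd L x y) \<le> hnorm L x + hnorm L y"
proof -
  have "(hnorm L (hadd L x y))\<^sup>2 = (hnorm L x)\<^sup>2 + 2 * Re (hinner L x y) + (hnorm L y)\<^sup>2"
    using Re_inner_commute[OF x y] by (simp add: hnorm_power2 inner_linear closed x y)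
  also have "Re (hinner L x y) \<le> hnorm L x * hnorm L y"
    using complex_Re_le_cmod cauchy_schwarz[OF x y] order.trans by blast
  finally have "(hnorm L (hadd L x y))\<^sup>2 \<le> (hnorm L x + hnorm L y)\<^sup>2"
    by (simp add: power2_sum)
  then show ?thesis
    by (rule power2_le_imp_le) (simp add: hnorm_nonneg x y)
qed

text \<open>Without vector space axioms, two expressions for the same combination need not be equal
  as elements of the carrier. Comparing inner products takes the place of rewriting one into the
  other.\<close>

lemma hnorm_cong:
  assumes "x \<in> hcarrier L" "y \<in> hcarrier L"
    and "\<And>w. w \<in> hcarrier L \<Longrightarrow> hinner L w x = hinner L w y"
  shows "hnorm L x = hnorm L y"
proof -
  have "hinner L x x = cnj (hinner L y x)"
    using assms inner_commute by metis
  also have "\<dots> = hinner L y y"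
    using assms inner_commute by metis
  finally show ?thesis
    by (simp add: hnorm_def)
qed

lemma hdist_nonneg: "\<lbrakk>x \<in> hcarrier L; y \<in> hcarrier L\<rbrakk> \<Longrightarrow> 0 \<le> hdist L x y"
  by (simp add: hdist_def hnorm_nonneg diff_closed)

lemma hdist_commute:
  assumes "x \<in> hcarrier L" "y \<in> hcarrier L"
  shows "hdist L x y = hdist L y x"
proof -
  have "hdist L x y = hnorm L (hscale L (- 1) (diff y x))"
    unfolding hdist_def by (rule hnorm_cong) (simp_all add: closed inner_linear assms algebra_simps)
  then show ?thesis
    by (simp add: hdist_def hnorm_scale diff_closed assms)
qed

lemma hdist_triangle:
  assumes "x \<in> hcarrier L" "y \<in> hcarrier L" "z \<in> hcarrier L"
  shows "hdist L x z \<le> hdist L x y + hdist L y z"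
proof -
  have "hdist L x z = hnorm L (hadd L (diff x y) (diff y z))"
    unfolding hdist_def by (rule hnorm_cong) (simp_all add: closed inner_linear assms)
  then show ?thesis
    using hnorm_triangle[of "diff x y" "diff y z"] by (simp add: hdist_def closed assms)
qed

lemma hnorm_le_hdist:
  assumes "x \<in> hcarrier L" "y \<in> hcarrier L"
  shows "hnorm L x \<le> hdist L x y + hnorm L y"
proof -
  have "hnorm L x = hnorm L (hadd L (diff x y) y)"
    by (rule hnorm_cong) (simp_all add: closed inner_linear assms)
  then show ?thesis
    using hnorm_triangle[of "diff x y" y] by (simp add: hdist_def closed assms)
qed

end

sublocale hilbert_space \<subseteq> pre: prehilbert L
  by unfold_locales
    (simp_all add: add_closed scale_closed inner_add_right inner_scale_right inner_nonneg, rule inner_commute)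

text \<open>Riesz for the real functional Re <k, T g> gives the vector that the definite description
  in \<open>hadjoint\<close> denotes; inserting i g recovers the imaginary part.\<close>

lemma hilbert_adjoint:
  fixes T :: "'h::chilbert_space \<Rightarrow> 'l"
  assumes L: "hilbert_space L" and T: "bounded_operator type_hilbert L T" and k: "k \<in> hcarrier L"
  shows "cinner (hadjoint type_hilbert L T k) g = hinner L k (T g)"
proof -
  interpret hilbert_space L by fact
  have T_closed: "T x \<in> hcarrier L" for x
    using T by (simp add: bounded_operator_def type_hilbert_def)
  have T_add: "T (x + y) = hadd L (T x) (T y)" for x y
    using T by (simp add: bounded_operator_def type_hilbert_def)
  have T_scale: "T (c *\<^sub>C x) = hscale L c (T x)" for c x
    using T by (simp add: bounded_operator_def type_hilbert_def)
  obtain C where C: "\<And>x. hnorm L (T x) \<le> C * norm x"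
    using T by (auto simp: bounded_operator_def hnorm_type_hilbert) (auto simp: type_hilbert_def)
  define f where "f g = Re (hinner L k (T g))" for g
  have "bounded_linear f"
  proof (rule bounded_linear_intro)
    show "f (x + y) = f x + f y" for x y
      by (simp add: f_def T_add inner_add_right k T_closed)
    show "f (r *\<^sub>R x) = r *\<^sub>R f x" for r x
      by (simp add: f_def scaleR_scaleC T_scale inner_scale_right k T_closed)
    show "norm (f x) \<le> norm x * (hnorm L k * C)" for x
    proof -
      have "norm (f x) \<le> hnorm L k * hnorm L (T x)"
        using abs_Re_le_cmod pre.cauchy_schwarz[OF k T_closed] order.trans
        by (fastforce simp: f_def)
      also have "\<dots> \<le> hnorm L k * (C * norm x)"
        by (intro mult_left_mono C pre.hnorm_nonneg k)
      finally show ?thesis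
        by (simp add: mult_ac)
    qed
  qed
  then obtain z where z: "\<And>x. f x = inner x z"
    using riesz_representation by metis
  have Re_z: "Re (cinner z x) = Re (hinner L k (T x))" for x
    using z[of x] by (metis f_def inner_eq_Re_cinner Inner_Product.inner_commute)
  have cz: "cinner z x = hinner L k (T x)" for x
  proof (rule complex_eqI)
    show "Im (cinner z x) = Im (hinner L k (T x))"
      using Re_z[of "\<i> *\<^sub>C x"] by (simp add: cinner_scaleC_right T_scale inner_scale_right k T_closed)
  qed (rule Re_z)
  have "hadjoint type_hilbert L T k = z"
    unfolding hadjoint_def
  proof (rule the_equality)
    show "z \<in> hcarrier type_hilbert \<and> (\<forall>g\<in>hcarrier type_hilbert. hinner type_hilbert z g = hinner L k (T g))"
      by (simp add: type_hilbert_def cz)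
    fix h assume "h \<in> hcarrier type_hilbert \<and> (\<forall>g\<in>hcarrier type_hilbert. hinner type_hilbert h g = hinner L k (T g))"
    then have "cinner h g = cinner z g" for g
      by (simp add: type_hilbert_def cz)
    then show "h = z"
      by (intro cinner_eqI) (metis cinner_commute)
  qed
  then show ?thesis
    by (simp add: cz)
qed

section \<open>Hilbert modules and matrices\<close>

context hilbert_cstar_module
begin

lemma ip_add_left: "ip (x + y) z = ip x z + ip y z"
  by (subst (1 2 3) ip_star) (simp add: ip_add_right star_add)

lemma ip_scaleC_left: "ip (c *\<^sub>C x) z = cnj c *\<^sub>C ip x z"
  by (subst (1 2) ip_star) (simp add: ip_scaleC_right star_scaleC)

lemma ip_act_left: "ip (act x a) z = star a * ip x z"
  by (subst (1 2) ip_star) (simp add: ip_act_right star_mult)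

lemma ip_zero_right [simp]: "ip x 0 = 0"
  using ip_add_right[of x 0 0] by simp

lemma ip_zero_left [simp]: "ip 0 x = 0"
  using ip_add_left[of 0 0 x] by simp

lemma ip_sum_right: "ip x (\<Sum>i\<in>I. f i) = (\<Sum>i\<in>I. ip x (f i))"
  by (induction I rule: infinite_finite_induct) (simp_all add: ip_add_right)

lemma ip_sum_left: "ip (\<Sum>i\<in>I. f i) x = (\<Sum>i\<in>I. ip (f i) x)"
  by (induction I rule: infinite_finite_induct) (simp_all add: ip_add_left)

lemma cpos_ip: "cpos (ip x x)"
  using ip_positive[of x] cpos_star_mult by metis

end

section \<open>Columns over the algebra and their norm\<close>

lemma cpos_column: "cpos (\<Sum>i\<in>I. star (\<xi> i) * \<xi> i)"
  by (intro cpos_sum cpos_star_mult)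

lemma norm_le_column_norm:
  assumes "i < n"
  shows "norm (\<xi> i) \<le> column_norm n \<xi>"
proof -
  have "norm (star (\<xi> i) * \<xi> i)
      \<le> norm (star (\<xi> i) * \<xi> i + (\<Sum>k\<in>{..<n} - {i}. star (\<xi> k) * \<xi> k))"
    by (intro cpos_norm_le cpos_star_mult cpos_column)
  also have "star (\<xi> i) * \<xi> i + (\<Sum>k\<in>{..<n} - {i}. star (\<xi> k) * \<xi> k) = (\<Sum>k<n. star (\<xi> k) * \<xi> k)"
    using assms by (subst sum.remove[of _ i]) auto
  finally show ?thesis
    unfolding column_norm_def by (intro real_le_rsqrt) (simp add: cstar_identity)
qed

lemma column_norm_zero: "column_norm n (\<lambda>i. 0) = 0"
  by (simp add: column_norm_def)

lemma bdd_above_column_norm: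
  fixes a :: "nat \<Rightarrow> nat \<Rightarrow> 'a::unital_cstar_algebra"
  shows "bdd_above ((\<lambda>\<xi>. column_norm n (\<lambda>i. \<Sum>j<n. a i j * \<xi> j)) ` {\<xi>. column_norm n \<xi> \<le> 1})"
proof (rule bdd_aboveI2)
  fix \<xi> :: "nat \<Rightarrow> 'a" assume "\<xi> \<in> {\<xi>. column_norm n \<xi> \<le> 1}"
  then have \<xi>: "norm (\<xi> j) \<le> 1" if "j < n" for j
    using norm_le_column_norm[OF that, of \<xi>] by simp
  define \<eta> where "\<eta> i = (\<Sum>j<n. a i j * \<xi> j)" for i
  have \<eta>: "norm (\<eta> i) \<le> (\<Sum>j<n. norm (a i j))" for i
    unfolding \<eta>_def
  proof (rule sum_norm_le)
    fix j assume "j \<in> {..<n}"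
    have "norm (a i j * \<xi> j) \<le> norm (a i j) * norm (\<xi> j)"
      by (rule norm_mult_ineq)
    also have "\<dots> \<le> norm (a i j)"
      using \<xi> \<open>j \<in> {..<n}\<close> by (simp add: mult_left_le)
    finally show "norm (a i j * \<xi> j) \<le> norm (a i j)" .
  qed
  have "norm (\<Sum>i<n. star (\<eta> i) * \<eta> i) \<le> (\<Sum>i<n. (\<Sum>j<n. norm (a i j))\<^sup>2)"
    by (rule sum_norm_le) (simp add: cstar_identity power_mono \<eta>)
  then show "column_norm n (\<lambda>i. \<Sum>j<n. a i j * \<xi> j) \<le> sqrt (\<Sum>i<n. (\<Sum>j<n. norm (a i j))\<^sup>2)"
    by (simp add: column_norm_def \<eta>_def)
qed

lemma column_norm_mult_le:
  assumes "cstar_matrix_norm n a \<le> 1" "column_norm n \<xi> \<le> 1"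
  shows "column_norm n (\<lambda>i. \<Sum>j<n. a i j * \<xi> j) \<le> 1"
proof -
  have "column_norm n (\<lambda>i. \<Sum>j<n. a i j * \<xi> j) \<le> cstar_matrix_norm n a"
    unfolding cstar_matrix_norm_def using assms(2)
    by (intro cSUP_upper[OF _ bdd_above_column_norm]) simp
  with assms(1) show ?thesis
    by simp
qed

section \<open>Powers of matrices over the algebra and the root of 1 - a\<close>

fun matrix_power :: "nat \<Rightarrow> (nat \<Rightarrow> nat \<Rightarrow> 'a::unital_cstar_algebra) \<Rightarrow> nat \<Rightarrow> nat \<Rightarrow> nat \<Rightarrow> 'a"
  where "matrix_power n a 0 i j = (if i = j then 1 else 0)"
  | "matrix_power n a (Suc k) i j = (\<Sum>l<n. a i l * matrix_power n a k l j)"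

lemma matrix_power_one: "i < n \<Longrightarrow> j < n \<Longrightarrow> matrix_power n a 1 i j = a i j"
  by (simp add: if_distrib sum.delta cong: if_cong)

lemma matrix_power_add:
  "i < n \<Longrightarrow> (\<Sum>l<n. matrix_power n a k i l * matrix_power n a m l j) = matrix_power n a (k + m) i j"
proof (induction k arbitrary: i)
  case 0
  then show ?case
    by (simp add: if_distrib[of "\<lambda>x. x * _"] sum.delta cong: if_cong)
next
  case (Suc k)
  have "(\<Sum>l<n. matrix_power n a (Suc k) i l * matrix_power n a m l j)
      = (\<Sum>r<n. a i r * (\<Sum>l<n. matrix_power n a k r l * matrix_power n a m l j))"
    by (simp add: sum_distrib_right sum_distrib_left mult.assoc) (rule sum.swap)
  also have "\<dots> = matrix_power n a (Suc k + m) i j"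
    by (simp add: Suc)
  finally show ?case .
qed

lemma star_matrix_power:
  assumes sa: "\<And>i j. i < n \<Longrightarrow> j < n \<Longrightarrow> star (a i j) = a j i"
  shows "i < n \<Longrightarrow> j < n \<Longrightarrow> star (matrix_power n a k i j) = matrix_power n a k j i"
proof (induction k arbitrary: i j)
  case (Suc k)
  have "star (matrix_power n a (Suc k) i j) = (\<Sum>l<n. matrix_power n a k j l * matrix_power n a 1 l i)"
    using Suc by (simp add: star_sum star_mult sa matrix_power_one del: One_nat_def)
  also have "\<dots> = matrix_power n a (k + 1) j i"
    by (rule matrix_power_add) fact
  finally show ?case by simp
qed auto

text \<open>The j-th column of the power is the image of a unit column under k applications of a
  contraction.\<close>

lemma norm_matrix_power_le:
  assumes "cstar_matrix_norm n a \<le> 1" "i < n" "j < n"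
  shows "norm (matrix_power n a k i j) \<le> 1"
proof -
  have "column_norm n (\<lambda>i. matrix_power n a k i j) \<le> 1"
  proof (induction k)
    case 0
    have "(\<Sum>i<n. star (matrix_power n a 0 i j) * matrix_power n a 0 i j) = (\<Sum>i<n. if i = j then 1 else 0)"
      by (rule sum.cong) auto
    then show ?case
      using assms(3) norm_one_le[where ?'a = 'a] by (simp add: column_norm_def)
  next
    case (Suc k)
    then show ?case
      using column_norm_mult_le[OF assms(1)] by simp
  qed
  then show ?thesis
    using norm_le_column_norm[OF assms(2), of "\<lambda>i. matrix_power n a k i j"] by simp
qed

text \<open>The root of 1 - a is summed entry by entry; contractivity enters through the entries of
  the powers, which are bounded by 1. The root is self-adjoint, so its square has the required
  form.\<close>

lemma one_minus_contraction_positive: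
  fixes a :: "nat \<Rightarrow> nat \<Rightarrow> 'a::unital_cstar_algebra"
  assumes sa: "\<And>i j. i < n \<Longrightarrow> j < n \<Longrightarrow> star (a i j) = a j i"
    and le: "cstar_matrix_norm n a \<le> 1"
  shows "cstar_matrix_positive n (\<lambda>i j. (if i = j then 1 else 0) - a i j)"
  unfolding cstar_matrix_positive_def
proof (intro exI allI impI)
  fix i j assume ij: "i < n" "j < n"
  let ?u = "matrix_power n a"
  define b where "b i j = (\<Sum>k. sqrt_coeff k *\<^sub>R ?u k i j)" for i j
  have "star (b l i) = b i l" if "l < n" for l
  proof -
    have "summable (\<lambda>k. sqrt_coeff k *\<^sub>R ?u k l i)"
      by (intro summable_sqrt_series norm_matrix_power_le le that ij)
    then show ?thesis
      by (simp add: b_def bounded_linear.suminf[OF bounded_linear_star] star_scaleR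
          star_matrix_power[where a = a, OF sa] that ij)
  qed
  then have "(\<Sum>l<n. star (b l i) * b l j) = (\<Sum>l<n. b i l * b l j)"
    by simp
  also have "\<dots> = ?u 0 i j - ?u 1 i j"
    unfolding b_def by (intro sqrt_series_square norm_matrix_power_le le matrix_power_add ij)
  also have "\<dots> = (if i = j then 1 else 0) - a i j"
    using matrix_power_one[OF ij, of a] by simp
  finally show "(if i = j then 1 else 0) - a i j = (\<Sum>l<n. star (b l i) * b l j)" ..
qed


section \<open>Maps that factor through a \<open>\<phi>\<close>-map are completely bounded\<close>

lemma bounded_operator_bound:
  assumes "bounded_operator L type_hilbert S"
  obtains C where "\<And>x. x \<in> hcarrier L \<Longrightarrow> norm (S x) \<le> C * hnorm L x"
  using assms unfolding bounded_operator_def hnorm_type_hilbert by blast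

lemma bounded_operator_type_hilbert:
  assumes "bounded_operator type_hilbert type_hilbert T"
  obtains C where "0 \<le> C" "\<And>x. norm (T x) \<le> C * norm x"
proof -
  obtain C where "\<And>x. x \<in> hcarrier type_hilbert \<Longrightarrow> norm (T x) \<le> C * hnorm type_hilbert x"
    using bounded_operator_bound[OF assms] by blast
  moreover have "x \<in> hcarrier type_hilbert" for x :: 'a
    by (simp add: type_hilbert_def)
  ultimately have C: "norm (T x) \<le> C * norm x" for x
    by (metis hnorm_type_hilbert)
  have "norm (T x) \<le> max C 0 * norm x" for x
    using C[of x] mult_right_mono[of C "max C 0" "norm x"] by simp
  then show ?thesis
    using that[of "max C 0"] by simp
qed

text \<open>\<open>L\<close> is a record, so a finite sum of its vectors is described by what it
  does: its image under \<open>S\<close> and its inner products.\<close>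

lemma (in hilbert_space) finite_sum_exists:
  fixes n :: nat
  assumes S: "bounded_operator L type_hilbert S" and w: "\<And>j. j < n \<Longrightarrow> w j \<in> hcarrier L"
  shows "\<exists>v\<in>hcarrier L. S v = (\<Sum>j<n. S (w j)) \<and>
    (\<forall>u\<in>hcarrier L. hinner L u v = (\<Sum>j<n. hinner L u (w j)))"
  using w
proof (induction n)
  case 0
  \<comment> \<open>Written as a multiple by 0, so that its image and its inner products vanish by
    homogeneity.\<close>
  let ?v = "hscale L 0 (hzero L)"
  have "S ?v = 0"
    using S zero_closed by (simp add: bounded_operator_def type_hilbert_def)
  then show ?case
    by (intro bexI[of _ ?v]) (simp_all add: inner_scale_right zero_closed scale_closed)
next
  case (Suc n)
  then obtain v where v: "v \<in> hcarrier L" "S v = (\<Sum>j<n. S (w j))"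
    "\<forall>u\<in>hcarrier L. hinner L u v = (\<Sum>j<n. hinner L u (w j))"
    by auto
  have "S (hadd L v (w n)) = S v + S (w n)"
    using S v Suc.prems by (simp add: bounded_operator_def type_hilbert_def)
  then show ?case
    using v Suc.prems
    by (intro bexI[of _ "hadd L v (w n)"]) (simp_all add: inner_add_right add_closed)
qed

lemma (in hilbert_space) bounded_operator_null:
  assumes S: "bounded_operator L type_hilbert S" and v: "v \<in> hcarrier L" "hinner L v v = 0"
  shows "S v = 0"
proof -
  obtain C where C: "\<And>x. x \<in> hcarrier L \<Longrightarrow> norm (S x) \<le> C * hnorm L x"
    using bounded_operator_bound[OF S] by blast
  show ?thesis
    using C[OF v(1)] v(2) by (simp add: hnorm_def)
qed

locale phi_factorization = hilbert_cstar_module act ip + hilbert_space L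
  for act :: "'e::{complex_normed_vector,banach} \<Rightarrow> 'a::unital_cstar_algebra \<Rightarrow> 'e"
    and ip :: "'e \<Rightarrow> 'e \<Rightarrow> 'a" and L :: "'l hilbert" +
  fixes \<phi> :: "'a \<Rightarrow> 'h::chilbert_space \<Rightarrow> 'h" and \<Gamma> :: "'e \<Rightarrow> 'h \<Rightarrow> 'l" and S :: "'l \<Rightarrow> 'k::chilbert_space"
  assumes cp: "completely_positive \<phi>"
    and phi_map: "phi_map ip \<phi> L \<Gamma>"
    and S: "bounded_operator L type_hilbert S"
begin

lemma \<Gamma>_closed: "\<Gamma> x h \<in> hcarrier L"
  using phi_map by (simp add: phi_map_def bounded_operator_def type_hilbert_def)

lemma inner_\<Gamma>: "hinner L (\<Gamma> x h) (\<Gamma> y g) = cinner h (\<phi> (ip x y) g)"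
proof -
  have "hadjoint type_hilbert L (\<Gamma> x) (\<Gamma> y g) = \<phi> (ip x y) g"
    using phi_map by (metis phi_map_def comp_apply)
  moreover have "cinner (hadjoint type_hilbert L (\<Gamma> x) (\<Gamma> y g)) h = hinner L (\<Gamma> y g) (\<Gamma> x h)"
    using phi_map by (intro hilbert_adjoint hilbert_space_axioms \<Gamma>_closed) (simp add: phi_map_def)
  ultimately show ?thesis
    by (metis \<Gamma>_closed inner_commute cinner_commute)
qed

lemma \<phi>_add: "\<phi> (a + b) h = \<phi> a h + \<phi> b h"
  using cp by (simp add: completely_positive_def linear_into_operators_def)

lemma \<phi>_scaleC: "\<phi> (c *\<^sub>C a) h = c *\<^sub>C \<phi> a h"
  using cp by (simp add: completely_positive_def linear_into_operators_def)

lemma \<phi>_zero: "\<phi> 0 h = 0"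
  using \<phi>_add[of 0 0 h] by simp

lemma \<phi>_diff: "\<phi> (a - b) h = \<phi> a h - \<phi> b h"
  using \<phi>_add[of "a - b" b h] by (simp add: algebra_simps)

lemma \<phi>_sum: "\<phi> (\<Sum>i\<in>I. f i) h = (\<Sum>i\<in>I. \<phi> (f i) h)"
  by (induction I rule: infinite_finite_induct) (simp_all add: \<phi>_add \<phi>_zero)

lemma S_add: "x \<in> hcarrier L \<Longrightarrow> y \<in> hcarrier L \<Longrightarrow> S (hadd L x y) = S x + S y"
  using S by (simp add: bounded_operator_def type_hilbert_def)

lemma S_scale: "x \<in> hcarrier L \<Longrightarrow> S (hscale L c x) = c *\<^sub>C S x"
  using S by (simp add: bounded_operator_def type_hilbert_def)

text \<open>A \<phi>-map is not assumed linear. Its defect of additivity or homogeneity is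
  orthogonal to every \<Gamma> z h, because \<phi> is linear and \<open>ip\<close> is linear in its
  second variable. The defect is itself a combination of such vectors, so it is null and
  \<open>S\<close> kills it.\<close>

lemma linear: "linear_into_operators (\<lambda>x. S \<circ> \<Gamma> x)"
  unfolding linear_into_operators_def
proof (intro conjI allI)
  fix x y :: 'e and h :: 'h and c :: complex
  let ?d = "\<lambda>u v. hadd L u (hscale L (- 1) v)"
  note closed = \<Gamma>_closed add_closed scale_closed
  have "hinner L (\<Gamma> z h) (?d (\<Gamma> (x + y) h) (hadd L (\<Gamma> x h) (\<Gamma> y h))) = 0" for z
    by (simp add: inner_add_right inner_scale_right closed inner_\<Gamma> ip_add_right \<phi>_add
        cinner_add_right)
  then have *: "hinner L (?d (\<Gamma> (x + y) h) (hadd L (\<Gamma> x h) (\<Gamma> y h)))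
      (?d (\<Gamma> (x + y) h) (hadd L (\<Gamma> x h) (\<Gamma> y h))) = 0"
    by (subst pre.inner_add_left; (intro closed)?; subst pre.inner_scale_left; (intro closed)?;
        subst pre.inner_add_left; (intro closed)?) auto
  have "S (?d (\<Gamma> (x + y) h) (hadd L (\<Gamma> x h) (\<Gamma> y h))) = 0"
    by (rule bounded_operator_null[OF S _ *]) (intro closed)
  then show "(S \<circ> \<Gamma> (x + y)) h = (S \<circ> \<Gamma> x) h + (S \<circ> \<Gamma> y) h"
    by (simp add: S_add S_scale closed scaleC_one add_eq_0_iff2 add.commute)
  have "hinner L (\<Gamma> z h) (?d (\<Gamma> (c *\<^sub>C x) h) (hscale L c (\<Gamma> x h))) = 0" for z
    by (simp add: inner_add_right inner_scale_right closed inner_\<Gamma> ip_scaleC_right \<phi>_scaleC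
        cinner_scaleC_right)
  then have *: "hinner L (?d (\<Gamma> (c *\<^sub>C x) h) (hscale L c (\<Gamma> x h)))
      (?d (\<Gamma> (c *\<^sub>C x) h) (hscale L c (\<Gamma> x h))) = 0"
    by (subst pre.inner_add_left; (intro closed)?; subst pre.inner_scale_left; (intro closed)?;
        subst pre.inner_scale_left; (intro closed)?) auto
  have "S (?d (\<Gamma> (c *\<^sub>C x) h) (hscale L c (\<Gamma> x h))) = 0"
    by (rule bounded_operator_null[OF S _ *]) (intro closed)
  then show "(S \<circ> \<Gamma> (c *\<^sub>C x)) h = c *\<^sub>C (S \<circ> \<Gamma> x) h"
    by (simp add: S_add S_scale closed scaleC_one)
qed

lemma Re_sum_phi_le:
  assumes M: "\<And>h. norm (\<phi> 1 h) \<le> M * norm h" and x: "module_matrix_norm ip n x \<le> 1"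
  shows "Re (\<Sum>j<n. cinner (h j) (\<Sum>l<n. \<phi> (module_matrix_ip ip n x x j l) (h l))) \<le> M * (\<Sum>j<n. (norm (h j))\<^sup>2)"
proof -
  define G where "G = module_matrix_ip ip n x x"
  have "star (G i j) = G j i" for i j
    by (simp add: G_def module_matrix_ip_def star_sum flip: ip_star)
  moreover have "cstar_matrix_norm n G \<le> 1"
    using x by (simp add: module_matrix_norm_def G_def)
  ultimately have "cstar_matrix_positive n (\<lambda>i j. (if i = j then 1 else 0) - G i j)"
    by (intro one_minus_contraction_positive)
  then have "operator_matrix_positive n (\<lambda>i j. \<phi> ((if i = j then 1 else 0) - G i j))"
    using cp by (simp add: completely_positive_def)
  then have "0 \<le> Re (\<Sum>i<n. cinner (h i) (\<Sum>j<n. \<phi> ((if i = j then 1 else 0) - G i j) (h j)))"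
    unfolding operator_matrix_positive_def complex_nonneg_Reals_iff by blast
  also have "(\<Sum>i<n. cinner (h i) (\<Sum>j<n. \<phi> ((if i = j then 1 else 0) - G i j) (h j)))
      = (\<Sum>i<n. cinner (h i) (\<phi> 1 (h i))) - (\<Sum>i<n. cinner (h i) (\<Sum>j<n. \<phi> (G i j) (h j)))"
  proof -
    have "(\<Sum>j<n. \<phi> (if i = j then 1 else 0) (h j)) = \<phi> 1 (h i)" if "i < n" for i
    proof -
      have "(\<Sum>j<n. \<phi> (if i = j then 1 else 0) (h j)) = (\<Sum>j<n. if i = j then \<phi> 1 (h j) else 0)"
        by (rule sum.cong) (simp_all add: \<phi>_zero)
      with that show ?thesis by simp
    qed
    then show ?thesis
      by (simp add: \<phi>_diff sum_subtractf cinner_diff_right)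
  qed
  finally have "Re (\<Sum>i<n. cinner (h i) (\<Sum>j<n. \<phi> (G i j) (h j))) \<le> (\<Sum>i<n. Re (cinner (h i) (\<phi> 1 (h i))))"
    by simp
  also have "\<dots> \<le> (\<Sum>i<n. M * (norm (h i))\<^sup>2)"
  proof (rule sum_mono)
    fix i
    have "Re (cinner (h i) (\<phi> 1 (h i))) \<le> norm (h i) * norm (\<phi> 1 (h i))"
      unfolding inner_eq_Re_cinner[symmetric] by (rule norm_cauchy_schwarz)
    also have "\<dots> \<le> norm (h i) * (M * norm (h i))"
      by (intro mult_left_mono M norm_ge_zero)
    finally show "Re (cinner (h i) (\<phi> 1 (h i))) \<le> M * (norm (h i))\<^sup>2"
      by (simp add: power2_eq_square mult_ac)
  qed
  finally show ?thesis
    by (simp add: G_def sum_distrib_left)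
qed

lemma completely_bounded: "completely_bounded ip (\<lambda>x. S \<circ> \<Gamma> x)"
proof -
  obtain C where C: "\<And>v. v \<in> hcarrier L \<Longrightarrow> norm (S v) \<le> C * hnorm L v"
    using bounded_operator_bound[OF S] by blast
  obtain M where M: "0 \<le> M" "\<And>h. norm (\<phi> 1 h) \<le> M * norm h"
    using cp bounded_operator_type_hilbert unfolding completely_positive_def by metis
  \<comment> \<open>The vector v stands for the sum of the \<Gamma> (y j) (h j); its squared norm is
    the Gram sum on the right.\<close>
  have row: "(norm (\<Sum>j<n. S (\<Gamma> (y j) (h j))))\<^sup>2
      \<le> C\<^sup>2 * Re (\<Sum>j<n. \<Sum>l<n. cinner (h j) (\<phi> (ip (y j) (y l)) (h l)))" for n and y :: "nat \<Rightarrow> 'e" and h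
  proof -
    obtain v where v: "v \<in> hcarrier L" "S v = (\<Sum>j<n. S (\<Gamma> (y j) (h j)))"
      "\<And>u. u \<in> hcarrier L \<Longrightarrow> hinner L u v = (\<Sum>j<n. hinner L u (\<Gamma> (y j) (h j)))"
      using finite_sum_exists[OF S, of n "\<lambda>j. \<Gamma> (y j) (h j)"] \<Gamma>_closed by blast
    have "hinner L (\<Gamma> z g) v = (\<Sum>l<n. cinner g (\<phi> (ip z (y l)) (h l)))" for z g
      by (simp add: v(3) \<Gamma>_closed inner_\<Gamma>)
    then have "hinner L v (\<Gamma> z g) = cnj (\<Sum>l<n. cinner g (\<phi> (ip z (y l)) (h l)))" for z g
      by (metis \<Gamma>_closed inner_commute v(1))
    then have "hinner L v v = (\<Sum>j<n. cnj (\<Sum>l<n. cinner (h j) (\<phi> (ip (y j) (y l)) (h l))))"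
      by (simp add: v(3)[OF v(1)])
    then have "Re (hinner L v v) = Re (\<Sum>j<n. \<Sum>l<n. cinner (h j) (\<phi> (ip (y j) (y l)) (h l)))"
      by simp
    moreover have "(norm (S v))\<^sup>2 \<le> (C * hnorm L v)\<^sup>2"
      using C[OF v(1)] by (intro power_mono) auto
    ultimately show ?thesis
      by (simp add: v(1,2) power_mult_distrib pre.hnorm_power2)
  qed
  have "amplification_norm ip (\<lambda>x. S \<circ> \<Gamma> x) n \<le> ereal (sqrt (C\<^sup>2 * M))" for n
    unfolding amplification_norm_def
  proof (rule SUP_least)
    fix x assume "x \<in> {x. module_matrix_norm ip n x \<le> 1}"
    then have x: "module_matrix_norm ip n x \<le> 1"
      by simp
    have "operator_matrix_norm n (\<lambda>i j. S \<circ> \<Gamma> (x i j)) \<le> sqrt (C\<^sup>2 * M)"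
      unfolding operator_matrix_norm_def
    proof (rule cSUP_least)
      show "{h::nat \<Rightarrow> 'h. direct_sum_norm n h \<le> 1} \<noteq> {}"
        by (auto intro!: exI[of _ "\<lambda>_. 0"] simp: direct_sum_norm_def)
      fix h :: "nat \<Rightarrow> 'h" assume "h \<in> {h. direct_sum_norm n h \<le> 1}"
      then have h: "(\<Sum>j<n. (norm (h j))\<^sup>2) \<le> 1"
        by (simp add: direct_sum_norm_def)
      have "(\<Sum>i<n. (norm (\<Sum>j<n. S (\<Gamma> (x i j) (h j))))\<^sup>2)
          \<le> (\<Sum>i<n. C\<^sup>2 * Re (\<Sum>j<n. \<Sum>l<n. cinner (h j) (\<phi> (ip (x i j) (x i l)) (h l))))"
        by (intro sum_mono row)
      also have "\<dots> = C\<^sup>2 * Re (\<Sum>i<n. \<Sum>j<n. \<Sum>l<n. cinner (h j) (\<phi> (ip (x i j) (x i l)) (h l)))"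
        by (simp add: sum_distrib_left)
      \<comment> \<open>Summing over the rows i inside \<phi> produces the entries of <x,
        x>.\<close>
      also have "(\<Sum>i<n. \<Sum>j<n. \<Sum>l<n. cinner (h j) (\<phi> (ip (x i j) (x i l)) (h l)))
          = (\<Sum>j<n. cinner (h j) (\<Sum>l<n. \<phi> (module_matrix_ip ip n x x j l) (h l)))"
      proof -
        have "(\<Sum>i<n. \<Sum>j<n. \<Sum>l<n. cinner (h j) (\<phi> (ip (x i j) (x i l)) (h l)))
            = (\<Sum>j<n. \<Sum>l<n. \<Sum>i<n. cinner (h j) (\<phi> (ip (x i j) (x i l)) (h l)))"
          by (subst sum.swap) (intro sum.cong refl sum.swap)
        then show ?thesis
          by (simp add: module_matrix_ip_def \<phi>_sum cinner_sum_right)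
      qed
      also have "C\<^sup>2 * Re \<dots> \<le> C\<^sup>2 * (M * (\<Sum>j<n. (norm (h j))\<^sup>2))"
        by (intro mult_left_mono Re_sum_phi_le M x zero_le_power2)
      also have "\<dots> \<le> C\<^sup>2 * M"
        using h M by (simp add: mult_left_le mult_left_mono)
      finally show "direct_sum_norm n (\<lambda>i. \<Sum>j<n. (S \<circ> \<Gamma> (x i j)) (h j)) \<le> sqrt (C\<^sup>2 * M)"
        by (simp add: direct_sum_norm_def)
    qed
    then show "ereal (operator_matrix_norm n (\<lambda>i j. S \<circ> \<Gamma> (x i j))) \<le> ereal (sqrt (C\<^sup>2 * M))"
      by simp
  qed
  then have "(SUP n. amplification_norm ip (\<lambda>x. S \<circ> \<Gamma> x) n) \<le> ereal (sqrt (C\<^sup>2 * M))"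
    by (intro SUP_least)
  then show ?thesis
    unfolding completely_bounded_def by (rule le_less_trans) simp
qed

end

theorem completely_bounded_if_factors:
  assumes "hilbert_cstar_module act ip" "factors_through_phi_map ip \<Phi> TYPE('l)"
  shows "linear_into_operators \<Phi> \<and> completely_bounded ip \<Phi>"
proof -
  obtain \<phi> and L :: "'l hilbert" and \<Gamma> S where *: "completely_positive \<phi>" "hilbert_space L" "phi_map ip \<phi> L \<Gamma>"
    "bounded_operator L type_hilbert S" "\<And>x. \<Phi> x = S \<circ> \<Gamma> x"
    using assms(2) unfolding factors_through_phi_map_def by blast
  interpret phi_factorization act ip L \<phi> \<Gamma> S
    using assms(1) * by (simp add: phi_factorization_def phi_factorization_axioms_def)
  have "\<Phi> = (\<lambda>x. S \<circ> \<Gamma> x)"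
    using *(5) by blast
  then show ?thesis
    using linear completely_bounded by simp
qed

section \<open>Linear functionals dominated by a sublinear one\<close>

definition sublinear_on :: "'v::real_vector set \<Rightarrow> ('v \<Rightarrow> real) \<Rightarrow> bool"
  where "sublinear_on V p \<longleftrightarrow> (\<forall>x\<in>V. \<forall>y\<in>V. p (x + y) \<le> p x + p y) \<and>
    (\<forall>x\<in>V. \<forall>r\<ge>0. p (r *\<^sub>R x) \<le> r * p x)"

lemma sublinear_on_add: "sublinear_on V p \<Longrightarrow> x \<in> V \<Longrightarrow> y \<in> V \<Longrightarrow> p (x + y) \<le> p x + p y"
  by (simp add: sublinear_on_def)

lemma sublinear_on_scaleR_le: "sublinear_on V p \<Longrightarrow> x \<in> V \<Longrightarrow> 0 \<le> r \<Longrightarrow> p (r *\<^sub>R x) \<le> r * p x"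
  by (simp add: sublinear_on_def)

lemma sublinear_on_zero:
  assumes "subspace V" "sublinear_on V p"
  shows "p 0 = 0"
proof -
  have "0 \<in> V"
    using assms(1) by (rule subspace_0)
  then show ?thesis
    using sublinear_on_add[OF assms(2), of 0 0] sublinear_on_scaleR_le[OF assms(2), of 0 0] by simp
qed

lemma sublinear_on_scaleR:
  assumes "subspace V" "sublinear_on V p" "x \<in> V" "0 \<le> r"
  shows "p (r *\<^sub>R x) = r * p x"
proof (cases "r = 0")
  case False
  have "r *\<^sub>R x \<in> V"
    using assms by (simp add: subspace_scale)
  then have "p ((1/r) *\<^sub>R (r *\<^sub>R x)) \<le> (1/r) * p (r *\<^sub>R x)"
    using assms by (intro sublinear_on_scaleR_le) auto
  then have "r * p x \<le> p (r *\<^sub>R x)"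
    using False assms by (simp add: field_simps)
  then show ?thesis
    using sublinear_on_scaleR_le[OF assms(2-4)] by simp
qed (use assms sublinear_on_zero in auto)

lemma sublinear_on_ge:
  assumes "subspace V" "sublinear_on V p" "x \<in> V"
  shows "- p (- x) \<le> p x"
  using sublinear_on_add[OF assms(2,3) subspace_neg[OF assms(1,3)]] sublinear_on_zero[OF assms(1,2)] by simp

text \<open>The linear functional is a minimal element of the set of sublinear functionals below \<open>p\<close>.\<close>

lemma minimal_sublinear_exists:
  assumes V: "subspace V" and p: "sublinear_on V p"
  obtains q where "sublinear_on V q" "\<And>x. x \<in> V \<Longrightarrow> q x \<le> p x"
    "\<And>q'. sublinear_on V q' \<Longrightarrow> (\<And>x. x \<in> V \<Longrightarrow> q' x \<le> q x) \<Longrightarrow> (\<And>x. x \<in> V \<Longrightarrow> q' x = q x)"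
proof -
  \<comment> \<open>Members of A vanish off V, so that antisymmetry of P is equality of
    functions.\<close>
  define A where "A = {q. sublinear_on V q \<and> (\<forall>x\<in>V. q x \<le> p x) \<and> (\<forall>x. x \<notin> V \<longrightarrow> q x = 0)}"
  define P :: "('a \<Rightarrow> real) \<Rightarrow> ('a \<Rightarrow> real) \<Rightarrow> bool" where "P q q' \<longleftrightarrow> (\<forall>x. q' x \<le> q x)" for q q'
  have restrict: "sublinear_on V (\<lambda>x. if x \<in> V then q x else 0)" if "sublinear_on V q" for q
    using that V by (simp add: sublinear_on_def subspace_add subspace_scale)
  have ge: "- p (- x) \<le> q x" if "q \<in> A" "x \<in> V" for q x
  proof -
    have "q (- x) \<le> p (- x)"
      using that V by (simp add: A_def subspace_neg)
    with sublinear_on_ge[OF V _ that(2), of q] that(1) show ?thesis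
      by (simp add: A_def)
  qed
  have "\<exists>m\<in>A. \<forall>a\<in>A. P m a \<longrightarrow> a = m"
  proof (rule predicate_Zorn)
    show "partial_order_on A (relation_of P A)"
    proof (rule partial_order_on_relation_ofI)
      show "P a c" if "P a b" "P b c" for a b c
        using that by (auto simp: P_def intro: order_trans)
      show "a = b" if "P a b" "P b a" for a b
        using that by (auto simp: P_def intro!: ext antisym)
    qed (simp add: P_def)
    fix C assume C: "C \<in> Chains (relation_of P A)"
    then have CA: "C \<subseteq> A" and chain: "\<And>q q'. q \<in> C \<Longrightarrow> q' \<in> C \<Longrightarrow> P q q' \<or> P q' q"
      by (auto simp: Chains_def relation_of_def)
    show "\<exists>u\<in>A. \<forall>a\<in>C. P a u"
    proof (cases "C = {}")
      case True
      have "(\<lambda>x. if x \<in> V then p x else 0) \<in> A"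
        using restrict[OF p] by (simp add: A_def)
      with True show ?thesis
        by blast
    next
      case False
      define u where "u x = (INF q\<in>C. q x)" for x
      have bdd: "bdd_below ((\<lambda>q. q x) ` C)" for x
      proof (cases "x \<in> V")
        case True
        then show ?thesis
          using CA ge by (intro bdd_belowI2[of _ "- p (- x)"]) auto
      next
        case False
        then show ?thesis
          using CA by (intro bdd_belowI2[of _ 0]) (auto simp: A_def)
      qed
      have u_le: "u x \<le> q x" if "q \<in> C" for q x
        unfolding u_def by (rule cINF_lower[OF bdd that])
      have u_ge: "z \<le> u x" if "\<And>q. q \<in> C \<Longrightarrow> z \<le> q x" for z x
        unfolding u_def by (rule cINF_greatest[OF False that])
      have "sublinear_on V u"
        unfolding sublinear_on_def
      proof (intro conjI ballI allI impI)
        fix x y assume xy: "x \<in> V" "y \<in> V"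
        \<comment> \<open>Subadditivity of the infimum needs one member s of the chain below both q
          and q'.\<close>
        have le: "u (x + y) \<le> q x + q' y" if qq: "q \<in> C" "q' \<in> C" for q q'
        proof -
          obtain s where s: "s \<in> C" "P q s" "P q' s"
            using chain[OF qq] qq by (auto simp: P_def)
          have "s (x + y) \<le> s x + s y"
            using s CA xy by (intro sublinear_on_add) (auto simp: A_def)
          moreover have "s x \<le> q x" "s y \<le> q' y"
            using s by (auto simp: P_def)
          ultimately show ?thesis
            using u_le[OF s(1), of "x + y"] by linarith
        qed
        have "u (x + y) - q' y \<le> u x" if "q' \<in> C" for q'
          using le[OF _ that] by (intro u_ge) (simp add: diff_le_eq)
        then have "u (x + y) - u x \<le> u y"
          by (intro u_ge) (smt (verit))
        then show "u (x + y) \<le> u x + u y"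
          by simp
      next
        fix x and r :: real assume x: "x \<in> V" and r: "0 \<le> r"
        have le: "u (r *\<^sub>R x) \<le> r * q x" if "q \<in> C" for q
          using sublinear_on_scaleR_le[OF _ x r, of q] CA that u_le[OF that, of "r *\<^sub>R x"]
          by (force simp: A_def)
        show "u (r *\<^sub>R x) \<le> r * u x"
        proof (cases "r = 0")
          case True
          with le False show ?thesis
            by auto
        next
          case False
          have "u (r *\<^sub>R x) / r \<le> u x"
            using le False r by (intro u_ge) (simp add: field_simps)
          with False r show ?thesis
            by (simp add: field_simps)
        qed
      qed
      moreover obtain q where q: "q \<in> C"
        using False by blast
      then have "u x \<le> p x" if "x \<in> V" for x
        using u_le[OF q, of x] CA that by (force simp: A_def)
      moreover have "u x = 0" if "x \<notin> V" for x
      proof (rule antisym)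
        show "u x \<le> 0"
          using u_le[OF q, of x] CA that q by (force simp: A_def)
        show "0 \<le> u x"
          using CA that by (intro u_ge) (force simp: A_def)
      qed
      ultimately have "u \<in> A"
        by (simp add: A_def)
      then show ?thesis
        using u_le by (auto simp: P_def)
    qed
  qed
  then obtain m where m: "m \<in> A" "\<And>a. a \<in> A \<Longrightarrow> P m a \<Longrightarrow> a = m"
    by blast
  show ?thesis
  proof (rule that[of m])
    show "sublinear_on V m" "\<And>x. x \<in> V \<Longrightarrow> m x \<le> p x"
      using m(1) by (auto simp: A_def)
    fix q' x assume q': "sublinear_on V q'" "\<And>x. x \<in> V \<Longrightarrow> q' x \<le> m x" and x: "x \<in> V"
    let ?q = "\<lambda>x. if x \<in> V then q' x else 0"
    have "?q \<in> A"
      using restrict[OF q'(1)] q'(2) m(1) by (force simp: A_def)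
    moreover have "P m ?q"
      using q'(2) m(1) by (simp add: P_def A_def)
    ultimately have "?q = m"
      by (rule m(2))
    with x show "q' x = m x"
      by (auto dest: fun_cong[of _ _ x])
  qed
qed

theorem sublinear_dominates_linear:
  assumes V: "subspace V" and p: "sublinear_on V p"
  obtains F where "\<And>x y. x \<in> V \<Longrightarrow> y \<in> V \<Longrightarrow> F (x + y) = F x + F y"
    "\<And>r x. x \<in> V \<Longrightarrow> F (r *\<^sub>R x) = r * F x" "\<And>x. x \<in> V \<Longrightarrow> F x \<le> p x"
proof (rule minimal_sublinear_exists[OF V p])
  fix q assume q: "sublinear_on V q" "\<And>x. x \<in> V \<Longrightarrow> q x \<le> p x"
    and minimal: "\<And>q'. sublinear_on V q' \<Longrightarrow> (\<And>x. x \<in> V \<Longrightarrow> q' x \<le> q x) \<Longrightarrow> (\<And>x. x \<in> V \<Longrightarrow> q' x = q x)"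
  note add = sublinear_on_add[OF q(1)] and scale = sublinear_on_scaleR[OF V q(1)]
  note Vs = subspace_add[OF V] subspace_scale[OF V] subspace_neg[OF V]
  have ge: "q y + q x \<le> q (y + x)" if x: "x \<in> V" and y: "y \<in> V" for x y
  proof -
    \<comment> \<open>s makes q as small as possible in the direction x while staying sublinear.
      Minimality forces s = q, and the term t = 1 of the infimum then gives superadditivity.\<close>
    define s where "s y = (INF t\<in>{0..}. q (y + t *\<^sub>R x) - t * q x)" for y
    have bdd: "bdd_below ((\<lambda>t. q (y + t *\<^sub>R x) - t * q x) ` {0..})" if "y \<in> V" for y
    proof (rule bdd_belowI2)
      fix t :: real assume "t \<in> {0..}"
      have "q (t *\<^sub>R x) \<le> q (y + t *\<^sub>R x) + q (- y)"
        using add[of "y + t *\<^sub>R x" "- y"] x that by (simp add: Vs)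
      then show "- q (- y) \<le> q (y + t *\<^sub>R x) - t * q x"
        using scale[OF x, of t] \<open>t \<in> {0..}\<close> by simp
    qed
    have s_le: "s y \<le> q (y + t *\<^sub>R x) - t * q x" if "y \<in> V" "0 \<le> t" for y t
      unfolding s_def using that by (intro cINF_lower bdd) auto
    have s_ge: "z \<le> s y" if "\<And>t. 0 \<le> t \<Longrightarrow> z \<le> q (y + t *\<^sub>R x) - t * q x" for z y
      unfolding s_def using that by (intro cINF_greatest) auto
    have "sublinear_on V s"
      unfolding sublinear_on_def
    proof (intro conjI ballI allI impI)
      fix y z assume yz: "y \<in> V" "z \<in> V"
      have le: "s (y + z) \<le> (q (y + a *\<^sub>R x) - a * q x) + (q (z + b *\<^sub>R x) - b * q x)" if "0 \<le> a" "0 \<le> b" for a b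
      proof -
        have "s (y + z) \<le> q (y + z + (a + b) *\<^sub>R x) - (a + b) * q x"
          using yz that by (intro s_le) (auto simp: Vs)
        also have "y + z + (a + b) *\<^sub>R x = (y + a *\<^sub>R x) + (z + b *\<^sub>R x)"
          by (simp add: algebra_simps)
        also have "q \<dots> \<le> q (y + a *\<^sub>R x) + q (z + b *\<^sub>R x)"
          using yz x by (intro add) (auto simp: Vs)
        finally show ?thesis
          by (simp add: algebra_simps)
      qed
      have "s (y + z) - (q (z + b *\<^sub>R x) - b * q x) \<le> s y" if "0 \<le> b" for b
        using le[OF _ that] by (intro s_ge) (smt (verit))
      then have "s (y + z) - s y \<le> s z"
        by (intro s_ge) (smt (verit))
      then show "s (y + z) \<le> s y + s z"
        by simp
    next
      fix y and r :: real assume y: "y \<in> V" and r: "0 \<le> r"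
      show "s (r *\<^sub>R y) \<le> r * s y"
      proof (cases "r = 0")
        case True
        then show ?thesis
          using s_le[of 0 0] subspace_0[OF V] sublinear_on_zero[OF V q(1)] by simp
      next
        case False
        have "s (r *\<^sub>R y) / r \<le> q (y + t *\<^sub>R x) - t * q x" if "0 \<le> t" for t
        proof -
          have "s (r *\<^sub>R y) \<le> q (r *\<^sub>R y + (r * t) *\<^sub>R x) - (r * t) * q x"
            using y r that by (intro s_le) (auto simp: Vs)
          also have "r *\<^sub>R y + (r * t) *\<^sub>R x = r *\<^sub>R (y + t *\<^sub>R x)"
            by (simp add: scaleR_add_right)
          also have "q \<dots> = r * q (y + t *\<^sub>R x)"
            using x y r by (intro scale) (auto simp: Vs)
          finally show ?thesis
            using False r by (simp add: field_simps)
        qed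
        then have "s (r *\<^sub>R y) / r \<le> s y"
          by (rule s_ge)
        with False r show ?thesis
          by (simp add: field_simps)
      qed
    qed
    moreover have "s y \<le> q y" if "y \<in> V" for y
      using s_le[OF that, of 0] by simp
    ultimately have "s y = q y"
      using y by (rule minimal)
    with s_le[OF y, of 1] show ?thesis
      by simp
  qed
  have additive: "q (x + y) = q x + q y" if "x \<in> V" "y \<in> V" for x y
    using add[OF that] ge[OF that(2,1)] by simp
  have neg: "q (- x) = - q x" if "x \<in> V" for x
    using additive[OF that Vs(3)[OF that]] sublinear_on_zero[OF V q(1)] by simp
  have "q (r *\<^sub>R x) = r * q x" if "x \<in> V" for r x
  proof (cases "0 \<le> r")
    case True
    then show ?thesis
      by (rule scale[OF that])
  next
    case False
    have "q (r *\<^sub>R x) = q (- ((- r) *\<^sub>R x))"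
      by simp
    also have "\<dots> = - q ((- r) *\<^sub>R x)"
      by (rule neg) (simp add: Vs that)
    also have "q ((- r) *\<^sub>R x) = (- r) * q x"
      using False that by (intro scale) auto
    finally show ?thesis
      by simp
  qed
  with additive q(2) show thesis
    by (intro that[of q])
qed

section \<open>Frames for finite families of vectors\<close>

text \<open>
  The positive semidefinite form \<open>(u, v) \<mapsto> \<Sum>\<^sub>k \<langle>u, g\<^sub>k\<rangle>\<langle>g\<^sub>k, v\<rangle>\<close> has rank at most \<open>K\<close>. A maximal
  orthonormal family for it exists, by Bessel's inequality in \<open>\<complex>\<^sup>K\<close>.
\<close>

definition frame_form :: "nat \<Rightarrow> (nat \<Rightarrow> 'h::chilbert_space) \<Rightarrow> 'h \<Rightarrow> 'h \<Rightarrow> complex"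
  where "frame_form K g u v = (\<Sum>k<K. cinner u (g k) * cinner (g k) v)"

lemma frame_form_right:
  "frame_form K g u (v + w) = frame_form K g u v + frame_form K g u w"
  "frame_form K g u (c *\<^sub>C v) = c * frame_form K g u v"
  "frame_form K g u (v - w) = frame_form K g u v - frame_form K g u w"
  "frame_form K g u (\<Sum>i\<in>I. f i) = (\<Sum>i\<in>I. frame_form K g u (f i))"
proof -
  show "frame_form K g u (\<Sum>i\<in>I. f i) = (\<Sum>i\<in>I. frame_form K g u (f i))"
    unfolding frame_form_def by (subst sum.swap) (simp add: cinner_sum_right sum_distrib_left)
qed (simp_all add: frame_form_def cinner_add_right cinner_diff_right cinner_scaleC_right
    sum.distrib sum_subtractf sum_distrib_left algebra_simps)

lemma frame_form_commute: "frame_form K g v u = cnj (frame_form K g u v)"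
  unfolding frame_form_def cnj_sum by (rule sum.cong) (auto simp: cinner_commute[symmetric])

lemma frame_form_self: "frame_form K g u u = of_real (\<Sum>k<K. (cmod (cinner (g k) u))\<^sup>2)"
  unfolding frame_form_def of_real_sum
proof (rule sum.cong[OF refl])
  fix k
  have "cinner u (g k) = cnj (cinner (g k) u)"
    by (rule cinner_commute)
  then show "cinner u (g k) * cinner (g k) u = of_real ((cmod (cinner (g k) u))\<^sup>2)"
    by (simp only: complex_norm_square mult.commute)
qed

text \<open>The vectors with coordinates <g_k, f_p> are orthonormal in K-dimensional space. Bessel's
  inequality for each coordinate vector, summed over the coordinates, compares n with K.\<close>

lemma orthonormal_family_card_le:
  assumes on: "\<And>p q. p < n \<Longrightarrow> q < n \<Longrightarrow> frame_form K g (f p) (f q) = (if p = q then 1 else 0)"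
  shows "n \<le> K"
proof -
  define v where "v p k = cinner (g k) (f p)" for p k
  have on': "(\<Sum>l<K. cnj (v p l) * v q l) = (if p = q then 1 else 0)" if "p < n" "q < n" for p q
    using on[OF that] by (simp add: frame_form_def v_def cinner_commute[symmetric])
  have "(\<Sum>p<n. (cmod (v p k))\<^sup>2) \<le> 1" if "k < K" for k
  proof -
    \<comment> \<open>The orthogonal projection of the k-th coordinate vector onto their span; its
      k-th coordinate equals its squared norm \<alpha>.\<close>
    define w where "w l = (\<Sum>p<n. cnj (v p k) * v p l)" for l
    define \<alpha> where "\<alpha> = (\<Sum>p<n. (cmod (v p k))\<^sup>2)"
    have wk: "w k = of_real \<alpha>"
      unfolding w_def \<alpha>_def of_real_sum complex_norm_square by (simp add: mult.commute)
    have "(\<Sum>l<K. cnj (w l) * w l) = (\<Sum>l<K. \<Sum>p<n. \<Sum>q<n. v p k * cnj (v q k) * (cnj (v p l) * v q l))"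
      unfolding w_def cnj_sum sum_product by (simp add: algebra_simps)
    also have "\<dots> = (\<Sum>p<n. \<Sum>q<n. v p k * cnj (v q k) * (\<Sum>l<K. cnj (v p l) * v q l))"
      by (subst sum.swap) (simp add: sum_distrib_left sum.swap[of _ "{..<n}" "{..<K}"])
    also have "\<dots> = (\<Sum>p<n. \<Sum>q<n. if q = p then v p k * cnj (v p k) else 0)"
      by (intro sum.cong refl) (auto simp: on')
    also have "\<dots> = of_real \<alpha>"
      unfolding \<alpha>_def of_real_sum complex_norm_square by simp
    finally have ww: "(\<Sum>l<K. cnj (w l) * w l) = of_real \<alpha>" .
    have "of_real (\<Sum>l<K. (cmod ((if l = k then 1 else 0) - w l))\<^sup>2)
        = (\<Sum>l<K. (if l = k then 1 - w l - cnj (w l) else 0) + cnj (w l) * w l)"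
      unfolding of_real_sum complex_norm_square by (rule sum.cong) (auto simp: algebra_simps)
    also have "\<dots> = of_real (1 - \<alpha>)"
      using that by (simp add: sum.distrib ww wk)
    finally have *: "(\<Sum>l<K. (cmod ((if l = k then 1 else 0) - w l))\<^sup>2) = 1 - \<alpha>"
      by (simp only: of_real_eq_iff)
    have "0 \<le> 1 - \<alpha>"
      unfolding *[symmetric] by (intro sum_nonneg) simp
    then show ?thesis
      by (simp add: \<alpha>_def)
  qed
  then have "(\<Sum>k<K. \<Sum>p<n. (cmod (v p k))\<^sup>2) \<le> (\<Sum>k<K. 1)"
    by (intro sum_mono) simp
  also have "(\<Sum>k<K. \<Sum>p<n. (cmod (v p k))\<^sup>2) = (\<Sum>p<n. \<Sum>k<K. (cmod (v p k))\<^sup>2)"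
    by (rule sum.swap)
  also have "\<dots> = (\<Sum>p<n. 1)"
  proof (rule sum.cong[OF refl])
    fix p assume "p \<in> {..<n}"
    then have "of_real (\<Sum>k<K. (cmod (v p k))\<^sup>2) = (1::complex)"
      using on[of p p] by (simp add: frame_form_self v_def)
    then show "(\<Sum>k<K. (cmod (v p k))\<^sup>2) = 1"
      by (metis of_real_1 of_real_eq_iff)
  qed
  finally show ?thesis
    by simp
qed

text \<open>If some g_k saw a vector orthogonal to a family of maximal length, the vector could be
  normalised and appended. The form is degenerate, so such a vector need not be 0.\<close>

lemma maximal_orthonormal_family:
  obtains n :: nat and f where "\<And>p q. p < n \<Longrightarrow> q < n \<Longrightarrow> frame_form K g (f p) (f q) = (if p = q then 1 else 0)"
    "\<And>u k. (\<And>p. p < n \<Longrightarrow> frame_form K g (f p) u = 0) \<Longrightarrow> k < K \<Longrightarrow> cinner (g k) u = 0"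
proof -
  define Q where "Q n \<longleftrightarrow> (\<exists>f. \<forall>p<n. \<forall>q<n. frame_form K g (f p) (f q) = (if p = q then 1 else 0))" for n :: nat
  have Q0: "Q 0"
    by (simp add: Q_def)
  have bound: "n \<le> K" if "Q n" for n
    using that orthonormal_family_card_le[of n K g] unfolding Q_def by blast
  define n where "n = (GREATEST n. Q n)"
  have "Q n"
    unfolding n_def using Q0 bound by (rule GreatestI_nat)
  then obtain f where on: "\<And>p q. p < n \<Longrightarrow> q < n \<Longrightarrow> frame_form K g (f p) (f q) = (if p = q then 1 else 0)"
    by (auto simp: Q_def)
  have "\<not> Q (Suc n)"
    using Greatest_le_nat[of Q "Suc n" K] bound by (auto simp: n_def)
  show ?thesis
  proof (rule that[of n f])
    show "frame_form K g (f p) (f q) = (if p = q then 1 else 0)" if "p < n" "q < n" for p q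
      using that by (rule on)
    fix u k assume u: "\<And>p. p < n \<Longrightarrow> frame_form K g (f p) u = 0" and k: "k < K"
    show "cinner (g k) u = 0"
    proof (rule ccontr)
      assume nz: "cinner (g k) u \<noteq> 0"
      define r where "r = (\<Sum>k<K. (cmod (cinner (g k) u))\<^sup>2)"
      have "0 < (cmod (cinner (g k) u))\<^sup>2"
        using nz by simp
      also have "\<dots> \<le> r"
        unfolding r_def using k by (intro member_le_sum) auto
      finally have r: "0 < r" .
      define s where "s = 1 / sqrt r"
      have s: "s * (s * r) = 1"
        using r by (simp add: s_def field_simps)
      define w where "w = of_real s *\<^sub>C u"
      have wf: "frame_form K g (f p) w = 0" if "p < n" for p
        using u[OF that] by (simp add: w_def frame_form_right)
      then have fw: "frame_form K g w (f p) = 0" if "p < n" for p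
        using that frame_form_commute[of K g w "f p"] by simp
      have "frame_form K g u w = of_real (s * r)"
        by (simp add: w_def frame_form_right frame_form_self r_def)
      then have "frame_form K g w u = of_real (s * r)"
        by (subst frame_form_commute) simp
      then have "of_real s * frame_form K g w u = of_real (s * (s * r))"
        by simp
      then have ww: "frame_form K g w w = 1"
        unfolding s by (subst w_def) (simp add: frame_form_right)
      have "\<forall>p<Suc n. \<forall>q<Suc n. frame_form K g ((f(n := w)) p) ((f(n := w)) q) = (if p = q then 1 else 0)"
        using on wf fw ww by (auto simp: less_Suc_eq)
      then have "Q (Suc n)"
        unfolding Q_def by blast
      with \<open>\<not> Q (Suc n)\<close> show False ..
    qed
  qed
qed

text \<open>t_p is the image of f_p under the operator u \<mapsto> \<Sum>_k <g_k, u> g_k. The t_p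
  are biorthogonal to the f_p, the g_k expand in them, and the sum of the rank one operators of the
  t_p is the same operator; the last equation compares traces.\<close>

lemma frame_exists:
  fixes g :: "nat \<Rightarrow> 'h::chilbert_space"
  obtains n :: nat and f t where "\<And>p q. p < n \<Longrightarrow> q < n \<Longrightarrow> frame_form K g (f p) (f q) = (if p = q then 1 else 0)"
    "\<And>k. k < K \<Longrightarrow> g k = (\<Sum>p<n. cinner (f p) (g k) *\<^sub>C t p)"
    "(\<Sum>p<n. (norm (t p))\<^sup>2) = (\<Sum>k<K. (norm (g k))\<^sup>2)"
proof (rule maximal_orthonormal_family[of K g])
  fix n :: nat and f assume on: "\<And>p q. p < n \<Longrightarrow> q < n \<Longrightarrow> frame_form K g (f p) (f q) = (if p = q then 1 else 0)"
    and null: "\<And>u k. (\<And>p. p < n \<Longrightarrow> frame_form K g (f p) u = 0) \<Longrightarrow> k < K \<Longrightarrow> cinner (g k) u = 0"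
  define t where "t p = (\<Sum>k<K. cinner (g k) (f p) *\<^sub>C g k)" for p
  have t: "cinner (t p) u = frame_form K g (f p) u" for p u
    by (simp add: t_def frame_form_def cinner_sum_left cinner_scaleC_left cinner_commute[symmetric])
  have expand: "cinner (g k) u = (\<Sum>p<n. cinner (g k) (f p) * cinner (t p) u)" if "k < K" for k u
  proof -
    \<comment> \<open>u minus its expansion is orthogonal to the family, so no g_k sees the
      difference.\<close>
    have "cinner (g k) (u - (\<Sum>p<n. cinner (t p) u *\<^sub>C f p)) = 0"
    proof (rule null[OF _ that])
      fix q assume q: "q < n"
      have "frame_form K g (f q) (\<Sum>p<n. cinner (t p) u *\<^sub>C f p) = (\<Sum>p<n. if p = q then cinner (t q) u else 0)"
        unfolding frame_form_right(4) by (rule sum.cong) (auto simp: frame_form_right on q)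
      also have "\<dots> = frame_form K g (f q) u"
        using q by (simp add: t)
      finally show "frame_form K g (f q) (u - (\<Sum>p<n. cinner (t p) u *\<^sub>C f p)) = 0"
        by (simp add: frame_form_right(3))
    qed
    then show ?thesis
      by (simp add: cinner_diff_right cinner_sum_right cinner_scaleC_right mult.commute)
  qed
  have g: "g k = (\<Sum>p<n. cinner (f p) (g k) *\<^sub>C t p)" if "k < K" for k
  proof (rule cinner_eqI)
    fix u
    have "cinner u (g k) = cnj (\<Sum>p<n. cinner (g k) (f p) * cinner (t p) u)"
      using expand[OF that, of u] by (metis cinner_commute)
    then show "cinner u (g k) = cinner u (\<Sum>p<n. cinner (f p) (g k) *\<^sub>C t p)"
      by (simp add: cinner_sum_right cinner_scaleC_right cinner_commute[symmetric])
  qed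
  have "of_real (\<Sum>k<K. (norm (g k))\<^sup>2) = (\<Sum>k<K. cinner (g k) (g k))"
    by (simp add: cinner_self)
  also have "\<dots> = (\<Sum>k<K. \<Sum>p<n. cinner (f p) (g k) * cinner (g k) (t p))"
  proof (rule sum.cong[OF refl])
    fix k assume k: "k \<in> {..<K}"
    have "cinner (g k) (g k) = cinner (g k) (\<Sum>p<n. cinner (f p) (g k) *\<^sub>C t p)"
      using g[of k] k by simp
    then show "cinner (g k) (g k) = (\<Sum>p<n. cinner (f p) (g k) * cinner (g k) (t p))"
      by (simp add: cinner_sum_right cinner_scaleC_right)
  qed
  also have "\<dots> = (\<Sum>p<n. cinner (t p) (t p))"
    by (subst sum.swap) (simp add: t frame_form_def)
  also have "\<dots> = of_real (\<Sum>p<n. (norm (t p))\<^sup>2)"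
    by (simp add: cinner_self)
  finally have "(\<Sum>p<n. (norm (t p))\<^sup>2) = (\<Sum>k<K. (norm (g k))\<^sup>2)"
    by (simp only: of_real_eq_iff)
  with on g show thesis
    by (intro that[of n f t])
qed


section \<open>Contractive Gram matrices\<close>

definition column_ip :: "nat \<Rightarrow> (nat \<Rightarrow> 'a::unital_cstar_algebra) \<Rightarrow> (nat \<Rightarrow> 'a) \<Rightarrow> 'a"
  where "column_ip n \<xi> \<eta> = (\<Sum>i<n. star (\<xi> i) * \<eta> i)"

definition matrix_column :: "nat \<Rightarrow> (nat \<Rightarrow> nat \<Rightarrow> 'a::unital_cstar_algebra) \<Rightarrow> (nat \<Rightarrow> 'a) \<Rightarrow> nat \<Rightarrow> 'a"
  where "matrix_column n a \<xi> i = (\<Sum>j<n. a i j * \<xi> j)"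

lemma column_ip_diff:
  "column_ip n (\<lambda>i. \<xi> i - \<eta> i) \<zeta> = column_ip n \<xi> \<zeta> - column_ip n \<eta> \<zeta>"
  "column_ip n \<zeta> (\<lambda>i. \<xi> i - \<eta> i) = column_ip n \<zeta> \<xi> - column_ip n \<zeta> \<eta>"
  by (simp_all add: column_ip_def star_diff algebra_simps sum_subtractf)

lemma column_ip_adjoint:
  assumes "\<And>i j. i < n \<Longrightarrow> j < n \<Longrightarrow> star (a i j) = a j i"
  shows "column_ip n (matrix_column n a \<xi>) \<eta> = column_ip n \<xi> (matrix_column n a \<eta>)"
proof -
  have "column_ip n (matrix_column n a \<xi>) \<eta> = (\<Sum>i<n. \<Sum>j<n. star (\<xi> j) * (a j i * \<eta> i))"
    by (simp add: column_ip_def matrix_column_def star_sum star_mult sum_distrib_right mult.assoc assms)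
  also have "\<dots> = column_ip n \<xi> (matrix_column n a \<eta>)"
    by (subst sum.swap) (simp add: column_ip_def matrix_column_def sum_distrib_left)
  finally show ?thesis .
qed

text \<open>If \<open>0 \<le> G \<le> 1\<close>, then \<open>G - G\<^sup>2 = G(1 - G)G + (1 - G)G(1 - G) \<ge> 0\<close>, hence \<open>G\<^sup>2 \<le> G \<le> 1\<close>.\<close>

lemma cstar_matrix_norm_le_one:
  fixes G :: "nat \<Rightarrow> nat \<Rightarrow> 'a::unital_cstar_algebra"
  assumes sa: "\<And>i j. i < n \<Longrightarrow> j < n \<Longrightarrow> star (G i j) = G j i"
    and pos: "\<And>\<xi>. cpos (column_ip n \<xi> (matrix_column n G \<xi>))"
    and le: "\<And>\<xi>. cpos (column_ip n \<xi> \<xi> - column_ip n \<xi> (matrix_column n G \<xi>))"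
  shows "cstar_matrix_norm n G \<le> 1"
  unfolding cstar_matrix_norm_def
proof (rule cSUP_least)
  show "{\<xi>::nat \<Rightarrow> 'a. column_norm n \<xi> \<le> 1} \<noteq> {}"
    using column_norm_zero[of n, where ?'a = 'a] by (metis (mono_tags) empty_iff mem_Collect_eq zero_le_one)
  fix \<xi> :: "nat \<Rightarrow> 'a" assume "\<xi> \<in> {\<xi>. column_norm n \<xi> \<le> 1}"
  then have \<xi>: "norm (column_ip n \<xi> \<xi>) \<le> 1"
    by (simp add: column_norm_def column_ip_def)
  define \<eta> where "\<eta> = matrix_column n G \<xi>"
  define \<zeta> where "\<zeta> i = \<xi> i - \<eta> i" for i
  have G\<zeta>: "matrix_column n G \<zeta> = (\<lambda>i. \<eta> i - matrix_column n G \<eta> i)"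
    by (simp add: fun_eq_iff \<zeta>_def \<eta>_def matrix_column_def algebra_simps sum_subtractf)
  have "column_ip n \<xi> \<xi> - column_ip n \<eta> \<eta> = (column_ip n \<xi> \<xi> - column_ip n \<xi> (matrix_column n G \<xi>))
      + (column_ip n \<eta> \<eta> - column_ip n \<eta> (matrix_column n G \<eta>)) + column_ip n \<zeta> (matrix_column n G \<zeta>)"
    unfolding G\<zeta> using column_ip_adjoint[of n G \<xi> \<eta>, OF sa]
    by (simp add: \<zeta>_def[abs_def] column_ip_diff flip: \<eta>_def)
  then have "cpos (column_ip n \<xi> \<xi> - column_ip n \<eta> \<eta>)"
    by (simp only:) (intro cpos_add pos le)
  moreover have "cpos (column_ip n \<eta> \<eta>)"
    unfolding column_ip_def by (rule cpos_column)
  ultimately have "norm (column_ip n \<eta> \<eta>) \<le> norm (column_ip n \<eta> \<eta> + (column_ip n \<xi> \<xi> - column_ip n \<eta> \<eta>))"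
    by (intro cpos_norm_le)
  with \<xi> have "norm (column_ip n \<eta> \<eta>) \<le> 1"
    by simp
  then show "column_norm n (\<lambda>i. \<Sum>j<n. G i j * \<xi> j) \<le> 1"
    by (simp add: column_norm_def column_ip_def \<eta>_def matrix_column_def)
qed

lemma sum_star_mult_expand:
  "star (\<Sum>p<n. c p * \<xi> p) * (\<Sum>q<n. c q * \<xi> q) = (\<Sum>p<n. \<Sum>q<n. star (\<xi> p) * (star (c p) * c q * \<xi> q))"
  for c :: "nat \<Rightarrow> 'a::unital_cstar_algebra"
  by (simp add: star_sum star_mult sum_product mult.assoc)

text \<open>The hypothesis exhibits 1 - G as a sum of terms \<open>star b * b\<close>, hence 0 \<le>
  G \<le> 1 for the Gram matrix G of y. Matrix norms refer to square matrices, so the M by n matrix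
  y is padded with zeros.\<close>

lemma (in hilbert_cstar_module) module_matrix_norm_le_one:
  assumes K: "finite K" and b: "\<And>p q. p < n \<Longrightarrow> q < n \<Longrightarrow>
      (\<Sum>k\<in>K. star (b k p) * b k q) + (\<Sum>m<M. ip (y m p) (y m q)) = (if p = q then 1 else 0)"
    and N: "n \<le> N" "M \<le> N"
  shows "module_matrix_norm ip N (\<lambda>m p. if m < M \<and> p < n then y m p else 0) \<le> 1"
proof -
  define z where "z m p = (if m < M \<and> p < n then y m p else 0)" for m p
  define c where "c k p = (if p < n then b k p else 0)" for k p
  define G where "G = module_matrix_ip ip N z z"
  \<comment> \<open>After padding, the right-hand side is the projection onto the first n
    coordinates instead of 1, which still lies below 1.\<close>
  have G: "(\<Sum>k\<in>K. star (c k p) * c k q) + G p q = (if p = q \<and> p < n then 1 else 0)" if "p < N" "q < N" for p q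
  proof (cases "p < n \<and> q < n")
    case True
    have "G p q = (\<Sum>m<N. if m < M then ip (y m p) (y m q) else 0)"
      unfolding G_def module_matrix_ip_def by (rule sum.cong) (auto simp: z_def True)
    also have "\<dots> = (\<Sum>m<M. ip (y m p) (y m q))"
      using N by (subst sum.inter_filter[symmetric]) (auto intro!: sum.cong)
    finally show ?thesis
      using b[of p q] True by (simp add: c_def)
  next
    case False
    then show ?thesis
      by (auto simp: c_def G_def module_matrix_ip_def z_def)
  qed
  have col: "column_ip N \<xi> (matrix_column N G \<xi>) = (\<Sum>p<N. \<Sum>q<N. star (\<xi> p) * (G p q * \<xi> q))" for \<xi>
    by (simp add: column_ip_def matrix_column_def sum_distrib_left)
  have "cstar_matrix_norm N G \<le> 1"
  proof (rule cstar_matrix_norm_le_one)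
    show "star (G i j) = G j i" for i j
      by (simp add: G_def module_matrix_ip_def star_sum flip: ip_star)
    show "cpos (column_ip N \<xi> (matrix_column N G \<xi>))" for \<xi>
    proof -
      have eq: "column_ip N \<xi> (matrix_column N G \<xi>)
          = (\<Sum>p<N. \<Sum>q<N. \<Sum>m<N. ip (act (z m p) (\<xi> p)) (act (z m q) (\<xi> q)))"
        (is "_ = ?s") unfolding col by (simp add: G_def module_matrix_ip_def ip_act_left ip_act_right sum_distrib_left
            sum_distrib_right mult.assoc)
      have swap: "(\<Sum>m<N. \<Sum>p<N. \<Sum>q<N. ip (act (z m p) (\<xi> p)) (act (z m q) (\<xi> q))) = ?s"
        by (subst sum.swap) (intro sum.cong refl sum.swap)
      note eq
      also note swap[symmetric]
      also have "(\<Sum>m<N. \<Sum>p<N. \<Sum>q<N. ip (act (z m p) (\<xi> p)) (act (z m q) (\<xi> q)))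
          = (\<Sum>m<N. ip (\<Sum>p<N. act (z m p) (\<xi> p)) (\<Sum>q<N. act (z m q) (\<xi> q)))"
        by (simp only: ip_sum_left) (simp only: ip_sum_right)
      finally show ?thesis
        by (simp add: cpos_sum cpos_ip)
    qed
    show "cpos (column_ip N \<xi> \<xi> - column_ip N \<xi> (matrix_column N G \<xi>))" for \<xi>
    proof -
      have "column_ip N \<xi> (matrix_column N G \<xi>) + (\<Sum>k\<in>K. star (\<Sum>p<N. c k p * \<xi> p) * (\<Sum>q<N. c k q * \<xi> q))
          = (\<Sum>p<N. \<Sum>q<N. star (\<xi> p) * (((\<Sum>k\<in>K. star (c k p) * c k q) + G p q) * \<xi> q))"
      proof -
        have "(\<Sum>k\<in>K. star (\<Sum>p<N. c k p * \<xi> p) * (\<Sum>q<N. c k q * \<xi> q))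
            = (\<Sum>p<N. \<Sum>q<N. \<Sum>k\<in>K. star (\<xi> p) * (star (c k p) * c k q * \<xi> q))"
          unfolding sum_star_mult_expand
          by (subst sum.swap) (intro sum.cong refl sum.swap)
        then show ?thesis
          unfolding col by (simp add: sum_distrib_left sum_distrib_right algebra_simps sum.distrib)
      qed
      also have "\<dots> = (\<Sum>p<N. \<Sum>q<N. if q = p then (if p < n then star (\<xi> p) * \<xi> p else 0) else 0)"
        by (intro sum.cong refl) (auto simp: G)
      also have "\<dots> = (\<Sum>p<N. if p < n then star (\<xi> p) * \<xi> p else 0)"
        by simp
      finally have "column_ip N \<xi> \<xi> - column_ip N \<xi> (matrix_column N G \<xi>)
          = (\<Sum>k\<in>K. star (\<Sum>p<N. c k p * \<xi> p) * (\<Sum>q<N. c k q * \<xi> q))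
            + (\<Sum>p<N. star (\<xi> p) * \<xi> p - (if p < n then star (\<xi> p) * \<xi> p else 0))"
        by (simp add: column_ip_def sum_subtractf algebra_simps)
      also have "cpos \<dots>"
        by (intro cpos_add cpos_sum) (auto simp: cpos_star_mult)
      finally show ?thesis .
    qed
  qed
  then show ?thesis
    by (simp add: module_matrix_norm_def G_def z_def[abs_def])
qed

section \<open>Finite sums of elementary tensors\<close>

text \<open>
  A list of pairs \<open>(x, h)\<close> stands for the tensor \<open>\<Sum> x \<otimes> h\<close>. It acts as the antilinear map
  \<open>u \<mapsto> \<Sum> \<langle>u, h\<rangle> x\<close>, which determines it.
\<close>

definition tensor_map :: "('e::complex_vector \<times> 'h::chilbert_space) list \<Rightarrow> 'h \<Rightarrow> 'e"
  where "tensor_map X u = (\<Sum>(x, h)\<leftarrow>X. cinner u h *\<^sub>C x)"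

definition tensor_apply :: "('e \<Rightarrow> 'h \<Rightarrow> 'k::complex_vector) \<Rightarrow> ('e \<times> 'h) list \<Rightarrow> 'k"
  where "tensor_apply \<Phi> X = (\<Sum>(x, h)\<leftarrow>X. \<Phi> x h)"

lemma tensor_apply_simps [simp]:
  "tensor_apply \<Phi> [] = 0"
  "tensor_apply \<Phi> ((x, h) # X) = \<Phi> x h + tensor_apply \<Phi> X"
  "tensor_apply \<Phi> (X @ Y) = tensor_apply \<Phi> X + tensor_apply \<Phi> Y"
  by (simp_all add: tensor_apply_def)

lemma tensor_map_simps [simp]:
  "tensor_map [] u = 0"
  "tensor_map ((x, h) # X) u = cinner u h *\<^sub>C x + tensor_map X u"
  "tensor_map (X @ Y) u = tensor_map X u + tensor_map Y u"
  by (simp_all add: tensor_map_def)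

lemma tensor_map_add: "tensor_map X (u + v) = tensor_map X u + tensor_map X v"
  by (induction X) (auto simp: cinner_add_left scaleC_add_left)

lemma tensor_map_scaleC: "tensor_map X (c *\<^sub>C u) = cnj c *\<^sub>C tensor_map X u"
  by (induction X) (auto simp: cinner_scaleC_left scaleC_scaleC scaleC_add_right)

lemma tensor_map_diff: "tensor_map X (u - v) = tensor_map X u - tensor_map X v"
  using tensor_map_add[of X "u - v" v] by (simp add: algebra_simps)

lemma tensor_map_sum: "tensor_map X (\<Sum>i\<in>I. f i) = (\<Sum>i\<in>I. tensor_map X (f i))"
proof -
  have "tensor_map X 0 = 0"
    using tensor_map_add[of X 0 0] by simp
  then show ?thesis
    by (induction I rule: infinite_finite_induct) (simp_all add: tensor_map_add)
qed

lemma sum_list_map_nth: "sum_list (map f xs) = (\<Sum>i<length xs. f (xs ! i))"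
  by (simp add: sum_list_sum_nth atLeast0LessThan)

lemma tensor_map_map_upt: "tensor_map (map (\<lambda>p. (y p, t p)) [0..<n]) u = (\<Sum>p<n. cinner u (t p) *\<^sub>C y p)"
  by (simp add: tensor_map_def o_def sum_list_map_nth)

lemma tensor_apply_map_upt: "tensor_apply \<Phi> (map (\<lambda>p. (y p, t p)) [0..<n]) = (\<Sum>p<n. \<Phi> (y p) (t p))"
  by (simp add: tensor_apply_def o_def sum_list_map_nth)

lemma sum_list_scaleR_right: "(\<Sum>x\<leftarrow>xs. r *\<^sub>R f x) = r *\<^sub>R (\<Sum>x\<leftarrow>xs. f x)"
  for f :: "_ \<Rightarrow> 'v::real_vector"
  by (induction xs) (simp_all add: scaleR_add_right)


section \<open>The domination inequality of a completely bounded map\<close>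

text \<open>Complete boundedness is kept only as \<open>matrix_bound\<close>, homogeneous in v and
  free of suprema; c will be an upper bound for the norms of all amplifications.\<close>

locale cb_map = hilbert_cstar_module act ip
  for act :: "'e::{complex_normed_vector,banach} \<Rightarrow> 'a::unital_cstar_algebra \<Rightarrow> 'e"
    and ip :: "'e \<Rightarrow> 'e \<Rightarrow> 'a" +
  fixes \<Phi> :: "'e \<Rightarrow> 'h::chilbert_space \<Rightarrow> 'k::chilbert_space" and c :: real
  assumes \<Phi>_add_left: "\<Phi> (x + y) h = \<Phi> x h + \<Phi> y h"
    and \<Phi>_scaleC_left: "\<Phi> (a *\<^sub>C x) h = a *\<^sub>C \<Phi> x h"
    and \<Phi>_add_right: "\<Phi> x (h + g) = \<Phi> x h + \<Phi> x g"
    and \<Phi>_scaleC_right: "\<Phi> x (a *\<^sub>C h) = a *\<^sub>C \<Phi> x h"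
    and matrix_bound: "module_matrix_norm ip n z \<le> 1 \<Longrightarrow>
      (\<Sum>i<n. (norm (\<Sum>j<n. \<Phi> (z i j) (v j)))\<^sup>2) \<le> c\<^sup>2 * (\<Sum>j<n. (norm (v j))\<^sup>2)"

lemma cb_map_exists:
  fixes act :: "'e::{complex_normed_vector,banach} \<Rightarrow> 'a::unital_cstar_algebra \<Rightarrow> 'e"
    and ip :: "'e \<Rightarrow> 'e \<Rightarrow> 'a"
    and \<Phi> :: "'e \<Rightarrow> 'h::chilbert_space \<Rightarrow> 'k::chilbert_space"
  assumes "hilbert_cstar_module act ip"
    and op: "\<And>x. bounded_operator type_hilbert type_hilbert (\<Phi> x)"
    and lin: "linear_into_operators \<Phi>" and cb: "completely_bounded ip \<Phi>"
  obtains c where "cb_map act ip \<Phi> c"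
proof -
  interpret hilbert_cstar_module act ip by fact
  have \<Phi>_scaleC_right: "\<Phi> x (a *\<^sub>C h) = a *\<^sub>C \<Phi> x h" for x a h
    using op[of x] by (simp add: bounded_operator_def type_hilbert_def)
  have \<Phi>_scaleR: "\<Phi> x (r *\<^sub>R h) = r *\<^sub>R \<Phi> x h" for x r h
    by (simp add: scaleR_scaleC \<Phi>_scaleC_right)
  obtain C where C: "\<And>x h. norm (\<Phi> x h) \<le> C x * norm h" "\<And>x. 0 \<le> C x"
  proof -
    have "\<exists>C. 0 \<le> C \<and> (\<forall>h. norm (\<Phi> x h) \<le> C * norm h)" for x
      by (rule bounded_operator_type_hilbert[OF op[of x]]) blast
    then show ?thesis
      using that by metis
  qed
  define s where "s = (SUP n. amplification_norm ip \<Phi> n)"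
  have "s < \<infinity>"
    using cb by (simp add: completely_bounded_def s_def)
  then obtain c where c: "s \<le> ereal c"
    by (cases s) auto
  have op_norm: "operator_matrix_norm n (\<lambda>i j. \<Phi> (y i j)) \<le> c" if "module_matrix_norm ip n y \<le> 1" for n y
  proof -
    have "ereal (operator_matrix_norm n (\<lambda>i j. \<Phi> (y i j))) \<le> amplification_norm ip \<Phi> n"
      unfolding amplification_norm_def using that by (intro SUP_upper2[of y]) auto
    also have "\<dots> \<le> s"
      unfolding s_def by (rule SUP_upper) simp
    finally show ?thesis
      using c order.trans by fastforce
  qed
  have "(\<Sum>i<n. (norm (\<Sum>j<n. \<Phi> (y i j) (g j)))\<^sup>2) \<le> c\<^sup>2 * (\<Sum>j<n. (norm (g j))\<^sup>2)"
    if y: "module_matrix_norm ip n y \<le> 1" for n y and g :: "nat \<Rightarrow> 'h"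
  proof -
    define D where "D = (\<lambda>h. direct_sum_norm n (\<lambda>i. \<Sum>j<n. \<Phi> (y i j) (h j)))"
    \<comment> \<open>\<open>operator_matrix_norm\<close> is a supremum of reals, so it bounds a
      member only once the set is known to be bounded.\<close>
    have bdd: "bdd_above (D ` {h. direct_sum_norm n h \<le> 1})"
    proof (rule bdd_aboveI2)
      fix h :: "nat \<Rightarrow> 'h" assume "h \<in> {h. direct_sum_norm n h \<le> 1}"
      then have h: "(\<Sum>j<n. (norm (h j))\<^sup>2) \<le> 1"
        by (simp add: direct_sum_norm_def)
      have "norm (h j) \<le> 1" if "j < n" for j
      proof -
        have "(norm (h j))\<^sup>2 \<le> (\<Sum>j<n. (norm (h j))\<^sup>2)"
          using that by (intro member_le_sum) auto
        with h show ?thesis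
          using abs_square_le_1[of "norm (h j)"] by simp
      qed
      then have "norm (\<Sum>j<n. \<Phi> (y i j) (h j)) \<le> (\<Sum>j<n. C (y i j))" for i
        by (intro sum_norm_le order.trans[OF C(1)]) (simp add: C mult_left_le)
      then show "D h \<le> sqrt (\<Sum>i<n. (\<Sum>j<n. C (y i j))\<^sup>2)"
        unfolding D_def direct_sum_norm_def by (intro real_sqrt_le_mono sum_mono power_mono) auto
    qed
    define r where "r = direct_sum_norm n g"
    have r: "r\<^sup>2 = (\<Sum>j<n. (norm (g j))\<^sup>2)" "0 \<le> r"
      by (simp_all add: r_def direct_sum_norm_def sum_nonneg)
    show ?thesis
    proof (cases "r = 0")
      case True
      then have "g j = 0" if "j < n" for j
        using r(1) that by (simp add: sum_nonneg_eq_0_iff)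
      moreover have "\<Phi> x 0 = 0" for x
        using \<Phi>_scaleR[of x 0 0] by simp
      ultimately show ?thesis
        by simp
    next
      case False
      define h where "h j = (1 / r) *\<^sub>R g j" for j
      have "(\<Sum>j<n. (norm (h j))\<^sup>2) = 1"
        using False by (simp add: h_def power_divide flip: r(1) sum_divide_distrib)
      then have "direct_sum_norm n h \<le> 1"
        by (simp add: direct_sum_norm_def)
      then have "D h \<le> operator_matrix_norm n (\<lambda>i j. \<Phi> (y i j))"
        unfolding operator_matrix_norm_def using bdd unfolding D_def by (intro cSUP_upper) auto
      also have "\<dots> \<le> c"
        by (rule op_norm[OF y])
      finally have "D h \<le> c" .
      moreover have "0 \<le> D h"
        by (simp add: D_def direct_sum_norm_def sum_nonneg)
      ultimately have "(D h)\<^sup>2 \<le> c\<^sup>2"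
        by (intro power_mono)
      then have "(\<Sum>i<n. (norm (\<Sum>j<n. \<Phi> (y i j) (h j)))\<^sup>2) \<le> c\<^sup>2"
        by (simp add: D_def direct_sum_norm_def sum_nonneg)
      moreover have "(norm (\<Sum>j<n. \<Phi> (y i j) (h j)))\<^sup>2 = (norm (\<Sum>j<n. \<Phi> (y i j) (g j)))\<^sup>2 / r\<^sup>2" for i
        by (simp add: h_def \<Phi>_scaleR power_divide flip: scaleR_sum_right)
      ultimately have "(\<Sum>i<n. (norm (\<Sum>j<n. \<Phi> (y i j) (g j)))\<^sup>2) / r\<^sup>2 \<le> c\<^sup>2"
        by (simp flip: sum_divide_distrib)
      then show ?thesis
        using False by (simp add: pos_divide_le_eq flip: r(1))
    qed
  qed
  then have "cb_map act ip \<Phi> c"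
    using op lin by unfold_locales
      (auto simp: linear_into_operators_def bounded_operator_def type_hilbert_def)
  then show ?thesis
    by (rule that)
qed

context cb_map
begin

lemma \<Phi>_zero_left: "\<Phi> 0 h = 0"
  using \<Phi>_add_left[of 0 0 h] by simp

lemma \<Phi>_minus_left: "\<Phi> (- x) h = - \<Phi> x h"
  using \<Phi>_add_left[of x "- x" h] \<Phi>_zero_left[of h] by (simp add: eq_neg_iff_add_eq_0 add.commute)

lemma \<Phi>_zero_right: "\<Phi> x 0 = 0"
  using \<Phi>_add_right[of x 0 0] by simp

lemma \<Phi>_sum_left: "\<Phi> (\<Sum>i\<in>I. f i) h = (\<Sum>i\<in>I. \<Phi> (f i) h)"
  by (induction I rule: infinite_finite_induct) (simp_all add: \<Phi>_add_left \<Phi>_zero_left)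

lemma \<Phi>_sum_right: "\<Phi> x (\<Sum>i\<in>I. f i) = (\<Sum>i\<in>I. \<Phi> x (f i))"
  by (induction I rule: infinite_finite_induct) (simp_all add: \<Phi>_add_right \<Phi>_zero_right)

text \<open>\<Phi> is well defined on tensors: after expanding the second components in a frame, the
  coefficient of t_p is \<open>tensor_map X (f p)\<close>, which vanishes.\<close>

lemma tensor_apply_eq_0:
  assumes "\<And>u. tensor_map X u = 0"
  shows "tensor_apply \<Phi> X = 0"
proof -
  define K where "K = length X"
  define g where "g k = snd (X ! k)" for k
  define x where "x k = fst (X ! k)" for k
  show ?thesis
  proof (rule frame_exists[of K g])
    fix n :: nat and f t
    assume g: "\<And>k. k < K \<Longrightarrow> g k = (\<Sum>p<n. cinner (f p) (g k) *\<^sub>C t p)"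
    have "tensor_apply \<Phi> X = (\<Sum>k<K. \<Phi> (x k) (g k))"
      by (simp add: tensor_apply_def sum_list_map_nth K_def g_def x_def case_prod_unfold)
    also have "\<dots> = (\<Sum>k<K. \<Phi> (x k) (\<Sum>p<n. cinner (f p) (g k) *\<^sub>C t p))"
      by (intro sum.cong refl arg_cong[where f = "\<Phi> _"] g) simp
    also have "\<dots> = (\<Sum>p<n. \<Phi> (\<Sum>k<K. cinner (f p) (g k) *\<^sub>C x k) (t p))"
      by (simp add: \<Phi>_sum_left \<Phi>_sum_right \<Phi>_scaleC_left \<Phi>_scaleC_right) (rule sum.swap)
    also have "(\<lambda>p. \<Sum>k<K. cinner (f p) (g k) *\<^sub>C x k) = (\<lambda>p. tensor_map X (f p))"
      by (simp add: tensor_map_def sum_list_map_nth K_def g_def x_def case_prod_unfold)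
    finally show "tensor_apply \<Phi> X = 0"
      by (simp add: assms \<Phi>_zero_left)
  qed
qed

text \<open>X and its expansion along the t_p induce the same antilinear map, because
  \<open>tensor_map X\<close> sees only the part of u that the g_k see. Their difference is
  therefore the zero tensor.\<close>

lemma tensor_apply_frame:
  fixes n :: nat
  assumes g: "\<And>k. k < K \<Longrightarrow> g k = (\<Sum>p<n. cinner (f p) (g k) *\<^sub>C t p)"
    and null: "\<And>u. (\<And>k. k < K \<Longrightarrow> cinner (g k) u = 0) \<Longrightarrow> tensor_map X u = 0"
  shows "tensor_apply \<Phi> X = (\<Sum>p<n. \<Phi> (tensor_map X (f p)) (t p))"
proof -
  define Y where "Y = X @ map (\<lambda>p. (- tensor_map X (f p), t p)) [0..<n]"
  have "tensor_map Y u = 0" for u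
  proof -
    have "cinner (g k) (u - (\<Sum>p<n. cinner (t p) u *\<^sub>C f p)) = 0" if "k < K" for k
    proof -
      have "cinner (g k) u = cinner (\<Sum>p<n. cinner (f p) (g k) *\<^sub>C t p) u"
        using g[OF that] by simp
      also have "\<dots> = (\<Sum>p<n. cinner (t p) u * cinner (g k) (f p))"
        by (simp add: cinner_sum_left cinner_scaleC_left cinner_commute[symmetric] mult.commute)
      finally show ?thesis
        by (simp add: cinner_diff_right cinner_sum_right cinner_scaleC_right)
    qed
    then have "tensor_map X (u - (\<Sum>p<n. cinner (t p) u *\<^sub>C f p)) = 0"
      by (rule null)
    then have "tensor_map X u - (\<Sum>p<n. cinner u (t p) *\<^sub>C tensor_map X (f p)) = 0"
      by (simp add: tensor_map_diff tensor_map_sum tensor_map_scaleC cinner_commute[symmetric])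
    then show ?thesis
      by (simp add: Y_def tensor_map_map_upt sum_negf)
  qed
  then have "tensor_apply \<Phi> Y = 0"
    by (rule tensor_apply_eq_0)
  then show ?thesis
    by (simp add: Y_def tensor_apply_map_upt \<Phi>_minus_left sum_negf)
qed

lemma tensor_apply_bound:
  fixes gs :: "'h list" and Bs :: "('h \<Rightarrow> 'a) list" and Xs :: "('e \<times> 'h) list list"
  assumes gram: "\<And>u v. (\<Sum>B\<leftarrow>Bs. star (B u) * B v) + (\<Sum>X\<leftarrow>Xs. ip (tensor_map X u) (tensor_map X v))
      = (\<Sum>g\<leftarrow>gs. cinner v g * cinner g u) *\<^sub>C 1"
  shows "(\<Sum>X\<leftarrow>Xs. (norm (tensor_apply \<Phi> X))\<^sup>2) \<le> c\<^sup>2 * (\<Sum>g\<leftarrow>gs. (norm g)\<^sup>2)"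
proof -
  define K where "K = length gs"
  define g where "g = nth gs"
  define M where "M = length Xs"
  define L where "L = length Bs"
  \<comment> \<open>The arguments are exchanged in \<open>frame_form\<close> because
    \<open>tensor_map\<close> is antilinear: the Gram kernels are linear in u and antilinear in
    v.\<close>
  have gram': "(\<Sum>k<L. star ((Bs ! k) u) * (Bs ! k) v)
      + (\<Sum>m<M. ip (tensor_map (Xs ! m) u) (tensor_map (Xs ! m) v)) = frame_form K g v u *\<^sub>C 1" for u v
    using gram[of u v] by (simp add: sum_list_map_nth K_def g_def M_def L_def frame_form_def)
  show ?thesis
  proof (rule frame_exists[of K g])
    fix n :: nat and f t
    assume on: "\<And>p q. p < n \<Longrightarrow> q < n \<Longrightarrow> frame_form K g (f p) (f q) = (if p = q then 1 else 0)"
      and g: "\<And>k. k < K \<Longrightarrow> g k = (\<Sum>p<n. cinner (f p) (g k) *\<^sub>C t p)"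
      and t: "(\<Sum>p<n. (norm (t p))\<^sup>2) = (\<Sum>k<K. (norm (g k))\<^sup>2)"
    \<comment> \<open>At a vector orthogonal to all g_k the positive terms on the left have sum 0,
      so each of them is 0.\<close>
    have null: "tensor_map (Xs ! m) u = 0" if "m < M" "\<And>k. k < K \<Longrightarrow> cinner (g k) u = 0" for m u
    proof -
      let ?i = "\<lambda>m. ip (tensor_map (Xs ! m) u) (tensor_map (Xs ! m) u)"
      have "(\<Sum>k<L. star ((Bs ! k) u) * (Bs ! k) u) + (\<Sum>m<M. ?i m) = 0"
        unfolding gram' using that(2) by (simp add: frame_form_def)
      moreover have "(\<Sum>m<M. ?i m) = ?i m + (\<Sum>m\<in>{..<M} - {m}. ?i m)"
        using that(1) by (intro sum.remove) auto
      ultimately have "?i m + ((\<Sum>m\<in>{..<M} - {m}. ?i m) + (\<Sum>k<L. star ((Bs ! k) u) * (Bs ! k) u)) = 0"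
        by (simp add: ac_simps)
      then have "?i m = 0"
        by (rule cpos_add_eq_0[rotated 2]) (intro cpos_ip cpos_add cpos_sum cpos_star_mult)+
      then show ?thesis
        by (rule ip_definite)
    qed
    define N where "N = max M n"
    define y where "y m p = tensor_map (Xs ! m) (f p)" for m p
    define z where "z m p = (if m < M \<and> p < n then y m p else 0)" for m p
    define t' where "t' p = (if p < n then t p else 0)" for p
    have "module_matrix_norm ip N (\<lambda>m p. if m < M \<and> p < n then y m p else 0) \<le> 1"
    proof (rule module_matrix_norm_le_one[where K = "{..<L}" and b = "\<lambda>k p. (Bs ! k) (f p)"])
      fix p q assume "p < n" "q < n"
      then show "(\<Sum>k<L. star ((Bs ! k) (f p)) * (Bs ! k) (f q)) + (\<Sum>m<M. ip (y m p) (y m q)) = (if p = q then 1 else 0)"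
        unfolding y_def gram' by (simp add: on scaleC_one)
    qed (auto simp: N_def)
    then have "module_matrix_norm ip N z \<le> 1"
      by (simp add: z_def[abs_def])
    then have bound: "(\<Sum>i<N. (norm (\<Sum>j<N. \<Phi> (z i j) (t' j)))\<^sup>2) \<le> c\<^sup>2 * (\<Sum>j<N. (norm (t' j))\<^sup>2)"
      by (rule matrix_bound)
    have row: "(\<Sum>j<N. \<Phi> (z m j) (t' j)) = tensor_apply \<Phi> (Xs ! m)" if "m < M" for m
    proof -
      have "(\<Sum>j<N. \<Phi> (z m j) (t' j)) = (\<Sum>j<n. \<Phi> (z m j) (t' j))"
        by (rule sum.mono_neutral_right) (auto simp: N_def t'_def \<Phi>_zero_right)
      also have "\<dots> = (\<Sum>p<n. \<Phi> (tensor_map (Xs ! m) (f p)) (t p))"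
        by (rule sum.cong) (auto simp: z_def y_def t'_def that)
      also have "\<dots> = tensor_apply \<Phi> (Xs ! m)"
        by (rule tensor_apply_frame[OF g null[OF that], symmetric])
      finally show ?thesis .
    qed
    have "(\<Sum>X\<leftarrow>Xs. (norm (tensor_apply \<Phi> X))\<^sup>2) = (\<Sum>m<M. (norm (\<Sum>j<N. \<Phi> (z m j) (t' j)))\<^sup>2)"
      by (simp add: sum_list_map_nth row flip: M_def)
    also have "\<dots> \<le> (\<Sum>m<N. (norm (\<Sum>j<N. \<Phi> (z m j) (t' j)))\<^sup>2)"
      by (rule sum_mono2) (auto simp: N_def)
    also note bound
    also have "(\<Sum>j<N. (norm (t' j))\<^sup>2) = (\<Sum>j<n. (norm (t' j))\<^sup>2)"
      by (rule sum.mono_neutral_right) (auto simp: N_def t'_def)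
    also have "\<dots> = (\<Sum>g\<leftarrow>gs. (norm g)\<^sup>2)"
      using t by (simp add: t'_def sum_list_map_nth K_def g_def)
    finally show "(\<Sum>X\<leftarrow>Xs. (norm (tensor_apply \<Phi> X))\<^sup>2) \<le> c\<^sup>2 * (\<Sum>g\<leftarrow>gs. (norm g)\<^sup>2)" .
  qed
qed

end

section \<open>Construction of the completely positive map\<close>

text \<open>Makes the kernels, which are functions, a real vector space for the Hahn-Banach
  argument.\<close>

instantiation "fun" :: (type, real_vector) real_vector
begin

definition "scaleR r f = (\<lambda>x. r *\<^sub>R f x)"

instance
  by intro_classes (simp_all add: scaleR_fun_def fun_eq_iff scaleR_add_right scaleR_add_left)

end

lemma scaleR_fun_apply [simp]: "(r *\<^sub>R f) x = r *\<^sub>R f x"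
  by (simp add: scaleR_fun_def)

lemma tensor_map_scaleR_left:
  fixes X :: "('e::complex_normed_vector \<times> 'h::chilbert_space) list"
  shows "tensor_map (map (\<lambda>(x, h). (r *\<^sub>R x, h)) X) u = r *\<^sub>R tensor_map X u"
  by (induction X) (auto simp: scaleR_add_right)

context cb_map
begin

lemma tensor_apply_scaleR_left:
  "tensor_apply \<Phi> (map (\<lambda>(x, h). (r *\<^sub>R x, h)) X) = r *\<^sub>R tensor_apply \<Phi> X"
  by (induction X) (auto simp: scaleR_add_right scaleR_scaleC \<Phi>_scaleC_left scaleC_add_right)

text \<open>
  The element \<open>\<Sum> a\<^sub>i \<otimes> h\<^sub>i\<^sup>* \<otimes> k\<^sub>i\<close> is represented by the kernel
  \<open>(u, w) \<mapsto> \<Sum> \<langle>h\<^sub>i, u\<rangle>\<langle>w, k\<^sub>i\<rangle> a\<^sub>i\<close>. The relation \<open>dominated v r\<close> says that \<open>r\<close> is an upper bound for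
  \<open>\<Sum> Re \<langle>h\<^sub>i, \<phi>(a\<^sub>i) k\<^sub>i\<rangle>\<close> that is forced by the three requirements on \<open>\<phi>\<close>: positivity (the
  \<open>Bs\<close>), domination of \<open>\<Phi>\<close> (the \<open>Xs\<close>) and \<open>\<phi>(1) \<le> c\<^sup>2\<close> (the \<open>gs\<close>).
\<close>

definition dominated :: "('h \<Rightarrow> 'h \<Rightarrow> 'a) \<Rightarrow> real \<Rightarrow> bool"
  where "dominated v r \<longleftrightarrow> (\<exists>gs Bs Xs.
    (\<forall>u w. (1/2) *\<^sub>R (v u w + star (v w u)) + (\<Sum>B\<leftarrow>Bs. star (B u) * B w)
        + (\<Sum>X\<leftarrow>Xs. ip (tensor_map X u) (tensor_map X w)) = (\<Sum>g\<leftarrow>gs. cinner w g * cinner g u) *\<^sub>C 1) \<and>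
    r = c\<^sup>2 * (\<Sum>g\<leftarrow>gs. (norm g)\<^sup>2) - (\<Sum>X\<leftarrow>Xs. (norm (tensor_apply \<Phi> X))\<^sup>2))"

lemma dominatedI:
  assumes "\<And>u w. (1/2) *\<^sub>R (v u w + star (v w u)) + (\<Sum>B\<leftarrow>Bs. star (B u) * B w)
        + (\<Sum>X\<leftarrow>Xs. ip (tensor_map X u) (tensor_map X w)) = (\<Sum>g\<leftarrow>gs. cinner w g * cinner g u) *\<^sub>C 1"
    and "r = c\<^sup>2 * (\<Sum>g\<leftarrow>gs. (norm g)\<^sup>2) - (\<Sum>X\<leftarrow>Xs. (norm (tensor_apply \<Phi> X))\<^sup>2)"
  shows "dominated v r"
  using assms unfolding dominated_def by blast

lemma dominatedE:
  assumes "dominated v r"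
  obtains gs Bs Xs where
    "\<And>u w. (1/2) *\<^sub>R (v u w + star (v w u)) + (\<Sum>B\<leftarrow>Bs. star (B u) * B w)
        + (\<Sum>X\<leftarrow>Xs. ip (tensor_map X u) (tensor_map X w)) = (\<Sum>g\<leftarrow>gs. cinner w g * cinner g u) *\<^sub>C 1"
    "r = c\<^sup>2 * (\<Sum>g\<leftarrow>gs. (norm g)\<^sup>2) - (\<Sum>X\<leftarrow>Xs. (norm (tensor_apply \<Phi> X))\<^sup>2)"
  using assms unfolding dominated_def by blast

lemma dominated_add:
  assumes "dominated v r" "dominated v' r'"
  shows "dominated (v + v') (r + r')"
proof (rule dominatedE[OF assms(1)], rule dominatedE[OF assms(2)], goal_cases)
  case prems: (1 gs Bs Xs gs' Bs' Xs')
  show ?case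
  proof (rule dominatedI[where gs = "gs @ gs'" and Bs = "Bs @ Bs'" and Xs = "Xs @ Xs'"], goal_cases)
    case (1 u w)
    show ?case
      using arg_cong2[OF prems(1)[of u w] prems(3)[of u w], of "(+)"]
      by (simp add: scaleC_add_left star_add scaleR_add_right ac_simps)
  qed (simp add: prems(2,4) algebra_simps)
qed

lemma dominated_scaleR:
  assumes "dominated v r" "0 \<le> t"
  shows "dominated (t *\<^sub>R v) (t * r)"
proof (rule dominatedE[OF assms(1)], goal_cases)
  case prems: (1 gs Bs Xs)
  \<comment> \<open>The data enter quadratically, so a factor t amounts to scaling each of them by
    its square root.\<close>
  define s where "s = sqrt t"
  have s: "s * s = t" "s\<^sup>2 = t"
    using assms(2) by (simp_all add: s_def)
  have ip_s: "ip (s *\<^sub>R x) (s *\<^sub>R y) = t *\<^sub>R ip x y" for x y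
    by (simp add: scaleR_scaleC ip_scaleC_left ip_scaleC_right scaleC_scaleC flip: s(1))
  have cs: "cinner w (s *\<^sub>R g) * cinner (s *\<^sub>R g) u = of_real t * (cinner w g * cinner g u)" for u w g :: 'h
    by (simp add: cinner_scaleR_left cinner_scaleR_right flip: s(1))
  show ?case
  proof (rule dominatedI[where gs = "map ((*\<^sub>R) s) gs" and Bs = "map (\<lambda>B u. s *\<^sub>R B u) Bs"
        and Xs = "map (map (\<lambda>(x, h). (s *\<^sub>R x, h))) Xs"], goal_cases)
    case (1 u w)
    have "(\<Sum>g\<leftarrow>map ((*\<^sub>R) s) gs. cinner w g * cinner g u) = of_real t * (\<Sum>g\<leftarrow>gs. cinner w g * cinner g u)"
      by (simp add: o_def cs sum_list_const_mult)
    then have rhs: "(\<Sum>g\<leftarrow>map ((*\<^sub>R) s) gs. cinner w g * cinner g u) *\<^sub>C 1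
        = t *\<^sub>R ((\<Sum>g\<leftarrow>gs. cinner w g * cinner g u) *\<^sub>C (1::'a))"
      by (simp add: scaleR_scaleC scaleC_scaleC)
    show ?case
      unfolding rhs prems(1)[symmetric]
      by (simp add: o_def star_scaleR scaleR_add_right tensor_map_scaleR_left ip_s s sum_list_scaleR_right
          mult.commute)
  next
    case 2
    have "(norm (tensor_apply \<Phi> (map (\<lambda>(x, h). (s *\<^sub>R x, h)) X)))\<^sup>2 = t * (norm (tensor_apply \<Phi> X))\<^sup>2" for X
      by (simp add: tensor_apply_scaleR_left power_mult_distrib s)
    then show ?case
      by (simp add: prems(2) o_def power_mult_distrib s sum_list_const_mult algebra_simps)
  qed
qed

text \<open>Here complete boundedness enters the construction of \<phi>: for v = 0 the identity of
  kernels is the hypothesis of \<open>tensor_apply_bound\<close>. It keeps the sublinear functional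
  finite from below.\<close>

lemma dominated_zero_nonneg:
  assumes "dominated 0 r"
  shows "0 \<le> r"
proof (rule dominatedE[OF assms], goal_cases)
  case (1 gs Bs Xs)
  then have "(\<Sum>X\<leftarrow>Xs. (norm (tensor_apply \<Phi> X))\<^sup>2) \<le> c\<^sup>2 * (\<Sum>g\<leftarrow>gs. (norm g)\<^sup>2)"
    by (intro tensor_apply_bound[of Bs]) simp
  with 1(2) show ?case
    by simp
qed

lemma dominated_lower_bound: "dominated v r \<Longrightarrow> dominated (- v) r' \<Longrightarrow> - r' \<le> r"
  using dominated_zero_nonneg[of "r + r'"] dominated_add[of v r "- v" r'] by simp

text \<open>\<open>dominated\<close> sees only the Hermitian part of a kernel. Applied to v and - v,
  this forces the functional to vanish on skew kernels, which gives \<phi> its adjoint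
  relation.\<close>

lemma dominated_skew:
  assumes "\<And>u w. v u w + star (v w u) = 0"
  shows "dominated v 0"
  by (rule dominatedI[where gs = "[]" and Bs = "[]" and Xs = "[]"]) (simp_all add: assms)

text \<open>An upper bound 0 for - v makes the functional nonnegative at v: the source of positivity
  of \<phi>.\<close>

lemma dominated_uminus_square:
  fixes B :: "nat \<Rightarrow> 'h \<Rightarrow> 'a"
  assumes "\<And>u w. v u w = (\<Sum>k<n. star (B k u) * B k w)"
  shows "dominated (- v) 0"
proof (rule dominatedI[where gs = "[]" and Bs = "map B [0..<n]" and Xs = "[]"], goal_cases)
  case (1 u w)
  have "star (v w u) = v u w"
    by (simp add: assms star_sum star_mult star_star)
  moreover have "(\<Sum>B\<leftarrow>map B [0..<n]. star (B u) * B w) = v u w"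
    by (simp add: assms sum_list_map_nth)
  ultimately show ?case
    by (simp flip: scaleR_minus_right scaleR_2)
qed simp

text \<open>An upper bound for - v is a lower bound for v, here the one by which \<phi> dominates
  \<Phi>.\<close>

lemma dominated_uminus_gram:
  assumes "\<And>u w. v u w = ip (tensor_map X u) (tensor_map X w)"
  shows "dominated (- v) (- (norm (tensor_apply \<Phi> X))\<^sup>2)"
proof (rule dominatedI[where gs = "[]" and Bs = "[]" and Xs = "[X]"], goal_cases)
  case (1 u w)
  have "star (v w u) = v u w"
    by (simp add: assms flip: ip_star)
  then show ?case
    by (simp add: assms flip: scaleR_minus_right scaleR_2)
qed simp

section \<open>Elementary kernels and their bounds\<close>

definition elementary :: "'h \<Rightarrow> 'a \<Rightarrow> 'h \<Rightarrow> 'h \<Rightarrow> 'h \<Rightarrow> 'a"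
  where "elementary h a k = (\<lambda>u w. (cinner h u * cinner w k) *\<^sub>C a)"

lemma star_elementary: "star (elementary h a k w u) = elementary k (star a) h u w"
  by (simp add: elementary_def star_scaleC cinner_commute[symmetric] mult.commute)

lemma elementary_linear:
  "elementary (h + h') a k = elementary h a k + elementary h' a k"
  "elementary h (a + b) k = elementary h a k + elementary h b k"
  "elementary h a (k + k') = elementary h a k + elementary h a k'"
  "elementary (r *\<^sub>R h) a k = r *\<^sub>R elementary h a k"
  "elementary h a (r *\<^sub>R k) = r *\<^sub>R elementary h a k"
  "elementary h (- a) k = - elementary h a k"
  by (simp_all add: fun_eq_iff elementary_def cinner_add_left cinner_add_right cinner_scaleR_left
      cinner_scaleR_right scaleC_add_left scaleC_add_right algebra_simps scaleR_scaleC scaleC_scaleC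
      cinner_scaleC_left cinner_scaleC_right)

text \<open>Scalars move to h as conjugates. This is how a real functional yields complex linearity
  of \<phi> in a and in k.\<close>

lemma elementary_scaleC:
  "elementary h (d *\<^sub>C a) k = elementary (cnj d *\<^sub>C h) a k"
  "elementary h a (d *\<^sub>C k) = elementary (cnj d *\<^sub>C h) a k"
  by (simp_all add: fun_eq_iff elementary_def cinner_scaleC_left cinner_scaleC_right scaleC_scaleC
      algebra_simps)

text \<open>Expand \<open>(h - ka)\<^sup>*(h - ka) \<ge> 0\<close> and use \<open>a\<^sup>*a \<le> \<parallel>a\<parallel>\<^sup>2\<close>.\<close>

lemma dominated_elementary: "dominated (elementary h a k) (c\<^sup>2 / 2 * ((norm h)\<^sup>2 + (norm a)\<^sup>2 * (norm k)\<^sup>2))"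
proof -
  define t where "t = norm a"
  have "cpos (t\<^sup>2 *\<^sub>R 1 - star a * a)"
    by (rule cpos_scalar_minus) (simp_all add: star_mult star_star cstar_identity t_def)
  then obtain d where d: "star d = d" "d * d = t\<^sup>2 *\<^sub>R 1 - star a * a"
    by (auto simp: cpos_def)
  \<comment> \<open>s^2 = 1/2 matches the symmetrisation in \<open>dominated\<close>.\<close>
  define s where "s = 1 / sqrt 2"
  have s: "s * s = 1/2" "s\<^sup>2 = 1/2"
    by (simp_all add: s_def power_divide)
  define B1 where "B1 u = s *\<^sub>R (cinner u h *\<^sub>C 1 - cinner u k *\<^sub>C a)" for u
  \<comment> \<open>Fills the gap between \<open>star a * a\<close> and (norm a)^2.\<close>
  define B2 where "B2 u = s *\<^sub>R (cinner u k *\<^sub>C d)" for u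
  show ?thesis
  proof (rule dominatedI[where gs = "[s *\<^sub>R h, (s * t) *\<^sub>R k]" and Bs = "[B1, B2]" and Xs = "[]"], goal_cases)
    case (1 u w)
    have B1: "star (B1 u) * B1 w = (1/2) *\<^sub>R ((cinner h u * cinner w h) *\<^sub>C 1 - elementary h a k u w
        - elementary k (star a) h u w + (cinner k u * cinner w k) *\<^sub>C (star a * a))"
      by (simp add: B1_def elementary_def star_scaleR star_diff star_scaleC cinner_commute[symmetric] s
          scaleC_mult_left scaleC_mult_right scaleC_scaleC scaleC_diff_right algebra_simps)
    have B2: "star (B2 u) * B2 w = (1/2) *\<^sub>R ((cinner k u * cinner w k) *\<^sub>C (t\<^sup>2 *\<^sub>R 1 - star a * a))"
      by (simp add: B2_def star_scaleR star_scaleC cinner_commute[symmetric] s d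
          scaleC_mult_left scaleC_mult_right scaleC_scaleC mult.commute)
    have 3: "(cinner w (s *\<^sub>R h) * cinner (s *\<^sub>R h) u + cinner w ((s * t) *\<^sub>R k) * cinner ((s * t) *\<^sub>R k) u) *\<^sub>C (1::'a)
        = (1/2) *\<^sub>R ((cinner h u * cinner w h) *\<^sub>C 1 + (cinner k u * cinner w k) *\<^sub>C (t\<^sup>2 *\<^sub>R 1))"
    proof -
      have "cinner w (s *\<^sub>R h) * cinner (s *\<^sub>R h) u = of_real (s * s) * (cinner h u * cinner w h)"
        by (simp add: cinner_scaleR_left cinner_scaleR_right)
      moreover have "cinner w ((s * t) *\<^sub>R k) * cinner ((s * t) *\<^sub>R k) u
          = of_real (s * s) * (cinner k u * cinner w k * of_real (t\<^sup>2))"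
        by (simp add: cinner_scaleR_left cinner_scaleR_right power2_eq_square)
      ultimately show ?thesis
        unfolding s by (simp only: scaleR_scaleC scaleC_add_left scaleC_add_right scaleC_scaleC)
    qed
    show ?case
      using 3 unfolding star_elementary
      by (simp add: B1 B2 scaleC_diff_right scaleC_add_right algebra_simps del: scaleC_scaleR)
  qed (simp add: t_def power_mult_distrib s algebra_simps)
qed

text \<open>The domain on which the infimum of all bounds is finite: a bound for v makes the set
  nonempty, one for - v bounds it from below.\<close>

definition kernels :: "('h \<Rightarrow> 'h \<Rightarrow> 'a) set"
  where "kernels = {v. (\<exists>r. dominated v r) \<and> (\<exists>r. dominated (- v) r)}"

lemma elementary_kernels: "elementary h a k \<in> kernels"
  using dominated_elementary[of h a k] dominated_elementary[of h "- a" k]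
  by (auto simp: kernels_def elementary_linear)

lemma subspace_kernels: "subspace kernels"
proof (rule subspaceI)
  show "0 \<in> kernels"
    using dominated_skew[of 0] by (auto simp: kernels_def)
  show "x + y \<in> kernels" if "x \<in> kernels" "y \<in> kernels" for x y
    using that dominated_add[of x _ y] dominated_add[of "- x" _ "- y"] by (force simp: kernels_def)
  show "r *\<^sub>R x \<in> kernels" if "x \<in> kernels" for r x
  proof (cases "0 \<le> r")
    case True
    then show ?thesis
      using that dominated_scaleR[of x _ r] dominated_scaleR[of "- x" _ r] by (force simp: kernels_def)
  next
    case False
    then show ?thesis
      using that dominated_scaleR[of x _ "- r"] dominated_scaleR[of "- x" _ "- r"] by (force simp: kernels_def)
  qed
qed

lemma dominated_functional_exists:
  obtains F where "\<And>x y. x \<in> kernels \<Longrightarrow> y \<in> kernels \<Longrightarrow> F (x + y) = F x + F y"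
    "\<And>r x. x \<in> kernels \<Longrightarrow> F (r *\<^sub>R x) = r * F x"
    "\<And>v r. v \<in> kernels \<Longrightarrow> dominated v r \<Longrightarrow> F v \<le> r"
proof -
  define p where "p v = Inf {r. dominated v r}" for v
  have bdd: "bdd_below {r. dominated v r}" if v: "v \<in> kernels" for v
  proof -
    obtain r' where "dominated (- v) r'"
      using v by (auto simp: kernels_def)
    then show ?thesis
      using dominated_lower_bound by (intro bdd_belowI[of _ "- r'"]) auto
  qed
  have p_le: "p v \<le> r" if "v \<in> kernels" "dominated v r" for v r
    unfolding p_def using that bdd by (intro cInf_lower) auto
  have p_ge: "z \<le> p v" if "v \<in> kernels" "\<And>r. dominated v r \<Longrightarrow> z \<le> r" for v z
    unfolding p_def using that by (intro cInf_greatest) (auto simp: kernels_def)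
  have "sublinear_on kernels p"
    unfolding sublinear_on_def
  proof (intro conjI ballI allI impI)
    fix x y assume xy: "x \<in> kernels" "y \<in> kernels"
    have le: "p (x + y) \<le> r + r'" if "dominated x r" "dominated y r'" for r r'
      using xy that by (intro p_le dominated_add subspace_add[OF subspace_kernels])
    have "p (x + y) - r' \<le> p x" if "dominated y r'" for r'
      using le[OF _ that] xy by (intro p_ge) (auto simp: diff_le_eq)
    then have "p (x + y) - p x \<le> p y"
      using xy by (intro p_ge) (smt (verit))+
    then show "p (x + y) \<le> p x + p y"
      by simp
  next
    fix x and t :: real assume x: "x \<in> kernels" and t: "0 \<le> t"
    have le: "p (t *\<^sub>R x) \<le> t * r" if "dominated x r" for r
      using x t that by (intro p_le dominated_scaleR subspace_scale[OF subspace_kernels])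
    show "p (t *\<^sub>R x) \<le> t * p x"
    proof (cases "t = 0")
      case True
      then show ?thesis
        using le x by (auto simp: kernels_def)
    next
      case False
      have "p (t *\<^sub>R x) / t \<le> p x"
        using le False t x by (intro p_ge) (auto simp: field_simps)
      with False t show ?thesis
        by (simp add: field_simps)
    qed
  qed
  from sublinear_dominates_linear[OF subspace_kernels this] obtain F where F:
    "\<And>x y. x \<in> kernels \<Longrightarrow> y \<in> kernels \<Longrightarrow> F (x + y) = F x + F y"
    "\<And>r x. x \<in> kernels \<Longrightarrow> F (r *\<^sub>R x) = r * F x" "\<And>x. x \<in> kernels \<Longrightarrow> F x \<le> p x"
    by blast
  show ?thesis
  proof (rule that[of F, OF F(1,2)])
    show "F v \<le> r" if "v \<in> kernels" "dominated v r" for v r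
      using F(3)[OF that(1)] p_le[OF that] by simp
  qed
qed

end

lemma Re_eq_imp_eq:
  assumes "\<And>k. Re (f k) = Re (g k)"
    and "\<And>k. f (\<i> *\<^sub>C k) = \<i> * f k" "\<And>k. g (\<i> *\<^sub>C k) = \<i> * g k"
  shows "f k = g k"
  using assms(1)[of k] assms(1)[of "\<i> *\<^sub>C k"] by (simp add: assms(2,3) complex_eq_iff)

text \<open>The functional prescribes Re <h, \<phi>(a) k> on elementary kernels, and Riesz in the
  variable h yields \<phi>(a) k.\<close>

lemma (in cb_map) phi_exists:
  obtains \<phi> :: "'a \<Rightarrow> 'h \<Rightarrow> 'h" where "completely_positive \<phi>"
    "\<And>a h k. cinner h (\<phi> a k) = cinner (\<phi> (star a) h) k"
    "\<And>X. (norm (tensor_apply \<Phi> X))\<^sup>2 \<le> Re (\<Sum>(x, h)\<leftarrow>X. \<Sum>(y, k)\<leftarrow>X. cinner h (\<phi> (ip x y) k))"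
proof (rule dominated_functional_exists)
  fix F :: "('h \<Rightarrow> 'h \<Rightarrow> 'a) \<Rightarrow> real"
  assume F_add: "\<And>x y. x \<in> kernels \<Longrightarrow> y \<in> kernels \<Longrightarrow> F (x + y) = F x + F y"
    and F_scaleR: "\<And>r x. x \<in> kernels \<Longrightarrow> F (r *\<^sub>R x) = r * F x"
    and F_le: "\<And>v r. v \<in> kernels \<Longrightarrow> dominated v r \<Longrightarrow> F v \<le> r"
  note V = subspace_add[OF subspace_kernels] subspace_scale[OF subspace_kernels]
    subspace_neg[OF subspace_kernels] subspace_0[OF subspace_kernels] elementary_kernels
  have F_minus: "F (- x) = - F x" if "x \<in> kernels" for x
    using F_scaleR[OF that, of "- 1"] by simp
  have F_zero: "F 0 = 0"
    using F_add[of 0 0] V by simp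
  have F_sum_list: "F (\<Sum>x\<leftarrow>xs. f x) = (\<Sum>x\<leftarrow>xs. F (f x)) \<and> (\<Sum>x\<leftarrow>xs. f x) \<in> kernels"
    if "\<And>x. f x \<in> kernels" for xs :: "'x list" and f
    by (induction xs) (simp_all only: list.map sum_list.Nil sum_list.Cons F_zero F_add V that)
  have F_skew: "F v = 0" if v: "v \<in> kernels" and skew: "\<And>u w. v u w + star (v w u) = 0" for v
  proof -
    have "(- v) u w + star ((- v) w u) = - (v u w + star (v w u))" for u w
      by simp
    then have "F (- v) \<le> 0"
      by (intro F_le V v dominated_skew) (simp only: skew neg_equal_zero minus_zero)
    moreover have "F v \<le> 0"
      by (intro F_le v dominated_skew skew)
    ultimately show ?thesis
      using F_minus[OF v] by simp
  qed
  define E where "E h a k = F (elementary h a k)" for h a k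
  have E_linear: "E (h + h') a k = E h a k + E h' a k" "E h (a + b) k = E h a k + E h b k"
    "E h a (k + k') = E h a k + E h a k'" "E (r *\<^sub>R h) a k = r * E h a k" "E h a (r *\<^sub>R k) = r * E h a k"
    for h h' a b k k' r
    by (simp_all add: E_def elementary_linear F_add F_scaleR V)
  have E_scaleC: "E h (d *\<^sub>C a) k = E (cnj d *\<^sub>C h) a k" "E h a (d *\<^sub>C k) = E (cnj d *\<^sub>C h) a k" for h a k d
    by (simp_all add: E_def elementary_scaleC)
  \<comment> \<open>\<open>dominated_elementary\<close> at unit vectors. That bound is not
    homogeneous in h and k, so it is used for unit vectors and then rescaled.\<close>
  define M where "M a = c\<^sup>2 / 2 * (1 + (norm a)\<^sup>2)" for a :: 'a
  have M_nonneg: "0 \<le> M a" for a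
    by (simp add: M_def)
  have E_unit: "\<bar>E h a k\<bar> \<le> M a" if "norm h = 1" "norm k = 1" for h a k
  proof -
    have "E h b k \<le> M b" for b
      unfolding E_def M_def using dominated_elementary[of h b k] that by (intro F_le V) simp
    from this[of a] this[of "- a"] show ?thesis
      by (simp add: E_def elementary_linear F_minus V M_def)
  qed
  have E_bound: "\<bar>E h a k\<bar> \<le> M a * norm h * norm k" for h a k
  proof (cases "h = 0 \<or> k = 0")
    case True
    then show ?thesis
      using E_linear(4)[of 0 h a k] E_linear(5)[of h a 0 k] by auto
  next
    case False
    define h' where "h' = (1 / norm h) *\<^sub>R h"
    define k' where "k' = (1 / norm k) *\<^sub>R k"
    have "h = norm h *\<^sub>R h'" "k = norm k *\<^sub>R k'"
      using False by (simp_all add: h'_def k'_def)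
    then have "E h a k = norm h * norm k * E h' a k'"
      by (metis E_linear(4,5) mult.assoc)
    moreover have "\<bar>E h' a k'\<bar> \<le> M a"
      using False by (intro E_unit) (simp_all add: h'_def k'_def)
    ultimately show ?thesis
      by (simp add: abs_mult mult_left_mono mult.commute[of "M a"] mult.assoc)
  qed
  have "\<exists>z. \<forall>h. E h a k = Re (cinner h z)" for a k
  proof -
    have "bounded_linear (\<lambda>h. E h a k)"
      by (rule bounded_linear_intro[where K = "M a * norm k"])
        (use E_bound[of _ a k] in \<open>simp_all add: E_linear mult_ac\<close>)
    then show ?thesis
      by (rule riesz_representation) (auto simp: inner_eq_Re_cinner)
  qed
  then obtain \<phi> where \<phi>: "\<And>h a k. Re (cinner h (\<phi> a k)) = E h a k"
    by metis
  have \<phi>_add: "\<phi> (a + b) k = \<phi> a k + \<phi> b k" for a b k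
    by (rule Re_cinner_eqI) (simp add: \<phi> cinner_add_right E_linear)
  have \<phi>_add_right: "\<phi> a (k + k') = \<phi> a k + \<phi> a k'" for a k k'
    by (rule Re_cinner_eqI) (simp add: \<phi> cinner_add_right E_linear)
  have shift: "cinner h (d *\<^sub>C z) = cinner (cnj d *\<^sub>C h) z" for h d and z :: 'h
    by (simp add: cinner_scaleC_left cinner_scaleC_right)
  have \<phi>_scaleC: "\<phi> (d *\<^sub>C a) k = d *\<^sub>C \<phi> a k" for d a k
    by (rule Re_cinner_eqI) (simp only: \<phi> shift E_scaleC)
  have \<phi>_scaleC_right: "\<phi> a (d *\<^sub>C k) = d *\<^sub>C \<phi> a k" for d a k
    by (rule Re_cinner_eqI) (simp only: \<phi> shift E_scaleC)
  have \<phi>_norm: "norm (\<phi> a k) \<le> M a * norm k" for a k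
  proof -
    have "(norm (\<phi> a k))\<^sup>2 \<le> M a * norm (\<phi> a k) * norm k"
      using E_bound[of "\<phi> a k" a k] by (simp add: Re_cinner_self flip: \<phi>)
    then have "norm (\<phi> a k) * norm (\<phi> a k) \<le> norm (\<phi> a k) * (M a * norm k)"
      by (simp add: power2_eq_square mult_ac)
    then show ?thesis
      using M_nonneg[of a] by (cases "norm (\<phi> a k) = 0") simp_all
  qed
  have E_star: "E h a k = E k (star a) h" for h a k
  proof -
    \<comment> \<open>The difference of the two elementary kernels is skew.\<close>
    have "F (elementary h a k + - elementary k (star a) h) = 0"
      by (intro F_skew V) (simp add: star_diff star_elementary star_star)
    then show ?thesis
      by (simp add: E_def F_add F_minus V del: add_uminus_conv_diff)
  qed
  have adjoint: "cinner h (\<phi> a k) = cinner (\<phi> (star a) h) k" for a h k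
  proof (rule Re_eq_imp_eq)
    fix k
    have "Re (cinner h (\<phi> a k)) = Re (cinner k (\<phi> (star a) h))"
      by (simp add: \<phi> E_star[of h])
    then show "Re (cinner h (\<phi> a k)) = Re (cinner (\<phi> (star a) h) k)"
      by (subst (2) cinner_commute) simp
  qed (simp_all add: \<phi>_scaleC_right cinner_scaleC_right)
  have domination: "(norm (tensor_apply \<Phi> X))\<^sup>2 \<le> Re (\<Sum>(x, h)\<leftarrow>X. \<Sum>(y, k)\<leftarrow>X. cinner h (\<phi> (ip x y) k))" for X
  proof -
    \<comment> \<open>The kernel whose value under F is the right-hand side; it is the Gram kernel
      of X.\<close>
    define v where "v = (\<Sum>p\<leftarrow>X. \<Sum>q\<leftarrow>X. elementary (snd p) (ip (fst p) (fst q)) (snd q))"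
    have in_V: "(\<Sum>q\<leftarrow>X. elementary (snd p) (ip (fst p) (fst q)) (snd q)) \<in> kernels" for p
      by (rule conjunct2[OF F_sum_list[OF elementary_kernels]])
    have v: "v \<in> kernels" "F v = (\<Sum>p\<leftarrow>X. \<Sum>q\<leftarrow>X. E (snd p) (ip (fst p) (fst q)) (snd q))"
      unfolding v_def E_def conjunct1[OF F_sum_list[OF in_V]] conjunct1[OF F_sum_list[OF elementary_kernels]]
      by (rule conjunct2[OF F_sum_list[OF in_V]]) (rule refl)
    have sum_list_apply: "(\<Sum>x\<leftarrow>xs. f x) u w = (\<Sum>x\<leftarrow>xs. f x u w)" for xs :: "('e \<times> 'h) list" and f :: "_ \<Rightarrow> 'h \<Rightarrow> 'h \<Rightarrow> 'a" and u w
      by (induction xs) simp_all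
    have "v u w = ip (tensor_map X u) (tensor_map X w)" for u w
    proof -
      have right: "ip y (\<Sum>q\<leftarrow>Y. f q) = (\<Sum>q\<leftarrow>Y. ip y (f q))" for y Y and f :: "'e \<times> 'h \<Rightarrow> 'e"
        by (induction Y) (simp_all add: ip_add_right)
      have left: "ip (\<Sum>q\<leftarrow>Y. f q) y = (\<Sum>q\<leftarrow>Y. ip (f q) y)" for y Y and f :: "'e \<times> 'h \<Rightarrow> 'e"
        by (induction Y) (simp_all add: ip_add_left)
      show ?thesis
        unfolding v_def sum_list_apply tensor_map_def case_prod_unfold left
        unfolding right
        by (simp add: elementary_def ip_scaleC_left ip_scaleC_right scaleC_scaleC cinner_commute[symmetric] mult.commute)
    qed
    then have "F (- v) \<le> - (norm (tensor_apply \<Phi> X))\<^sup>2"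
      by (intro F_le V dominated_uminus_gram v)
    moreover have "Re (\<Sum>(x, h)\<leftarrow>X. \<Sum>(y, k)\<leftarrow>X. cinner h (\<phi> (ip x y) k)) = F v"
    proof -
      have Re_sum_list: "Re (\<Sum>q\<leftarrow>Y. f q) = (\<Sum>q\<leftarrow>Y. Re (f q))" for Y and f :: "'e \<times> 'h \<Rightarrow> complex"
        by (induction Y) simp_all
      show ?thesis
        by (simp add: v case_prod_unfold Re_sum_list \<phi>)
    qed
    ultimately show ?thesis
      by (simp add: F_minus v(1))
  qed
  have "operator_matrix_positive n (\<lambda>i j. \<phi> (a i j))" if pos: "cstar_matrix_positive n a" for n a
    unfolding operator_matrix_positive_def
  proof (intro allI)
    fix h :: "nat \<Rightarrow> 'h"
    obtain b where b: "\<And>i j. i < n \<Longrightarrow> j < n \<Longrightarrow> a i j = (\<Sum>k<n. star (b k i) * b k j)"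
      using pos by (auto simp: cstar_matrix_positive_def)
    have star_a: "star (a i j) = a j i" if "i < n" "j < n" for i j
      by (simp add: b that star_sum star_mult star_star)
    define z where "z = (\<Sum>i<n. cinner (h i) (\<Sum>j<n. \<phi> (a i j) (h j)))"
    have z: "z = (\<Sum>i<n. \<Sum>j<n. cinner (h i) (\<phi> (a i j) (h j)))"
      by (simp add: z_def cinner_sum_right)
    \<comment> \<open>F controls only the real part of z; that z is real comes from the adjoint
      relation.\<close>
    have "cnj z = (\<Sum>i<n. \<Sum>j<n. cinner (\<phi> (a i j) (h j)) (h i))"
      by (simp add: z cinner_commute[symmetric])
    also have "\<dots> = (\<Sum>i<n. \<Sum>j<n. cinner (h j) (\<phi> (a j i) (h i)))"
    proof (intro sum.cong refl)
      fix i j assume "i \<in> {..<n}" "j \<in> {..<n}"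
      then show "cinner (\<phi> (a i j) (h j)) (h i) = cinner (h j) (\<phi> (a j i) (h i))"
        by (simp add: adjoint star_a)
    qed
    also have "\<dots> = z"
      unfolding z by (rule sum.swap)
    finally have "Im z = 0"
      by (simp add: complex_eq_iff)
    define v where "v = (\<Sum>i<n. \<Sum>j<n. elementary (h i) (a i j) (h j))"
    have F_sum: "F (\<Sum>i<m. f i) = (\<Sum>i<m. F (f i))" "(\<Sum>i<m. f i) \<in> kernels"
      if f: "\<And>i. f i \<in> kernels" for m :: nat and f
    proof -
      have mem: "(\<Sum>i<m. f i) \<in> kernels" for m :: nat
        using f by (rule subspace_sum[OF subspace_kernels])
      show "(\<Sum>i<m. f i) \<in> kernels"
        by (rule mem)
      show "F (\<Sum>i<m. f i) = (\<Sum>i<m. F (f i))"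
        by (induction m) (simp_all only: lessThan_0 sum.empty sum.lessThan_Suc F_zero F_add f mem)
    qed
    have v: "v \<in> kernels" "F v = Re z"
      unfolding v_def z by (simp_all only: F_sum V E_def \<phi> Re_sum)
    have sum_apply: "(\<Sum>x\<in>I. f x) u w = (\<Sum>x\<in>I. f x u w)" for I :: "nat set" and f :: "_ \<Rightarrow> 'h \<Rightarrow> 'h \<Rightarrow> 'a" and u w
      by (induction I rule: infinite_finite_induct) simp_all
    \<comment> \<open>The rows of the factor b contracted with the vectors h i; their Gram sum is
      v.\<close>
    define B where "B k u = (\<Sum>i<n. cinner u (h i) *\<^sub>C b k i)" for k u
    have "v u w = (\<Sum>k<n. star (B k u) * B k w)" for u w
    proof -
      have "v u w = (\<Sum>i<n. \<Sum>j<n. \<Sum>k<n. (cinner (h i) u * cinner w (h j)) *\<^sub>C (star (b k i) * b k j))"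
        by (simp add: v_def sum_apply elementary_def b scaleC_sum_right)
      also have "\<dots> = (\<Sum>i<n. \<Sum>k<n. \<Sum>j<n. (cinner (h i) u * cinner w (h j)) *\<^sub>C (star (b k i) * b k j))"
        by (intro sum.cong refl sum.swap)
      also have "\<dots> = (\<Sum>k<n. \<Sum>i<n. \<Sum>j<n. (cinner (h i) u * cinner w (h j)) *\<^sub>C (star (b k i) * b k j))"
        by (rule sum.swap)
      also have "\<dots> = (\<Sum>k<n. star (B k u) * B k w)"
        by (simp add: B_def star_sum star_scaleC cinner_commute[symmetric] sum_product scaleC_mult_left
            scaleC_mult_right scaleC_scaleC mult.commute[of "cinner (h _) u"])
      finally show ?thesis .
    qed
    then have "F (- v) \<le> 0"
      by (intro F_le V dominated_uminus_square v)
    then have "0 \<le> Re z"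
      using v by (simp add: F_minus)
    with \<open>Im z = 0\<close> show "(\<Sum>i<n. cinner (h i) (\<Sum>j<n. \<phi> (a i j) (h j))) \<in> \<real>\<^sub>\<ge>\<^sub>0"
      by (simp add: complex_nonneg_Reals_iff flip: z_def)
  qed
  moreover have "bounded_operator type_hilbert type_hilbert (\<phi> a)" for a
    using \<phi>_norm[of a] unfolding bounded_operator_def hnorm_type_hilbert
    by (auto simp: type_hilbert_def \<phi>_add_right \<phi>_scaleC_right)
  moreover have "linear_into_operators \<phi>"
    by (simp add: linear_into_operators_def \<phi>_add \<phi>_scaleC)
  ultimately have "completely_positive \<phi>"
    by (simp add: completely_positive_def)
  then show thesis
    using adjoint domination by (rule that)
qed

section \<open>Completion of a semi-inner product space\<close>

text \<open>
  An element of the completion is a function \<open>f\<close> of \<open>p\<close>, the limit of \<open>p \<mapsto> \<langle>\<iota> p, u\<^sub>n\<rangle>\<close> for a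
  Cauchy sequence \<open>u\<close>. This passes to the quotient by null vectors at the same time.
\<close>

locale completion = prehilbert W for W :: "'w hilbert" +
  fixes \<iota> :: "'x \<Rightarrow> 'w"
  assumes carrier_UNIV: "hcarrier W = UNIV"
    and total: "\<exists>ps. \<forall>v. hinner W w v = (\<Sum>p\<leftarrow>ps. hinner W (\<iota> p) v)"
begin

lemma in_carrier [simp]: "w \<in> hcarrier W"
  by (simp add: carrier_UNIV)

abbreviation "s \<equiv> hinner W"

definition cauchy :: "(nat \<Rightarrow> 'w) \<Rightarrow> bool"
  where "cauchy u \<longleftrightarrow> (\<forall>e>0. \<exists>N. \<forall>m\<ge>N. \<forall>n\<ge>N. hdist W (u m) (u n) < e)"

definition represents :: "('x \<Rightarrow> complex) \<Rightarrow> (nat \<Rightarrow> 'w) \<Rightarrow> bool"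
  where "represents f u \<longleftrightarrow> cauchy u \<and> (\<forall>p. (\<lambda>n. s (\<iota> p) (u n)) \<longlonglongrightarrow> f p)"

definition repr :: "('x \<Rightarrow> complex) \<Rightarrow> nat \<Rightarrow> 'w"
  where "repr f = (SOME u. represents f u)"

text \<open>The inner product is computed along chosen sequences; \<open>inner_tendsto\<close> shows
  that all representing sequences give the same limit.\<close>

definition completed :: "('x \<Rightarrow> complex) hilbert"
  where "completed = \<lparr>hcarrier = {f. \<exists>u. represents f u}, hzero = (\<lambda>p. 0),
    hadd = (\<lambda>f g p. f p + g p), hscale = (\<lambda>c f p. c * f p),
    hinner = (\<lambda>f g. lim (\<lambda>n. s (repr f n) (repr g n)))\<rparr>"

definition embed :: "'w \<Rightarrow> 'x \<Rightarrow> complex"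
  where "embed w = (\<lambda>p. s (\<iota> p) w)"

lemma cmod_s_le: "cmod (s v w) \<le> hnorm W v * hnorm W w"
  by (rule cauchy_schwarz) simp_all

lemma s_diff: "s v (diff w z) = s v w - s v z" "s (diff w z) v = s w v - s z v"
  by (simp_all add: inner_linear closed)

lemma cauchy_bounded:
  assumes "cauchy u"
  obtains B where "0 \<le> B" "\<And>n. hnorm W (u n) \<le> B"
proof -
  obtain N where N: "\<And>m n. m \<ge> N \<Longrightarrow> n \<ge> N \<Longrightarrow> hdist W (u m) (u n) < 1"
    using assms by (metis cauchy_def zero_less_one)
  define B where "B = (\<Sum>n\<le>N. hnorm W (u n)) + 1"
  have "hnorm W (u n) \<le> B" for n
  proof (cases "n \<le> N")
    case True
    then have "hnorm W (u n) \<le> (\<Sum>n\<le>N. hnorm W (u n))"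
      by (intro member_le_sum) (auto simp: hnorm_nonneg)
    then show ?thesis
      by (simp add: B_def)
  next
    case False
    have "hnorm W (u n) \<le> hdist W (u n) (u N) + hnorm W (u N)"
      by (rule hnorm_le_hdist) simp_all
    moreover have "hnorm W (u N) \<le> (\<Sum>n\<le>N. hnorm W (u n))"
      by (intro member_le_sum) (auto simp: hnorm_nonneg)
    ultimately show ?thesis
      using N[of n N] False by (simp add: B_def)
  qed
  moreover have "0 \<le> B"
    by (simp add: B_def add_nonneg_nonneg sum_nonneg hnorm_nonneg)
  ultimately show ?thesis
    using that by blast
qed

lemma cauchy_const: "cauchy (\<lambda>n. w)"
proof -
  have "hdist W w w = 0"
    by (simp add: hdist_def hnorm_def s_diff)
  then show ?thesis
    by (simp add: cauchy_def)
qed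

lemma cauchy_add:
  assumes "cauchy u" "cauchy v"
  shows "cauchy (\<lambda>n. hadd W (u n) (v n))"
  unfolding cauchy_def
proof (intro allI impI)
  fix e :: real assume "0 < e"
  then obtain M N where M: "\<And>m n. m \<ge> M \<Longrightarrow> n \<ge> M \<Longrightarrow> hdist W (u m) (u n) < e/2"
    and N: "\<And>m n. m \<ge> N \<Longrightarrow> n \<ge> N \<Longrightarrow> hdist W (v m) (v n) < e/2"
    using assms unfolding cauchy_def by (metis half_gt_zero)
  have "hdist W (hadd W (u m) (v m)) (hadd W (u n) (v n)) < e" if "m \<ge> max M N" "n \<ge> max M N" for m n
  proof -
    have "hdist W (hadd W (u m) (v m)) (hadd W (u n) (v n)) = hnorm W (hadd W (diff (u m) (u n)) (diff (v m) (v n)))"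
      unfolding hdist_def by (rule hnorm_cong) (simp_all add: inner_linear closed)
    also have "\<dots> \<le> hdist W (u m) (u n) + hdist W (v m) (v n)"
      unfolding hdist_def by (rule hnorm_triangle) simp_all
    finally show ?thesis
      using M[of m n] N[of m n] that by simp
  qed
  then show "\<exists>N. \<forall>m\<ge>N. \<forall>n\<ge>N. hdist W (hadd W (u m) (v m)) (hadd W (u n) (v n)) < e"
    by blast
qed

lemma hdist_scale: "hdist W (hscale W c v) (hscale W c w) = cmod c * hdist W v w"
proof -
  have "hdist W (hscale W c v) (hscale W c w) = hnorm W (hscale W c (diff v w))"
    unfolding hdist_def by (rule hnorm_cong) (simp_all add: inner_linear closed algebra_simps)
  then show ?thesis
    by (simp add: hnorm_scale hdist_def)
qed

lemma cauchy_scale: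
  assumes "cauchy u"
  shows "cauchy (\<lambda>n. hscale W c (u n))"
  unfolding cauchy_def
proof (intro allI impI)
  fix e :: real assume "0 < e"
  then have "0 < e / (cmod c + 1)"
    by (simp add: add_nonneg_pos)
  then obtain N where N: "\<And>m n. m \<ge> N \<Longrightarrow> n \<ge> N \<Longrightarrow> hdist W (u m) (u n) < e / (cmod c + 1)"
    using assms unfolding cauchy_def by metis
  have "hdist W (hscale W c (u m)) (hscale W c (u n)) < e" if "m \<ge> N" "n \<ge> N" for m n
  proof -
    have "cmod c * hdist W (u m) (u n) \<le> (cmod c + 1) * hdist W (u m) (u n)"
      by (intro mult_right_mono hdist_nonneg) simp_all
    also have "\<dots> < e"
      using N[OF that] by (simp add: pos_less_divide_eq add_nonneg_pos mult.commute)
    finally show ?thesis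
      by (simp add: hdist_scale)
  qed
  then show "\<exists>N. \<forall>m\<ge>N. \<forall>n\<ge>N. hdist W (hscale W c (u m)) (hscale W c (u n)) < e"
    by blast
qed

lemma cauchy_diff: "cauchy u \<Longrightarrow> cauchy v \<Longrightarrow> cauchy (\<lambda>n. diff (u n) (v n))"
  by (intro cauchy_add cauchy_scale)

lemma convergent_s:
  assumes u: "cauchy u" and v: "cauchy v"
  shows "convergent (\<lambda>n. s (u n) (v n))"
proof -
  obtain B where B: "0 \<le> B" "\<And>n. hnorm W (u n) \<le> B"
    using cauchy_bounded[OF u] by blast
  obtain D where D: "0 \<le> D" "\<And>n. hnorm W (v n) \<le> D"
    using cauchy_bounded[OF v] by blast
  have "Cauchy (\<lambda>n. s (u n) (v n))"
  proof (rule CauchyI)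
    fix e :: real assume "0 < e"
    define d where "d = e / (B + D + 1)"
    have pos: "0 < B + D + 1"
      using B(1) D(1) by simp
    then have "0 < d"
      using \<open>0 < e\<close> by (simp add: d_def)
    then obtain M N where M: "\<And>m n. m \<ge> M \<Longrightarrow> n \<ge> M \<Longrightarrow> hdist W (u m) (u n) < d"
      and N: "\<And>m n. m \<ge> N \<Longrightarrow> n \<ge> N \<Longrightarrow> hdist W (v m) (v n) < d"
      using u v unfolding cauchy_def by metis
    have "norm (s (u m) (v m) - s (u n) (v n)) < e" if "m \<ge> max M N" "n \<ge> max M N" for m n
    proof -
      have "s (u m) (v m) - s (u n) (v n) = s (diff (u m) (u n)) (v m) + s (u n) (diff (v m) (v n))"
        by (simp add: s_diff)
      also have "norm \<dots> \<le> hdist W (u m) (u n) * hnorm W (v m) + hnorm W (u n) * hdist W (v m) (v n)"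
        unfolding hdist_def by (intro norm_triangle_mono cmod_s_le)
      also have "\<dots> \<le> d * D + B * d"
        using M[of m n] N[of m n] that B D \<open>0 < d\<close>
        by (intro add_mono mult_mono) (auto simp: hnorm_nonneg hdist_nonneg)
      also have "\<dots> < d * (B + D + 1)"
        using \<open>0 < d\<close> by (simp add: algebra_simps)
      also have "\<dots> = e"
        using pos by (simp add: d_def)
      finally show ?thesis .
    qed
    then show "\<exists>M. \<forall>m\<ge>M. \<forall>n\<ge>M. norm (s (u m) (v m) - s (u n) (v n)) < e"
      by blast
  qed
  then show ?thesis
    by (rule Cauchy_convergent)
qed

lemma s_tendsto_zero:
  assumes "\<And>p. (\<lambda>n. s (\<iota> p) (u n)) \<longlonglongrightarrow> 0"
  shows "(\<lambda>n. s w (u n)) \<longlonglongrightarrow> 0"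
proof -
  obtain ps where ps: "\<And>v. s w v = (\<Sum>p\<leftarrow>ps. s (\<iota> p) v)"
    using total by blast
  have "(\<lambda>n. \<Sum>p\<leftarrow>ps. s (\<iota> p) (u n)) \<longlonglongrightarrow> 0"
  proof (induction ps)
    case (Cons p ps)
    show ?case
      using tendsto_add[OF assms[of p] Cons] by simp
  qed simp
  then show ?thesis
    by (simp add: ps)
qed

text \<open>In |d_n|^2 = <d_N, d_n> + <d_n - d_N, d_n> the second term is small by the Cauchy
  property and the first by weak convergence. Hence values at the generators determine a Cauchy
  sequence up to null sequences.\<close>

lemma hnorm_tendsto_zero:
  assumes d: "cauchy d" and weak: "\<And>p. (\<lambda>n. s (\<iota> p) (d n)) \<longlonglongrightarrow> 0"
  shows "(\<lambda>n. hnorm W (d n)) \<longlonglongrightarrow> 0"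
proof -
  obtain B where B: "0 \<le> B" "\<And>n. hnorm W (d n) \<le> B"
    using cauchy_bounded[OF d] by blast
  have "(\<lambda>n. (hnorm W (d n))\<^sup>2) \<longlonglongrightarrow> 0"
  proof (rule LIMSEQ_I)
    fix e :: real assume "0 < e"
    define \<epsilon> where "\<epsilon> = e / (2 * (B + 1))"
    have "0 < \<epsilon>"
      using \<open>0 < e\<close> B(1) by (simp add: \<epsilon>_def)
    then obtain N where N: "\<And>m n. m \<ge> N \<Longrightarrow> n \<ge> N \<Longrightarrow> hdist W (d m) (d n) < \<epsilon>"
      using d unfolding cauchy_def by metis
    obtain M where M: "\<And>n. n \<ge> M \<Longrightarrow> norm (s (d N) (d n)) < e / 2"
      using LIMSEQ_D[OF s_tendsto_zero[OF weak, of "d N"], of "e/2"] \<open>0 < e\<close> by auto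
    have "norm ((hnorm W (d n))\<^sup>2 - 0) < e" if "n \<ge> max M N" for n
    proof -
      have "of_real ((hnorm W (d n))\<^sup>2) = s (d N) (d n) + s (diff (d n) (d N)) (d n)"
        using inner_self[of "d n"] by (simp add: s_diff)
      then have "(hnorm W (d n))\<^sup>2 = cmod (s (d N) (d n) + s (diff (d n) (d N)) (d n))"
        by (metis abs_of_nonneg norm_of_real zero_le_power2)
      also have "\<dots> \<le> cmod (s (d N) (d n)) + hdist W (d n) (d N) * hnorm W (d n)"
        unfolding hdist_def by (intro norm_triangle_mono cmod_s_le order_refl)
      also have "hdist W (d n) (d N) * hnorm W (d n) \<le> \<epsilon> * B"
        using N[of n N] that B \<open>0 < \<epsilon>\<close> by (intro mult_mono) (auto simp: hnorm_nonneg)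
      also have "\<epsilon> * B \<le> \<epsilon> * (B + 1)"
        using \<open>0 < \<epsilon>\<close> by simp
      also have "\<dots> = e / 2"
        using B(1) by (simp add: \<epsilon>_def field_simps)
      finally show ?thesis
        using M[of n] that by simp
    qed
    then show "\<exists>M. \<forall>n\<ge>M. norm ((hnorm W (d n))\<^sup>2 - 0) < e"
      by blast
  qed
  then have "(\<lambda>n. sqrt ((hnorm W (d n))\<^sup>2)) \<longlonglongrightarrow> sqrt 0"
    by (rule tendsto_real_sqrt)
  then show ?thesis
    by (simp add: hnorm_nonneg)
qed

lemma represents_unique:
  assumes "represents f u" "represents f v"
  shows "(\<lambda>n. hdist W (u n) (v n)) \<longlonglongrightarrow> 0"
  unfolding hdist_def
proof (rule hnorm_tendsto_zero)
  show "cauchy (\<lambda>n. diff (u n) (v n))"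
    using assms by (intro cauchy_diff) (auto simp: represents_def)
  fix p
  have "(\<lambda>n. s (\<iota> p) (u n) - s (\<iota> p) (v n)) \<longlonglongrightarrow> f p - f p"
    using assms by (intro tendsto_diff) (auto simp: represents_def)
  then show "(\<lambda>n. s (\<iota> p) (diff (u n) (v n))) \<longlonglongrightarrow> 0"
    by (simp add: s_diff)
qed

lemma represents_repr: "f \<in> hcarrier completed \<Longrightarrow> represents f (repr f)"
  unfolding completed_def repr_def using someI_ex[of "represents f"] by simp

lemma represents_closed: "represents f u \<Longrightarrow> f \<in> hcarrier completed"
  by (auto simp: completed_def)

lemma inner_tendsto:
  assumes f: "represents f u" and g: "represents g v"
  shows "(\<lambda>n. s (u n) (v n)) \<longlonglongrightarrow> hinner completed f g"
proof -
  define u' v' where "u' = repr f" and "v' = repr g"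
  have f': "represents f u'" and g': "represents g v'"
    unfolding u'_def v'_def using f g represents_closed represents_repr by blast+
  have "(\<lambda>n. s (u' n) (v' n)) \<longlonglongrightarrow> hinner completed f g"
    using convergent_s[of u' v'] f' g'
    by (simp add: completed_def convergent_LIMSEQ_iff represents_def flip: u'_def v'_def)
  moreover have "(\<lambda>n. s (u n) (v n) - s (u' n) (v' n)) \<longlonglongrightarrow> 0"
  proof -
    obtain B where B: "0 \<le> B" "\<And>n. hnorm W (u' n) \<le> B"
      using cauchy_bounded f' unfolding represents_def by blast
    obtain D where D: "0 \<le> D" "\<And>n. hnorm W (v n) \<le> D"
      using cauchy_bounded g unfolding represents_def by blast
    have "(\<lambda>n. hdist W (u n) (u' n) * D + B * hdist W (v n) (v' n)) \<longlonglongrightarrow> 0 * D + B * 0"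
      by (intro tendsto_intros represents_unique[OF f f'] represents_unique[OF g g'])
    then have lim: "(\<lambda>n. hdist W (u n) (u' n) * D + B * hdist W (v n) (v' n)) \<longlonglongrightarrow> 0"
      by simp
    have le: "norm (s (u n) (v n) - s (u' n) (v' n)) \<le> hdist W (u n) (u' n) * D + B * hdist W (v n) (v' n)" for n
    proof -
      have "s (u n) (v n) - s (u' n) (v' n) = s (diff (u n) (u' n)) (v n) + s (u' n) (diff (v n) (v' n))"
        by (simp add: s_diff)
      also have "norm \<dots> \<le> hdist W (u n) (u' n) * hnorm W (v n) + hnorm W (u' n) * hdist W (v n) (v' n)"
        unfolding hdist_def by (intro norm_triangle_mono cmod_s_le)
      also have "\<dots> \<le> hdist W (u n) (u' n) * D + B * hdist W (v n) (v' n)"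
        using B D by (intro add_mono mult_mono) (auto simp: hnorm_nonneg hdist_nonneg)
      finally show ?thesis .
    qed
    show ?thesis
      by (rule Lim_null_comparison[OF always_eventually[OF allI[OF le]] lim])
  qed
  ultimately have "(\<lambda>n. (s (u n) (v n) - s (u' n) (v' n)) + s (u' n) (v' n)) \<longlonglongrightarrow> 0 + hinner completed f g"
    by (intro tendsto_add)
  then show ?thesis
    by simp
qed

lemma represents_add: "represents f u \<Longrightarrow> represents g v \<Longrightarrow> represents (\<lambda>p. f p + g p) (\<lambda>n. hadd W (u n) (v n))"
  by (auto simp: represents_def cauchy_add inner_linear intro: tendsto_add)

lemma represents_scale: "represents f u \<Longrightarrow> represents (\<lambda>p. c * f p) (\<lambda>n. hscale W c (u n))"
  by (auto simp: represents_def cauchy_scale inner_linear intro: tendsto_mult)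

lemma represents_embed: "represents (embed w) (\<lambda>n. w)"
  by (simp add: represents_def cauchy_const embed_def)

lemma represents_zero: "represents (\<lambda>p. 0) (\<lambda>n. hscale W 0 w)"
  by (simp add: represents_def cauchy_const inner_linear)

lemma embed_closed: "embed w \<in> hcarrier completed"
  by (rule represents_closed[OF represents_embed])

lemma inner_embed: "hinner completed (embed v) (embed w) = s v w"
  using inner_tendsto[OF represents_embed represents_embed] LIMSEQ_unique tendsto_const by blast

lemma hadd_completed: "hadd completed f g = (\<lambda>p. f p + g p)"
  by (simp add: completed_def)

lemma hscale_completed: "hscale completed c f = (\<lambda>p. c * f p)"
  by (simp add: completed_def)

lemma hnorm_tendsto:
  assumes "represents f u"
  shows "(\<lambda>n. hnorm W (u n)) \<longlonglongrightarrow> hnorm completed f"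
  unfolding hnorm_def by (intro tendsto_real_sqrt tendsto_Re inner_tendsto assms)

lemma hdist_tendsto:
  assumes "represents f u" "represents g v"
  shows "(\<lambda>n. hdist W (u n) (v n)) \<longlonglongrightarrow> hdist completed f g"
  unfolding hdist_def hadd_completed hscale_completed
  by (intro hnorm_tendsto represents_add represents_scale assms)

lemma prehilbert_completed: "prehilbert completed"
proof
  fix x y z assume "x \<in> hcarrier completed" "y \<in> hcarrier completed" "z \<in> hcarrier completed"
  then obtain u v w where u: "represents x u" and v: "represents y v" and w: "represents z w"
    using represents_repr by blast
  have "(\<lambda>n. s (u n) (hadd W (v n) (w n))) \<longlonglongrightarrow> hinner completed x (hadd completed y z)"
    unfolding hadd_completed by (intro inner_tendsto represents_add u v w)
  moreover have "(\<lambda>n. s (u n) (v n) + s (u n) (w n)) \<longlonglongrightarrow> hinner completed x y + hinner completed x z"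
    by (intro tendsto_add inner_tendsto u v w)
  ultimately show "hinner completed x (hadd completed y z) = hinner completed x y + hinner completed x z"
    by (simp add: inner_linear LIMSEQ_unique)
next
  fix x y and c assume "x \<in> hcarrier completed" "y \<in> hcarrier completed"
  then obtain u v where u: "represents x u" and v: "represents y v"
    using represents_repr by blast
  show "hadd completed x y \<in> hcarrier completed"
    unfolding hadd_completed by (rule represents_closed[OF represents_add[OF u v]])
  have "(\<lambda>n. s (v n) (u n)) \<longlonglongrightarrow> hinner completed y x"
    by (intro inner_tendsto u v)
  moreover have "(\<lambda>n. cnj (s (u n) (v n))) \<longlonglongrightarrow> cnj (hinner completed x y)"
    by (intro tendsto_cnj inner_tendsto u v)
  ultimately show "hinner completed y x = cnj (hinner completed x y)"
    by (simp add: LIMSEQ_unique flip: inner_commute)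
  have "(\<lambda>n. s (u n) (hscale W c (v n))) \<longlonglongrightarrow> hinner completed x (hscale completed c y)"
    unfolding hscale_completed by (intro inner_tendsto represents_scale u v)
  moreover have "(\<lambda>n. c * s (u n) (v n)) \<longlonglongrightarrow> c * hinner completed x y"
    by (intro tendsto_mult tendsto_const inner_tendsto u v)
  ultimately show "hinner completed x (hscale completed c y) = c * hinner completed x y"
    by (simp add: inner_linear LIMSEQ_unique)
next
  fix x and c assume "x \<in> hcarrier completed"
  then obtain u where u: "represents x u"
    using represents_repr by blast
  show "hscale completed c x \<in> hcarrier completed"
    unfolding hscale_completed by (rule represents_closed[OF represents_scale[OF u]])
  have "(\<lambda>n. Re (s (u n) (u n))) \<longlonglongrightarrow> Re (hinner completed x x)"
    by (intro tendsto_Re inner_tendsto u)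
  then show "0 \<le> Re (hinner completed x x)"
    by (rule LIMSEQ_le_const) (auto simp: inner_nonneg)
qed

interpretation compl: prehilbert completed
  by (rule prehilbert_completed)

lemma hdist_embed: "hdist completed (embed v) (embed w) = hdist W v w"
  using hdist_tendsto[OF represents_embed represents_embed] LIMSEQ_unique tendsto_const by blast

lemma embed_dense:
  assumes "f \<in> hcarrier completed" "0 < e"
  obtains w where "hdist completed f (embed w) < e"
proof -
  have u: "represents f (repr f)"
    by (rule represents_repr[OF assms(1)])
  then obtain N where N: "\<And>m n. m \<ge> N \<Longrightarrow> n \<ge> N \<Longrightarrow> hdist W (repr f m) (repr f n) < e/2"
    using assms(2) unfolding represents_def cauchy_def by (metis half_gt_zero)
  have "(\<lambda>n. hdist W (repr f n) (repr f N)) \<longlonglongrightarrow> hdist completed f (embed (repr f N))"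
    by (intro hdist_tendsto u represents_embed)
  then have "hdist completed f (embed (repr f N)) \<le> e/2"
    by (rule LIMSEQ_le_const2) (use N in \<open>auto intro!: exI[of _ N] less_imp_le\<close>)
  then show ?thesis
    using assms(2) by (intro that[of "repr f N"]) simp
qed

text \<open>Each \<open>F n\<close> is replaced by an embedded vector within 1/(n + 1). These
  vectors form a single Cauchy sequence in \<open>W\<close>, and the function it represents is the
  limit.\<close>

lemma completed_complete:
  assumes F: "\<And>n. F n \<in> hcarrier completed"
    and cauchy_F: "\<forall>e>0. \<exists>N::nat. \<forall>m\<ge>N. \<forall>n\<ge>N. hdist completed (F m) (F n) < e"
  shows "\<exists>l\<in>hcarrier completed. (\<lambda>n. hdist completed (F n) l) \<longlonglongrightarrow> 0"
proof -
  have "\<exists>w. hdist completed (F n) (embed w) < 1 / real (Suc n)" for n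
  proof (rule embed_dense[OF F[of n]])
    show "0 < 1 / real (Suc n)"
      by simp
  qed blast
  then obtain w where w: "\<And>n. hdist completed (F n) (embed (w n)) < 1 / real (Suc n)"
    by metis
  have "cauchy w"
    unfolding cauchy_def
  proof (intro allI impI)
    fix e :: real assume "0 < e"
    then obtain N where N: "\<And>m n. m \<ge> N \<Longrightarrow> n \<ge> N \<Longrightarrow> hdist completed (F m) (F n) < e/3"
      using cauchy_F by (metis divide_pos_pos zero_less_numeral)
    obtain M where M: "1 / real (Suc M) < e/3"
      using nat_approx_posE[of "e/3"] \<open>0 < e\<close> by auto
    have "hdist W (w m) (w n) < e" if mn: "m \<ge> max M N" "n \<ge> max M N" for m n
    proof -
      have small: "hdist completed (F k) (embed (w k)) < e/3" if "k \<ge> M" for k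
      proof -
        have "1 / real (Suc k) \<le> 1 / real (Suc M)"
          using that by (auto intro!: divide_left_mono)
        with w[of k] M show ?thesis
          by linarith
      qed
      have "hdist W (w m) (w n) = hdist completed (embed (w m)) (embed (w n))"
        by (simp add: hdist_embed)
      also have "\<dots> \<le> hdist completed (embed (w m)) (F m) + hdist completed (F m) (embed (w n))"
        by (intro compl.hdist_triangle F embed_closed)
      also have "hdist completed (F m) (embed (w n)) \<le> hdist completed (F m) (F n) + hdist completed (F n) (embed (w n))"
        by (intro compl.hdist_triangle F embed_closed)
      also have "hdist completed (embed (w m)) (F m) = hdist completed (F m) (embed (w m))"
        by (intro compl.hdist_commute F embed_closed)
      finally show ?thesis
        using small[of m] small[of n] N[of m n] mn by simp
    qed
    then show "\<exists>N. \<forall>m\<ge>N. \<forall>n\<ge>N. hdist W (w m) (w n) < e"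
      by blast
  qed
  define f where "f p = lim (\<lambda>n. s (\<iota> p) (w n))" for p
  have f: "represents f w"
    unfolding represents_def f_def
    using \<open>cauchy w\<close> convergent_s[OF cauchy_const \<open>cauchy w\<close>] by (simp add: convergent_LIMSEQ_iff)
  have near: "(\<lambda>n. hdist completed (embed (w n)) f) \<longlonglongrightarrow> 0"
  proof (rule LIMSEQ_I)
    fix e :: real assume "0 < e"
    then obtain N where N: "\<And>m n. m \<ge> N \<Longrightarrow> n \<ge> N \<Longrightarrow> hdist W (w m) (w n) < e/2"
      using \<open>cauchy w\<close> unfolding cauchy_def by (metis half_gt_zero)
    have "norm (hdist completed (embed (w n)) f - 0) < e" if "n \<ge> N" for n
    proof -
      have "(\<lambda>m. hdist W (w n) (w m)) \<longlonglongrightarrow> hdist completed (embed (w n)) f"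
        by (intro hdist_tendsto f represents_embed)
      then have "hdist completed (embed (w n)) f \<le> e/2"
        by (rule LIMSEQ_le_const2) (use N that in \<open>auto intro!: exI[of _ N] less_imp_le\<close>)
      then show ?thesis
        using \<open>0 < e\<close> compl.hdist_nonneg[OF embed_closed represents_closed[OF f], of "w n"] by simp
    qed
    then show "\<exists>N. \<forall>n\<ge>N. norm (hdist completed (embed (w n)) f - 0) < e"
      by blast
  qed
  have "(\<lambda>n. 1 / real (Suc n)) \<longlonglongrightarrow> 0"
    by (rule LIMSEQ_Suc[OF lim_1_over_n])
  from tendsto_add[OF this near]
  have lim: "(\<lambda>n. 1 / real (Suc n) + hdist completed (embed (w n)) f) \<longlonglongrightarrow> 0"
    by (simp only: add_0)
  have le: "norm (hdist completed (F n) f) \<le> 1 / real (Suc n) + hdist completed (embed (w n)) f" for n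
    using compl.hdist_triangle[OF F embed_closed represents_closed[OF f], of n "w n"] w[of n]
      compl.hdist_nonneg[OF F represents_closed[OF f], of n] by simp
  have "(\<lambda>n. hdist completed (F n) f) \<longlonglongrightarrow> 0"
    by (rule Lim_null_comparison[OF always_eventually[OF allI[OF le]] lim])
  then show ?thesis
    using represents_closed[OF f] by blast
qed

lemma hilbert_space_completed: "hilbert_space completed"
proof
  show "hzero completed \<in> hcarrier completed"
    using represents_closed[OF represents_zero] by (simp add: completed_def)
  show "x = hzero completed" if x: "x \<in> hcarrier completed" "hinner completed x x = 0" for x
  proof -
    obtain u where u: "represents x u"
      using represents_repr x(1) by blast
    have "hnorm completed x = 0"
      using x(2) by (simp add: hnorm_def)
    then have norm: "(\<lambda>n. hnorm W (u n)) \<longlonglongrightarrow> 0"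
      using hnorm_tendsto[OF u] by simp
    have "x p = 0" for p
    proof (rule LIMSEQ_unique)
      show "(\<lambda>n. s (\<iota> p) (u n)) \<longlonglongrightarrow> x p"
        using u by (simp add: represents_def)
      \<comment> \<open>By Cauchy-Schwarz the norms of a representing sequence control the values of
        the function.\<close>
      show "(\<lambda>n. s (\<iota> p) (u n)) \<longlonglongrightarrow> 0"
        by (rule Lim_null_comparison[OF _ tendsto_mult_right_zero[OF norm, of "hnorm W (\<iota> p)"]])
          (simp add: cmod_s_le)
    qed
    then show ?thesis
      by (simp add: completed_def fun_eq_iff)
  qed
  show "\<exists>l\<in>hcarrier completed. (\<lambda>n. hdist completed (f n) l) \<longlonglongrightarrow> 0"
    if "\<And>n. f n \<in> hcarrier completed" "\<forall>e>0. \<exists>N. \<forall>m\<ge>N. \<forall>n\<ge>N. hdist completed (f m) (f n) < e" for f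
    using that by (rule completed_complete)
qed (fact compl.add_closed compl.scale_closed compl.inner_commute compl.inner_add_right
    compl.inner_scale_right compl.inner_nonneg
    | simp add: hadd_completed hscale_completed fun_eq_iff algebra_simps
    | simp add: completed_def fun_eq_iff)+

text \<open>The bound by the seminorm maps Cauchy sequences to Cauchy sequences and makes the limit
  independent of the representing sequence.\<close>

lemma contraction_extends:
  fixes T :: "'w \<Rightarrow> 'k::chilbert_space"
  assumes T_add: "\<And>v w. T (hadd W v w) = T v + T w"
    and T_scale: "\<And>c w. T (hscale W c w) = c *\<^sub>C T w"
    and T_le: "\<And>w. norm (T w) \<le> hnorm W w"
  obtains S where "bounded_operator completed type_hilbert S" "\<And>w. S (embed w) = T w"
proof -
  define S where "S f = lim (\<lambda>n. T (repr f n))" for f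
  have T_dist: "norm (T v - T w) \<le> hdist W v w" for v w
    using T_le[of "diff v w"] by (simp add: hdist_def T_add T_scale scaleC_one)
  have conv: "convergent (\<lambda>n. T (u n))" if "cauchy u" for u
  proof -
    have "Cauchy (\<lambda>n. T (u n))"
    proof (rule CauchyI)
      fix e :: real assume "0 < e"
      then obtain N where "\<And>m n. m \<ge> N \<Longrightarrow> n \<ge> N \<Longrightarrow> hdist W (u m) (u n) < e"
        using \<open>cauchy u\<close> unfolding cauchy_def by metis
      then show "\<exists>M. \<forall>m\<ge>M. \<forall>n\<ge>M. norm (T (u m) - T (u n)) < e"
        using T_dist le_less_trans by blast
    qed
    then show ?thesis
      by (rule Cauchy_convergent)
  qed
  have S: "(\<lambda>n. T (u n)) \<longlonglongrightarrow> S f" if u: "represents f u" for f u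
  proof -
    have r: "represents f (repr f)"
      by (rule represents_repr[OF represents_closed[OF u]])
    then have "(\<lambda>n. T (repr f n)) \<longlonglongrightarrow> S f"
      using conv[of "repr f"] by (simp add: S_def represents_def convergent_LIMSEQ_iff)
    moreover have "(\<lambda>n. T (u n) - T (repr f n)) \<longlonglongrightarrow> 0"
      by (rule Lim_null_comparison[OF _ represents_unique[OF u r]]) (simp add: T_dist)
    ultimately have "(\<lambda>n. (T (u n) - T (repr f n)) + T (repr f n)) \<longlonglongrightarrow> 0 + S f"
      by (intro tendsto_add)
    then show ?thesis
      by simp
  qed
  have "bounded_operator completed type_hilbert S"
    unfolding bounded_operator_def hnorm_type_hilbert
  proof (intro conjI ballI allI exI)
    fix x y c assume "x \<in> hcarrier completed" "y \<in> hcarrier completed"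
    then obtain u v where u: "represents x u" and v: "represents y v"
      using represents_repr by blast
    have "(\<lambda>n. T (hadd W (u n) (v n))) \<longlonglongrightarrow> S (hadd completed x y)"
      unfolding hadd_completed by (intro S represents_add u v)
    moreover have "(\<lambda>n. T (u n) + T (v n)) \<longlonglongrightarrow> S x + S y"
      by (intro tendsto_add S u v)
    ultimately show "S (hadd completed x y) = hadd type_hilbert (S x) (S y)"
      by (simp add: T_add LIMSEQ_unique type_hilbert_def)
  next
    fix x c assume "x \<in> hcarrier completed"
    then obtain u where u: "represents x u"
      using represents_repr by blast
    have bl: "bounded_linear (\<lambda>k::'k. c *\<^sub>C k)"
      by (rule bounded_linear_intro[where K = "cmod c"]) (simp_all add: scaleC_add_right norm_scaleC)
    have "(\<lambda>n. T (hscale W c (u n))) \<longlonglongrightarrow> S (hscale completed c x)"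
      unfolding hscale_completed by (intro S represents_scale u)
    moreover have "(\<lambda>n. c *\<^sub>C T (u n)) \<longlonglongrightarrow> c *\<^sub>C S x"
      by (intro bounded_linear.tendsto[OF bl] S u)
    ultimately show "S (hscale completed c x) = hscale type_hilbert c (S x)"
      by (simp add: T_scale LIMSEQ_unique type_hilbert_def)
  next
    fix x assume "x \<in> hcarrier completed"
    then obtain u where u: "represents x u"
      using represents_repr by blast
    have "norm (S x) \<le> hnorm completed x"
      by (rule LIMSEQ_le[OF tendsto_norm[OF S[OF u]] hnorm_tendsto[OF u]]) (simp add: T_le)
    then show "norm (S x) \<le> 1 * hnorm completed x"
      by simp
  qed (simp add: type_hilbert_def)
  moreover have "S (embed w) = T w" for w
    using S[OF represents_embed, of w] LIMSEQ_unique tendsto_const by blast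
  ultimately show ?thesis
    by (rule that)
qed

end

text \<open>Concatenation is not commutative and the form is degenerate, so this is only a
  \<open>prehilbert\<close> structure; the completion divides out the null tensors.\<close>

definition tensor_space ::
    "('e \<Rightarrow> 'e \<Rightarrow> 'a) \<Rightarrow> ('a \<Rightarrow> 'h::chilbert_space \<Rightarrow> 'h) \<Rightarrow> ('e \<times> 'h) list hilbert"
  where "tensor_space ip \<phi> = \<lparr>hcarrier = UNIV, hzero = [], hadd = (@),
    hscale = (\<lambda>c. map (\<lambda>(x, h). (x, c *\<^sub>C h))),
    hinner = (\<lambda>X Y. \<Sum>(x, h)\<leftarrow>X. \<Sum>(y, k)\<leftarrow>Y. cinner h (\<phi> (ip x y) k))\<rparr>"

lemma (in cb_map) factors_through_phi_map: "factors_through_phi_map ip \<Phi> TYPE('e \<times> 'h \<Rightarrow> complex)"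
proof (rule phi_exists)
  fix \<phi> :: "'a \<Rightarrow> 'h \<Rightarrow> 'h"
  assume cp: "completely_positive \<phi>"
    and adjoint: "\<And>a h k. cinner h (\<phi> a k) = cinner (\<phi> (star a) h) k"
    and domination: "\<And>X. (norm (tensor_apply \<Phi> X))\<^sup>2 \<le> Re (\<Sum>(x, h)\<leftarrow>X. \<Sum>(y, k)\<leftarrow>X. cinner h (\<phi> (ip x y) k))"
  have bounded: "bounded_operator type_hilbert type_hilbert (\<phi> a)" for a
    using cp by (simp add: completely_positive_def)
  then have \<phi>_add_right: "\<phi> a (h + k) = \<phi> a h + \<phi> a k" and \<phi>_scaleC_right: "\<phi> a (d *\<^sub>C k) = d *\<^sub>C \<phi> a k"
    for a h k d
    by (simp_all add: bounded_operator_def type_hilbert_def)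
  define W where "W = tensor_space ip \<phi>"
  have W_simps: "hcarrier W = UNIV" "hadd W = (@)" "hscale W d X = map (\<lambda>(x, h). (x, d *\<^sub>C h)) X"
    "hinner W X Y = (\<Sum>p\<leftarrow>X. \<Sum>q\<leftarrow>Y. cinner (snd p) (\<phi> (ip (fst p) (fst q)) (snd q)))" for d X Y
    by (simp_all add: W_def tensor_space_def case_prod_unfold)
  \<comment> \<open>The generators are the one-element lists, so the completion consists of
    functions of a pair (x, h).\<close>
  interpret completion W "\<lambda>p. [p]"
  proof
    show "hinner W Y X = cnj (hinner W X Y)" for X Y
    proof -
      have "cnj (cinner h (\<phi> (ip x y) k)) = cinner k (\<phi> (ip y x) h)" for x y h k
        by (metis adjoint cinner_commute ip_star)
      then have "cnj (hinner W X Y) = (\<Sum>i<length X. \<Sum>j<length Y.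
          cinner (snd (Y ! j)) (\<phi> (ip (fst (Y ! j)) (fst (X ! i))) (snd (X ! i))))"
        by (simp add: W_simps sum_list_map_nth)
      also have "\<dots> = hinner W Y X"
        unfolding W_simps sum_list_map_nth by (rule sum.swap)
      finally show ?thesis ..
    qed
    show "hinner W X (hscale W d Y) = d * hinner W X Y" for X Y d
      by (simp add: W_simps o_def case_prod_unfold \<phi>_scaleC_right cinner_scaleC_right sum_list_const_mult)
    show "0 \<le> Re (hinner W X X)" for X
      using order.trans[OF zero_le_power2 domination[of X]] by (simp add: W_simps case_prod_unfold)
    show "\<exists>ps. \<forall>Y. hinner W X Y = (\<Sum>p\<leftarrow>ps. hinner W [p] Y)" for X
      by (rule exI[of _ X]) (simp add: W_simps)
  qed (simp_all add: W_simps sum_list_addf)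
  define \<Gamma> where "\<Gamma> x h = embed [(x, h)]" for x h
  have \<Gamma>_inner: "hinner completed (\<Gamma> x h) (\<Gamma> y k) = cinner h (\<phi> (ip x y) k)" for x y h k
    by (simp add: \<Gamma>_def inner_embed W_simps)
  have \<Gamma>_closed: "\<Gamma> x h \<in> hcarrier completed" for x h
    by (simp add: \<Gamma>_def embed_closed)
  have \<Gamma>_add: "\<Gamma> x (h + k) = hadd completed (\<Gamma> x h) (\<Gamma> x k)"
    and \<Gamma>_scaleC: "\<Gamma> x (d *\<^sub>C h) = hscale completed d (\<Gamma> x h)" for x h k d
    by (simp_all add: \<Gamma>_def embed_def hadd_completed hscale_completed W_simps \<phi>_add_right \<phi>_scaleC_right
        cinner_add_right cinner_scaleC_right)
  have \<Gamma>_bounded: "bounded_operator type_hilbert completed (\<Gamma> x)" for x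
  proof -
    obtain C where C: "0 \<le> C" "\<And>h. norm (\<phi> (ip x x) h) \<le> C * norm h"
      using bounded_operator_type_hilbert[OF bounded] by metis
    have "hnorm completed (\<Gamma> x h) \<le> sqrt C * norm h" for h
    proof -
      have "Re (cinner h (\<phi> (ip x x) h)) \<le> norm h * norm (\<phi> (ip x x) h)"
        unfolding inner_eq_Re_cinner[symmetric] by (rule norm_cauchy_schwarz)
      also have "\<dots> \<le> norm h * (C * norm h)"
        by (intro mult_left_mono C norm_ge_zero)
      finally have "Re (cinner h (\<phi> (ip x x) h)) \<le> (sqrt C * norm h)\<^sup>2"
        using C(1) by (simp add: power_mult_distrib power2_eq_square[of "norm h"] mult_ac)
      then show ?thesis
        using C(1) by (simp add: hnorm_def \<Gamma>_inner real_le_lsqrt)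
    qed
    then show ?thesis
      unfolding bounded_operator_def hnorm_type_hilbert
      by (auto simp: type_hilbert_def \<Gamma>_closed \<Gamma>_add \<Gamma>_scaleC)
  qed
  have "hadjoint type_hilbert completed (\<Gamma> x) (\<Gamma> y h) = \<phi> (ip x y) h" for x y h
  proof (rule cinner_eqI)
    fix g
    have "cinner (hadjoint type_hilbert completed (\<Gamma> x) (\<Gamma> y h)) g = hinner completed (\<Gamma> y h) (\<Gamma> x g)"
      by (intro hilbert_adjoint hilbert_space_completed \<Gamma>_bounded \<Gamma>_closed)
    also have "\<dots> = cinner (\<phi> (ip x y) h) g"
      unfolding \<Gamma>_inner by (metis adjoint ip_star)
    finally show "cinner g (hadjoint type_hilbert completed (\<Gamma> x) (\<Gamma> y h)) = cinner g (\<phi> (ip x y) h)"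
      by (metis cinner_commute)
  qed
  then have "phi_map ip \<phi> completed \<Gamma>"
    by (simp add: phi_map_def \<Gamma>_bounded fun_eq_iff)
  moreover obtain S where "bounded_operator completed type_hilbert S" "\<And>X. S (embed X) = tensor_apply \<Phi> X"
  proof (rule contraction_extends)
    show "tensor_apply \<Phi> (hadd W X Y) = tensor_apply \<Phi> X + tensor_apply \<Phi> Y" for X Y
      by (simp add: W_simps)
    show "tensor_apply \<Phi> (hscale W d X) = d *\<^sub>C tensor_apply \<Phi> X" for d X
      unfolding W_simps by (induction X) (auto simp: \<Phi>_scaleC_right scaleC_add_right)
    show "norm (tensor_apply \<Phi> X) \<le> hnorm W X" for X
      unfolding hnorm_def using domination[of X] by (intro real_le_rsqrt) (simp add: W_simps case_prod_unfold)
  qed blast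
  moreover from this(2) have "\<Phi> x = S \<circ> \<Gamma> x" for x
    by (simp add: \<Gamma>_def fun_eq_iff)
  ultimately show ?thesis
    unfolding factors_through_phi_map_def using cp hilbert_space_completed by blast
qed

text \<open>The carrier type of \<open>L\<close> cannot be quantified: it is fixed where
  \<open>L\<close> is constructed and arbitrary where \<open>L\<close> is given.\<close>

theorem theorem2p1:
  fixes act :: "'e::{complex_normed_vector,banach} \<Rightarrow> 'a::unital_cstar_algebra \<Rightarrow> 'e"
    and ip :: "'e \<Rightarrow> 'e \<Rightarrow> 'a"
    and \<Phi> :: "'e \<Rightarrow> 'h::chilbert_space \<Rightarrow> 'k::chilbert_space"
  assumes "hilbert_cstar_module act ip"
    and "\<And>x. bounded_operator type_hilbert type_hilbert (\<Phi> x)"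
  shows "((linear_into_operators \<Phi> \<and> completely_bounded ip \<Phi>) \<longleftrightarrow>
            factors_through_phi_map ip \<Phi> TYPE('e \<times> 'h \<Rightarrow> complex)) \<and>
         (factors_through_phi_map ip \<Phi> TYPE('l) \<longrightarrow>
            linear_into_operators \<Phi> \<and> completely_bounded ip \<Phi>)"
proof (intro conjI impI iffI)
  assume "linear_into_operators \<Phi> \<and> completely_bounded ip \<Phi>"
  then obtain c where "cb_map act ip \<Phi> c"
    using cb_map_exists[where \<Phi> = \<Phi>, OF assms] by blast
  then show "factors_through_phi_map ip \<Phi> TYPE('e \<times> 'h \<Rightarrow> complex)"
    by (rule cb_map.factors_through_phi_map)
qed (use completely_bounded_if_factors[OF assms(1)] in blast)+

end
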